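(* Let $\mathfrak{g}$ be a finite-dimensional Lie algebra over a field $\mathbb{F}$ of characteristic zero, and let $\Omega_1$, $A$, and $p_\gamma$ be as in the context. Suppose $p\in S^k(\mathfrak{g})^{\mathfrak{g}}:=S^k(\mathfrak{g})\cap S(\mathfrak{g})^{\mathfrak{g}}$ for some $k\in\mathbb{N}_+$. Then \[ p_\gamma\in S^k(\mathfrak{g}\otimes A)^{\mathfrak{g}\otimes A}\quad\text{for all }\gamma\in\mathbb{Z}^\ell\text{ with } \gamma\notin\bigcup_{j=1}^k\Big(\big((\Omega_1-\Omega_1)\setminus\Omega_1\big)^j+\Omega_1^{k-j}\Big). \]
   Context: Tensor products are over $\mathbb{F}$; $\mathbb{N}=\{0,1,2,\dotsc\}$, $\mathbb{N}_+=\{1,2,\dotsc\}$. Fix $\ell\in\mathbb{N}$, $\Gamma=\mathbb{Z}^\ell$, $\Omega=\mathbb{N}^\ell$. Fix $\Omega_0\subseteq\Omega$ such that $\omega+\gamma\in\Omega_0$ for all $\omega\in\Omega$, $\gamma\in\Omega_0$, and such that $\Omega_1=\Omega\setminus\Omega_0$ is finite. Set $A=\mathbb{F}[t_1,\dotsc,t_\ell]/I$, where $I$ is the ideal spanned by $\{t^\omega\mid\omega\in\Omega_0\}$, $t^\omega=t_1^{\omega_1}\dotsm t_\ell^{\omega_\ell}$. Let $\tau^\omega$ be the image of $t^\omega$ in $A$; $\{\tau^\omega\mid\omega\in\Omega_1\}$ is a basis of $A$. The bracket on $\mathfrak{g}\otimes A$ is $[x\otimes a,y\otimes b]=[x,y]\otimes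 ab$. For a Lie algebra $\mathfrak{a}$, $\mathfrak{a}$ acts on the symmetric algebra $S(\mathfrak{a})=\bigoplus_k S^k(\mathfrak{a})$ by derivations extending the adjoint action, and $S(\mathfrak{a})^{\mathfrak{a}}$ is the set of elements annihilated by all of $\mathfrak{a}$; $S^k(\mathfrak{a})^{\mathfrak{a}}=S^k(\mathfrak{a})\cap S(\mathfrak{a})^{\mathfrak{a}}$. Definition of $p_\gamma$: let $a=\sum_{\omega\in\Omega_1}\tau^\omega\in A$ and let $\tau_a\colon S(\mathfrak{g})\to S(\mathfrak{g}\otimes A)$ be the algebra homomorphism extending $x\mapsto x\otimes a$. The algebra $S(\mathfrak{g}\otimes A)$ is $\Gamma$-graded, with $x\otimes\tau^\omega$ of degree $\omega$. For $p\in S(\mathfrak{g})$ and $\gamma\in\Gamma$, $p_\gamma$ is the degree $\gamma$ component of $\tau_a(p)$. For subsets of $\Gamma$: $\Upsilon+\Upsilon'=\{\gamma+\gamma'\mid \gamma\in\Upsilon,\gamma'\in\Upsilon'\}$, $\Upsilon-\Upsilon'=\{\gamma-\gamma'\mid\gamma\in\Upsilon,\gamma'\in\Upsilon'\}$, $\Upsilon^j=\Upsilon+\dotsb+\Upsilon$ ($j$ summands) for $j\in\mathbb{N}_+$, and $\Upsilon^0=\{0\}$. *)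

theory Defs
  imports
    "HOL-Algebra.Algebraic_Closure_Type"
    "HOL-Library.Poly_Mapping"
    "HOL-Library.Multiset"
    "HOL-Library.Set_Algebras"
begin

section \<open>Vector spaces, algebras and their quotients\<close>

text \<open>
  The ground field is the type \<open>'f :: field\<close>. Vector spaces and commutative algebras over it are
  records of type \<^typ>\<open>('f, 'v) module\<close> satisfying \<^locale>\<open>module\<close> resp. \<^locale>\<open>algebra\<close> over
  \<^term>\<open>ring_of_type_algebra :: 'f::field ring\<close>. For a mere vector space the fields \<open>mult\<close> and \<open>one\<close>
  of the record are junk.
\<close>

definition lin_span :: "('f::field, 'v, 'm) module_scheme \<Rightarrow> 'v set \<Rightarrow> 'v set" where
  "lin_span V G =
     {v. \<exists>B c. finite B \<and> B \<subseteq> G \<and> v = (\<Oplus>\<^bsub>V\<^esub>b\<in>B. c b \<odot>\<^bsub>V\<^esub> b)}"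

definition fin_dim :: "('f::field, 'v, 'm) module_scheme \<Rightarrow> bool" where
  "fin_dim V \<longleftrightarrow> (\<exists>B. finite B \<and> B \<subseteq> carrier V \<and> lin_span V B = carrier V)"

text \<open>
  The quotient by an ideal (or, for a mere vector space, by a subspace): the library's factor ring
  with the induced scalar multiplication added.
\<close>

definition quotient :: "('f::field, 'v, 'm) module_scheme \<Rightarrow> 'v set \<Rightarrow> ('f, 'v set) module" where
  "quotient V J =
     ring.extend (V Quot J) (module.fields (\<lambda>c C. \<Union>v\<in>C. J +>\<^bsub>V\<^esub> (c \<odot>\<^bsub>V\<^esub> v)))"

definition free_space :: "'x set \<Rightarrow> ('f::field, 'x \<Rightarrow>\<^sub>0 'f) module" where
  "free_space G =
     \<lparr>carrier = {u. Poly_Mapping.keys u \<subseteq> G}, monoid.mult = undefined, one = undefined,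
      zero = 0, add = (+), module.smult = (\<lambda>c. Poly_Mapping.map ((*) c))\<rparr>"

text \<open>
  The monoid algebra of a submonoid \<open>M\<close> of the additive monoid \<open>'m\<close>. With \<open>M = \<nat>\<^sup>l\<close> this is the
  polynomial algebra in \<open>l\<close> variables; with \<open>M\<close> the finite multisets over a set \<open>G\<close> it is the
  polynomial algebra whose variables are the elements of \<open>G\<close>.
\<close>

definition monoid_algebra :: "'m::comm_monoid_add set \<Rightarrow> ('f::field, 'm \<Rightarrow>\<^sub>0 'f) module" where
  "monoid_algebra M =
     \<lparr>carrier = {p. Poly_Mapping.keys p \<subseteq> M}, monoid.mult = (*), one = 1,
      zero = 0, add = (+), module.smult = (\<lambda>c. Poly_Mapping.map ((*) c))\<rparr>"

definition alg_hom ::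
    "('f::field, 'a, 'm) module_scheme \<Rightarrow> ('f, 'b, 'n) module_scheme \<Rightarrow> ('a \<Rightarrow> 'b) set" where
  "alg_hom S T =
     {h \<in> ring_hom S T. \<forall>c. \<forall>x\<in>carrier S. h (c \<odot>\<^bsub>S\<^esub> x) = c \<odot>\<^bsub>T\<^esub> h x}"

definition derivations :: "('f::field, 'a, 'm) module_scheme \<Rightarrow> ('a \<Rightarrow> 'a) set" where
  "derivations S =
     {D \<in> carrier S \<rightarrow> carrier S.
        (\<forall>x\<in>carrier S. \<forall>y\<in>carrier S. D (x \<oplus>\<^bsub>S\<^esub> y) = D x \<oplus>\<^bsub>S\<^esub> D y) \<and>
        (\<forall>c. \<forall>x\<in>carrier S. D (c \<odot>\<^bsub>S\<^esub> x) = c \<odot>\<^bsub>S\<^esub> D x) \<and>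
        (\<forall>x\<in>carrier S. \<forall>y\<in>carrier S.
           D (x \<otimes>\<^bsub>S\<^esub> y) = D x \<otimes>\<^bsub>S\<^esub> y \<oplus>\<^bsub>S\<^esub> x \<otimes>\<^bsub>S\<^esub> D y)}"


section \<open>Tensor products\<close>

text \<open>
  \<open>V \<otimes> W\<close> is the vector space freely spanned by the pairs \<open>(v, w)\<close>, modulo the bilinearity relations.
\<close>

definition tensor_relations ::
    "('f::field, 'v, 'm) module_scheme \<Rightarrow> ('f, 'w, 'n) module_scheme \<Rightarrow> ('v \<times> 'w \<Rightarrow>\<^sub>0 'f) set" where
  "tensor_relations V W =
     {Poly_Mapping.single (x \<oplus>\<^bsub>V\<^esub> y, w) 1 - Poly_Mapping.single (x, w) 1 - Poly_Mapping.single (y, w) 1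
        | x y w. x \<in> carrier V \<and> y \<in> carrier V \<and> w \<in> carrier W} \<union>
     {Poly_Mapping.single (c \<odot>\<^bsub>V\<^esub> x, w) 1 - Poly_Mapping.single (x, w) c
        | c x w. x \<in> carrier V \<and> w \<in> carrier W} \<union>
     {Poly_Mapping.single (x, w \<oplus>\<^bsub>W\<^esub> z) 1 - Poly_Mapping.single (x, w) 1 - Poly_Mapping.single (x, z) 1
        | x w z. x \<in> carrier V \<and> w \<in> carrier W \<and> z \<in> carrier W} \<union>
     {Poly_Mapping.single (x, c \<odot>\<^bsub>W\<^esub> w) 1 - Poly_Mapping.single (x, w) c
        | c x w. x \<in> carrier V \<and> w \<in> carrier W}"

definition tensor_null ::
    "('f::field, 'v, 'm) module_scheme \<Rightarrow> ('f, 'w, 'n) module_scheme \<Rightarrow> ('v \<times> 'w \<Rightarrow>\<^sub>0 'f) set" where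
  "tensor_null V W =
     lin_span (free_space (carrier V \<times> carrier W) :: ('f, 'v \<times> 'w \<Rightarrow>\<^sub>0 'f) module)
       (tensor_relations V W)"

definition tensor ::
    "('f::field, 'v, 'm) module_scheme \<Rightarrow> ('f, 'w, 'n) module_scheme
      \<Rightarrow> ('f, ('v \<times> 'w \<Rightarrow>\<^sub>0 'f) set) module" where
  "tensor V W = quotient (free_space (carrier V \<times> carrier W)) (tensor_null V W)"

definition pure_tensor ::
    "('f::field, 'v, 'm) module_scheme \<Rightarrow> ('f, 'w, 'n) module_scheme \<Rightarrow> 'v \<Rightarrow> 'w
      \<Rightarrow> ('v \<times> 'w \<Rightarrow>\<^sub>0 'f) set" where
  "pure_tensor V W x w =
     tensor_null V W +>\<^bsub>(free_space (carrier V \<times> carrier W) :: ('f, 'v \<times> 'w \<Rightarrow>\<^sub>0 'f) module)\<^esub>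
       Poly_Mapping.single (x, w) 1"


section \<open>Lie algebras\<close>

record ('f, 'v) lie_alg = "('f, 'v) module" +
  bracket :: "'v \<Rightarrow> 'v \<Rightarrow> 'v"

locale lie_algebra =
  module "ring_of_type_algebra :: 'f::field ring" L
  for L :: "('f::field, 'v, 'm) lie_alg_scheme" (structure) +
  assumes bracket_closed:
      "\<lbrakk>x \<in> carrier L; y \<in> carrier L\<rbrakk> \<Longrightarrow> bracket L x y \<in> carrier L"
    and bracket_add_left:
      "\<lbrakk>x \<in> carrier L; y \<in> carrier L; z \<in> carrier L\<rbrakk>
        \<Longrightarrow> bracket L (x \<oplus>\<^bsub>L\<^esub> y) z = bracket L x z \<oplus>\<^bsub>L\<^esub> bracket L y z"
    and bracket_add_right:
      "\<lbrakk>x \<in> carrier L; y \<in> carrier L; z \<in> carrier L\<rbrakk>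
        \<Longrightarrow> bracket L x (y \<oplus>\<^bsub>L\<^esub> z) = bracket L x y \<oplus>\<^bsub>L\<^esub> bracket L x z"
    and bracket_smult_left:
      "\<lbrakk>x \<in> carrier L; y \<in> carrier L\<rbrakk>
        \<Longrightarrow> bracket L (c \<odot>\<^bsub>L\<^esub> x) y = c \<odot>\<^bsub>L\<^esub> bracket L x y"
    and bracket_smult_right:
      "\<lbrakk>x \<in> carrier L; y \<in> carrier L\<rbrakk>
        \<Longrightarrow> bracket L x (c \<odot>\<^bsub>L\<^esub> y) = c \<odot>\<^bsub>L\<^esub> bracket L x y"
    and bracket_self:
      "x \<in> carrier L \<Longrightarrow> bracket L x x = \<zero>\<^bsub>L\<^esub>"
    and jacobi:
      "\<lbrakk>x \<in> carrier L; y \<in> carrier L; z \<in> carrier L\<rbrakk>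
        \<Longrightarrow> bracket L x (bracket L y z) \<oplus>\<^bsub>L\<^esub> bracket L y (bracket L z x)
              \<oplus>\<^bsub>L\<^esub> bracket L z (bracket L x y) = \<zero>\<^bsub>L\<^esub>"

text \<open>
  The Lie algebra \<open>L \<otimes> A\<close>. The bilinear extension of \<open>[(x, a), (y, b)] = ([x, y], a b)\<close> to the free
  space on pairs is passed to cosets in the same way as \<^const>\<open>rcoset_mult\<close> does for factor rings.
\<close>

definition lie_tensor_pre ::
    "('f::field, 'v, 'm) lie_alg_scheme \<Rightarrow> ('f, 'a, 'n) module_scheme
      \<Rightarrow> ('v \<times> 'a \<Rightarrow>\<^sub>0 'f) \<Rightarrow> ('v \<times> 'a \<Rightarrow>\<^sub>0 'f) \<Rightarrow> ('v \<times> 'a \<Rightarrow>\<^sub>0 'f)" where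
  "lie_tensor_pre L A u v =
     (\<Sum>(x, a)\<in>Poly_Mapping.keys u. \<Sum>(y, b)\<in>Poly_Mapping.keys v.
        Poly_Mapping.single (bracket L x y, a \<otimes>\<^bsub>A\<^esub> b)
          (Poly_Mapping.lookup u (x, a) * Poly_Mapping.lookup v (y, b)))"

definition lie_tensor ::
    "('f::field, 'v, 'm) lie_alg_scheme \<Rightarrow> ('f, 'a, 'n) module_scheme
      \<Rightarrow> ('f, ('v \<times> 'a \<Rightarrow>\<^sub>0 'f) set) lie_alg" where
  "lie_tensor L A =
     module.extend (tensor L A)
       (lie_alg.fields (\<lambda>C D. \<Union>u\<in>C. \<Union>v\<in>D.
          tensor_null L A +>\<^bsub>(free_space (carrier L \<times> carrier A) :: ('f, 'v \<times> 'a \<Rightarrow>\<^sub>0 'f) module)\<^esub>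
            lie_tensor_pre L A u v))"


section \<open>The symmetric algebra and its invariants\<close>

text \<open>
  \<open>S(V)\<close> is the polynomial algebra in variables \<open>X\<^sub>x\<close>, one for each vector \<open>x\<close>, modulo the ideal
  making \<open>x \<mapsto> X\<^sub>x\<close> linear. The variable \<open>X\<^sub>x\<close> is \<open>Poly_Mapping.single {#x#} 1\<close>.
\<close>

definition sym_free :: "('f::field, 'v, 'm) module_scheme \<Rightarrow> ('f, 'v multiset \<Rightarrow>\<^sub>0 'f) module" where
  "sym_free V = monoid_algebra {m. set_mset m \<subseteq> carrier V}"

definition sym_ideal :: "('f::field, 'v, 'm) module_scheme \<Rightarrow> ('v multiset \<Rightarrow>\<^sub>0 'f) set" where
  "sym_ideal V =
     Idl\<^bsub>sym_free V\<^esub>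
       ({Poly_Mapping.single {#x \<oplus>\<^bsub>V\<^esub> y#} 1 - Poly_Mapping.single {#x#} 1 - Poly_Mapping.single {#y#} 1
           | x y. x \<in> carrier V \<and> y \<in> carrier V} \<union>
        {Poly_Mapping.single {#c \<odot>\<^bsub>V\<^esub> x#} 1 - Poly_Mapping.single {#x#} c
           | c x. x \<in> carrier V})"

definition sym_alg ::
    "('f::field, 'v, 'm) module_scheme \<Rightarrow> ('f, ('v multiset \<Rightarrow>\<^sub>0 'f) set) module" where
  "sym_alg V = quotient (sym_free V) (sym_ideal V)"

definition sym_incl ::
    "('f::field, 'v, 'm) module_scheme \<Rightarrow> 'v \<Rightarrow> ('v multiset \<Rightarrow>\<^sub>0 'f) set" where
  "sym_incl V x = sym_ideal V +>\<^bsub>sym_free V\<^esub> Poly_Mapping.single {#x#} 1"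

definition sym_power ::
    "('f::field, 'v, 'm) module_scheme \<Rightarrow> nat \<Rightarrow> ('v multiset \<Rightarrow>\<^sub>0 'f) set set" where
  "sym_power V k =
     lin_span (sym_alg V)
       {\<Otimes>\<^bsub>sym_alg V\<^esub>i\<in>{..<k}. sym_incl V (x i) | x. \<forall>i<k. x i \<in> carrier V}"

definition sym_action ::
    "('f::field, 'v, 'm) lie_alg_scheme \<Rightarrow> 'v
      \<Rightarrow> ('v multiset \<Rightarrow>\<^sub>0 'f) set \<Rightarrow> ('v multiset \<Rightarrow>\<^sub>0 'f) set" where
  "sym_action L x =
     (THE D. D \<in> extensional (carrier (sym_alg L)) \<and> D \<in> derivations (sym_alg L) \<and>
             (\<forall>y\<in>carrier L. D (sym_incl L y) = sym_incl L (bracket L x y)))"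

definition sym_invariants ::
    "('f::field, 'v, 'm) lie_alg_scheme \<Rightarrow> ('v multiset \<Rightarrow>\<^sub>0 'f) set set" where
  "sym_invariants L =
     {q \<in> carrier (sym_alg L). \<forall>x\<in>carrier L. sym_action L x q = \<zero>\<^bsub>sym_alg L\<^esub>}"


section \<open>The truncated polynomial algebra\<close>

text \<open>
  \<open>Gam l = \<int>\<^sup>l\<close> consists of the finitely supported integer sequences supported in \<open>{..<l}\<close>, and
  \<open>Omg l = \<nat>\<^sup>l\<close> is its submonoid of nonnegative ones, so that no coercion between the two is needed.
  The exponent of the monomial \<open>t\<^sup>w\<close> is \<open>w \<in> Omg l\<close>.
\<close>

definition Gam :: "nat \<Rightarrow> (nat \<Rightarrow>\<^sub>0 int) set" where
  "Gam l = {g. Poly_Mapping.keys g \<subseteq> {..<l}}"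

definition Omg :: "nat \<Rightarrow> (nat \<Rightarrow>\<^sub>0 int) set" where
  "Omg l = {g \<in> Gam l. \<forall>i. 0 \<le> Poly_Mapping.lookup g i}"

definition trunc_ideal ::
    "nat \<Rightarrow> (nat \<Rightarrow>\<^sub>0 int) set \<Rightarrow> ((nat \<Rightarrow>\<^sub>0 int) \<Rightarrow>\<^sub>0 'f::field) set" where
  "trunc_ideal l \<Omega>\<^sub>0 =
     Idl\<^bsub>(monoid_algebra (Omg l) :: ('f, (nat \<Rightarrow>\<^sub>0 int) \<Rightarrow>\<^sub>0 'f) module)\<^esub>
       ((\<lambda>w. Poly_Mapping.single w 1) ` \<Omega>\<^sub>0)"

definition trunc_alg ::
    "nat \<Rightarrow> (nat \<Rightarrow>\<^sub>0 int) set \<Rightarrow> ('f::field, ((nat \<Rightarrow>\<^sub>0 int) \<Rightarrow>\<^sub>0 'f) set) module" where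
  "trunc_alg l \<Omega>\<^sub>0 = quotient (monoid_algebra (Omg l)) (trunc_ideal l \<Omega>\<^sub>0)"

definition tau ::
    "nat \<Rightarrow> (nat \<Rightarrow>\<^sub>0 int) set \<Rightarrow> (nat \<Rightarrow>\<^sub>0 int) \<Rightarrow> ((nat \<Rightarrow>\<^sub>0 int) \<Rightarrow>\<^sub>0 'f::field) set" where
  "tau l \<Omega>\<^sub>0 w =
     trunc_ideal l \<Omega>\<^sub>0
       +>\<^bsub>(monoid_algebra (Omg l) :: ('f, (nat \<Rightarrow>\<^sub>0 int) \<Rightarrow>\<^sub>0 'f) module)\<^esub> Poly_Mapping.single w 1"

definition tau_sum ::
    "nat \<Rightarrow> (nat \<Rightarrow>\<^sub>0 int) set \<Rightarrow> ((nat \<Rightarrow>\<^sub>0 int) \<Rightarrow>\<^sub>0 'f::field) set" where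
  "tau_sum l \<Omega>\<^sub>0 =
     (\<Oplus>\<^bsub>(trunc_alg l \<Omega>\<^sub>0 :: ('f, _) module)\<^esub>w\<in>Omg l - \<Omega>\<^sub>0. tau l \<Omega>\<^sub>0 w)"


section \<open>The elements \<open>p\<^sub>\<gamma>\<close>\<close>

text \<open>The type of elements of \<open>S(L \<otimes> A)\<close>.\<close>

type_synonym ('f, 'v) sym_current =
  "(('v \<times> ((nat \<Rightarrow>\<^sub>0 int) \<Rightarrow>\<^sub>0 'f) set \<Rightarrow>\<^sub>0 'f) set multiset \<Rightarrow>\<^sub>0 'f) set"

definition current ::
    "nat \<Rightarrow> (nat \<Rightarrow>\<^sub>0 int) set \<Rightarrow> ('f::field, 'v, 'm) lie_alg_scheme
      \<Rightarrow> ('f, ('v \<times> ((nat \<Rightarrow>\<^sub>0 int) \<Rightarrow>\<^sub>0 'f) set \<Rightarrow>\<^sub>0 'f) set) lie_alg" where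
  "current l \<Omega>\<^sub>0 L = lie_tensor L (trunc_alg l \<Omega>\<^sub>0)"

definition tau_map ::
    "nat \<Rightarrow> (nat \<Rightarrow>\<^sub>0 int) set \<Rightarrow> ('f::field, 'v, 'm) lie_alg_scheme
      \<Rightarrow> ('v multiset \<Rightarrow>\<^sub>0 'f) set \<Rightarrow> ('f, 'v) sym_current" where
  "tau_map l \<Omega>\<^sub>0 L =
     (THE h. h \<in> extensional (carrier (sym_alg L)) \<and>
             h \<in> alg_hom (sym_alg L) (sym_alg (current l \<Omega>\<^sub>0 L)) \<and>
             (\<forall>x\<in>carrier L. h (sym_incl L x) =
                sym_incl (current l \<Omega>\<^sub>0 L) (pure_tensor L (trunc_alg l \<Omega>\<^sub>0) x (tau_sum l \<Omega>\<^sub>0))))"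

definition degree_space ::
    "nat \<Rightarrow> (nat \<Rightarrow>\<^sub>0 int) set \<Rightarrow> ('f::field, 'v, 'm) lie_alg_scheme \<Rightarrow> (nat \<Rightarrow>\<^sub>0 int)
      \<Rightarrow> ('f, 'v) sym_current set" where
  "degree_space l \<Omega>\<^sub>0 L \<gamma> =
     lin_span (sym_alg (current l \<Omega>\<^sub>0 L))
       {\<Otimes>\<^bsub>sym_alg (current l \<Omega>\<^sub>0 L)\<^esub>i\<in>{..<n}.
            sym_incl (current l \<Omega>\<^sub>0 L) (pure_tensor L (trunc_alg l \<Omega>\<^sub>0) (x i) (tau l \<Omega>\<^sub>0 (w i)))
          | (n::nat) x w. (\<forall>i<n. x i \<in> carrier L \<and> w i \<in> Omg l - \<Omega>\<^sub>0) \<and> (\<Sum>i<n. w i) = \<gamma>}"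

text \<open>
  The degree \<open>\<gamma>\<close> component is the \<open>\<gamma>\<close>-th entry of the unique decomposition into homogeneous elements.
\<close>

definition degree_component ::
    "nat \<Rightarrow> (nat \<Rightarrow>\<^sub>0 int) set \<Rightarrow> ('f::field, 'v, 'm) lie_alg_scheme \<Rightarrow> (nat \<Rightarrow>\<^sub>0 int)
      \<Rightarrow> ('f, 'v) sym_current \<Rightarrow> ('f, 'v) sym_current" where
  "degree_component l \<Omega>\<^sub>0 L \<gamma> q =
     (THE r. \<exists>c. (\<forall>\<delta>\<in>Gam l. c \<delta> \<in> degree_space l \<Omega>\<^sub>0 L \<delta>) \<and>
                 finite {\<delta>\<in>Gam l. c \<delta> \<noteq> \<zero>\<^bsub>sym_alg (current l \<Omega>\<^sub>0 L)\<^esub>} \<and>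
                 q = (\<Oplus>\<^bsub>sym_alg (current l \<Omega>\<^sub>0 L)\<^esub>\<delta>
                        \<in>{\<delta>\<in>Gam l. c \<delta> \<noteq> \<zero>\<^bsub>sym_alg (current l \<Omega>\<^sub>0 L)\<^esub>}. c \<delta>) \<and>
                 r = c \<gamma>)"

definition p_component ::
    "nat \<Rightarrow> (nat \<Rightarrow>\<^sub>0 int) set \<Rightarrow> ('f::field, 'v, 'm) lie_alg_scheme
      \<Rightarrow> ('v multiset \<Rightarrow>\<^sub>0 'f) set \<Rightarrow> (nat \<Rightarrow>\<^sub>0 int) \<Rightarrow> ('f, 'v) sym_current" where
  "p_component l \<Omega>\<^sub>0 L p \<gamma> = degree_component l \<Omega>\<^sub>0 L \<gamma> (tau_map l \<Omega>\<^sub>0 L p)"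


section \<open>Subsets of \<open>\<int>\<^sup>l\<close>\<close>

text \<open>Sums of sets are those of \<^theory>\<open>HOL-Library.Set_Algebras\<close>; \<open>-\<close> on sets is set difference.\<close>

definition diffset :: "'a::ab_group_add set \<Rightarrow> 'a set \<Rightarrow> 'a set" where
  "diffset U V = {u - v | u v. u \<in> U \<and> v \<in> V}"

primrec sumset_pow :: "'a::comm_monoid_add set \<Rightarrow> nat \<Rightarrow> 'a set" where
  "sumset_pow U 0 = {0}"
| "sumset_pow U (Suc j) = U + sumset_pow U j"

end

theory Submission
  imports Defs
begin

text \<open>
  The derivation by which \<open>x \<otimes> \<tau>\<^sup>\<sigma>\<close> acts on \<open>S(L \<otimes> A)\<close> raises degrees by \<open>\<sigma>\<close>, and up to truncation
  effects it turns the degree \<open>\<gamma>\<close> part of \<open>\<tau>\<^sub>a(p)\<close> into the degree \<open>\<gamma> + \<sigma>\<close> part of \<open>\<tau>\<^sub>a(x \<cdot> p)\<close>,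
  which vanishes when \<open>p\<close> is invariant. So the whole matter is to see that for the given \<open>\<gamma>\<close> there
  are no truncation effects.

  Write \<open>p\<close> as a combination of products \<open>x\<^sub>1 \<cdots> x\<^sub>k\<close>. The degree \<open>\<gamma>\<close> part of the image of such a
  product is the sum of \<open>\<Prod>\<^sub>i x\<^sub>i \<otimes> \<tau>\<^bsup>\<omega>\<^sub>i\<^esup>\<close> over all tuples in \<open>\<Omega>\<^sub>1\<close> with sum \<open>\<gamma>\<close>. Acting with
  \<open>x \<otimes> \<tau>\<^sup>\<sigma>\<close> on the \<open>i\<close>-th factor replaces \<open>x\<^sub>i\<close> by \<open>[x, x\<^sub>i]\<close> and \<open>\<omega>\<^sub>i\<close> by \<open>\<omega>'\<^sub>i = \<sigma> + \<omega>\<^sub>i\<close>, and terms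
  with \<open>\<sigma> + \<omega>\<^sub>i \<in> \<Omega>\<^sub>0\<close> vanish. The degree \<open>\<gamma> + \<sigma>\<close> part of \<open>\<tau>\<^sub>a(x \<cdot> p)\<close> is the sum of the same terms
  over all tuples \<open>\<omega>'\<close> in \<open>\<Omega>\<^sub>1\<close> with sum \<open>\<gamma> + \<sigma>\<close>. What it has in excess are the terms with
  \<open>\<omega>'\<^sub>i - \<sigma> \<notin> \<Omega>\<^sub>1\<close>; for them
  \<open>\<gamma> = (\<omega>'\<^sub>i - \<sigma>) + \<Sum>\<^bsub>j \<noteq> i\<^esub> \<omega>'\<^sub>j\<close> lies in \<open>((\<Omega>\<^sub>1 - \<Omega>\<^sub>1) \<setminus> \<Omega>\<^sub>1) + \<Omega>\<^sub>1\<^bsup>k-1\<^esup>\<close>, the set of the union with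
  index \<open>j = 1\<close>. This is \<open>action_part_monomial\<close>, proved by induction on \<open>k\<close>: splitting off one factor
  turns the sums over tuples into sums over the single exponent of that factor (\<open>part_mult\<close>).

  For this to be a proof about the objects in the theorem, each of them has to be identified by its
  universal property: quotients (\<open>quotient_map_exists\<close>), the tensor product (\<open>tensor_map_exists\<close>),
  the bracket on pure tensors (\<open>bracket_tens\<close>), the symmetric algebra (\<open>sym_alg_hom_exists\<close> and, for
  the action, \<open>derivation_exists\<close>). The degree \<open>\<gamma>\<close> component is meaningful because the homogeneous
  subspaces of \<open>S(L \<otimes> A)\<close> are independent: there are derivations \<open>D\<^sub>i\<close> with
  \<open>D\<^sub>i (x \<otimes> \<tau>\<^sup>\<omega>) = \<omega>\<^sub>i (x \<otimes> \<tau>\<^sup>\<omega>)\<close>, so that the subspace of degree \<open>\<delta>\<close> consists of joint eigenvectors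
  with eigenvalues \<open>\<delta>\<^sub>i\<close>, and in characteristic zero these separate the degrees
  (\<open>degree_spaces_independent\<close>).
\<close>

section \<open>Vector spaces, linear maps and commutative algebras\<close>

lemma field_ring_simps [simp]:
  "carrier (ring_of_type_algebra :: 'f::field ring) = UNIV"
  "monoid.mult (ring_of_type_algebra :: 'f::field ring) = (*)"
  "one (ring_of_type_algebra :: 'f::field ring) = 1"
  "zero (ring_of_type_algebra :: 'f::field ring) = 0"
  "add (ring_of_type_algebra :: 'f::field ring) = (+)"
  by (simp_all add: ring_of_type_algebra_def)

definition lin_subspace :: "('f::field, 'v, 'm) module_scheme \<Rightarrow> 'v set \<Rightarrow> bool" where
  "lin_subspace V U \<longleftrightarrow> U \<subseteq> carrier V \<and> \<zero>\<^bsub>V\<^esub> \<in> U \<and>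
     (\<forall>x\<in>U. \<forall>y\<in>U. x \<oplus>\<^bsub>V\<^esub> y \<in> U) \<and> (\<forall>c. \<forall>x\<in>U. c \<odot>\<^bsub>V\<^esub> x \<in> U)"

lemma lin_subspaceI:
  assumes "U \<subseteq> carrier V" "\<zero>\<^bsub>V\<^esub> \<in> U"
    and "\<And>x y. x \<in> U \<Longrightarrow> y \<in> U \<Longrightarrow> x \<oplus>\<^bsub>V\<^esub> y \<in> U"
    and "\<And>c x. x \<in> U \<Longrightarrow> c \<odot>\<^bsub>V\<^esub> x \<in> U"
  shows "lin_subspace V U"
  using assms by (auto simp: lin_subspace_def)

definition lin_maps ::
    "('f::field, 'v, 'm) module_scheme \<Rightarrow> ('f, 'w, 'n) module_scheme \<Rightarrow> ('v \<Rightarrow> 'w) set" where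
  "lin_maps V W =
     {f \<in> carrier V \<rightarrow> carrier W.
        (\<forall>x\<in>carrier V. \<forall>y\<in>carrier V. f (x \<oplus>\<^bsub>V\<^esub> y) = f x \<oplus>\<^bsub>W\<^esub> f y) \<and>
        (\<forall>c. \<forall>x\<in>carrier V. f (c \<odot>\<^bsub>V\<^esub> x) = c \<odot>\<^bsub>W\<^esub> f x)}"

lemma lin_mapsI:
  assumes "\<And>x. x \<in> carrier V \<Longrightarrow> f x \<in> carrier W"
    and "\<And>x y. x \<in> carrier V \<Longrightarrow> y \<in> carrier V \<Longrightarrow> f (x \<oplus>\<^bsub>V\<^esub> y) = f x \<oplus>\<^bsub>W\<^esub> f y"
    and "\<And>c x. x \<in> carrier V \<Longrightarrow> f (c \<odot>\<^bsub>V\<^esub> x) = c \<odot>\<^bsub>W\<^esub> f x"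
  shows "f \<in> lin_maps V W"
  using assms by (auto simp: lin_maps_def)

lemma lin_maps_closed: "f \<in> lin_maps V W \<Longrightarrow> x \<in> carrier V \<Longrightarrow> f x \<in> carrier W"
  and lin_maps_add: "f \<in> lin_maps V W \<Longrightarrow> x \<in> carrier V \<Longrightarrow> y \<in> carrier V \<Longrightarrow>
    f (x \<oplus>\<^bsub>V\<^esub> y) = f x \<oplus>\<^bsub>W\<^esub> f y"
  and lin_maps_smult: "f \<in> lin_maps V W \<Longrightarrow> x \<in> carrier V \<Longrightarrow> f (c \<odot>\<^bsub>V\<^esub> x) = c \<odot>\<^bsub>W\<^esub> f x"
  by (auto simp: lin_maps_def)

lemma lin_maps_comp:
  "f \<in> lin_maps U V \<Longrightarrow> g \<in> lin_maps V W \<Longrightarrow> (\<lambda>x. g (f x)) \<in> lin_maps U W"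
  by (intro lin_mapsI) (simp_all add: lin_maps_closed lin_maps_add lin_maps_smult)

text \<open>
  Vector spaces over the field \<open>'f\<close>. Membership of scalars in the carrier of the ground ring is
  vacuous here, so the module laws are restated without it.
\<close>
locale vec = module "ring_of_type_algebra :: 'f::field ring" V
  for V :: "('f::field, 'v, 'm) module_scheme" (structure)
begin

lemma scal_closed [simp, intro]: "x \<in> carrier V \<Longrightarrow> c \<odot> x \<in> carrier V"
  by (rule smult_closed) auto

lemma scal_add_left: "x \<in> carrier V \<Longrightarrow> (c + d) \<odot> x = c \<odot> x \<oplus> d \<odot> x"
  using smult_l_distr[of c d x] by simp

lemma scal_add_right: "x \<in> carrier V \<Longrightarrow> y \<in> carrier V \<Longrightarrow> c \<odot> (x \<oplus> y) = c \<odot> x \<oplus> c \<odot> y"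
  using smult_r_distr[of c x y] by simp

lemma scal_mult: "x \<in> carrier V \<Longrightarrow> (c * d) \<odot> x = c \<odot> (d \<odot> x)"
  using smult_assoc1[of c d x] by simp

lemma scal_one [simp]: "x \<in> carrier V \<Longrightarrow> 1 \<odot> x = x"
  using smult_one[of x] by simp

lemma scal_zero_left [simp]: "x \<in> carrier V \<Longrightarrow> 0 \<odot> x = \<zero>"
  using smult_l_null[of x] by simp

lemma scal_zero_right [simp]: "c \<odot> \<zero> = \<zero>"
  using smult_r_null[of c] by simp

lemma scal_minus_one: "x \<in> carrier V \<Longrightarrow> (- 1) \<odot> x = \<ominus> x"
  using scal_add_left[of x "-1" 1] by (intro minus_equality[symmetric]) auto

lemma scal_finsum: "f \<in> A \<rightarrow> carrier V \<Longrightarrow> c \<odot> (\<Oplus>i\<in>A. f i) = (\<Oplus>i\<in>A. c \<odot> f i)"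
  by (cases "finite A") (auto simp: finsum_smult_ldistr)

lemma scal_eq_zero: "x \<in> carrier V \<Longrightarrow> c \<odot> x = \<zero> \<Longrightarrow> c \<noteq> 0 \<Longrightarrow> x = \<zero>"
  using scal_mult[of x "inverse c" c] by simp

lemma subspace_minus: "lin_subspace V U \<Longrightarrow> x \<in> U \<Longrightarrow> \<ominus> x \<in> U"
  using scal_minus_one[of x] by (auto simp: lin_subspace_def) (metis subsetD)

lemma subspace_finsum:
  assumes "lin_subspace V U" "\<And>a. a \<in> A \<Longrightarrow> f a \<in> U"
  shows "(\<Oplus>a\<in>A. f a) \<in> U"
  using assms
proof (induction A rule: infinite_finite_induct)
  case (insert a A)
  then have "f \<in> A \<rightarrow> carrier V" "f a \<in> carrier V" by (auto simp: lin_subspace_def)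
  with insert show ?case by (auto simp: lin_subspace_def)
qed (auto simp: lin_subspace_def)

lemma lin_span_superset: "G \<subseteq> carrier V \<Longrightarrow> G \<subseteq> lin_span V G"
proof
  fix g assume "G \<subseteq> carrier V" "g \<in> G"
  then show "g \<in> lin_span V G"
    unfolding lin_span_def by (intro CollectI exI[of _ "{g}"] exI[of _ "\<lambda>_. 1"]) auto
qed

lemma lin_span_minimal:
  assumes "lin_subspace V U" "G \<subseteq> U"
  shows "lin_span V G \<subseteq> U"
proof
  fix v assume "v \<in> lin_span V G"
  then obtain B c where "B \<subseteq> G" "v = (\<Oplus>b\<in>B. c b \<odot> b)" by (auto simp: lin_span_def)
  with assms show "v \<in> U" by (auto intro!: subspace_finsum simp: lin_subspace_def subset_iff)
qed

lemma subspace_carrier: "lin_subspace V (carrier V)"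
  by (auto simp: lin_subspace_def)

lemma lin_span_subspace:
  assumes G: "G \<subseteq> carrier V"
  shows "lin_subspace V (lin_span V G)"
proof (rule lin_subspaceI)
  show "lin_span V G \<subseteq> carrier V"
    using lin_span_minimal[OF subspace_carrier G] .
  show "\<zero> \<in> lin_span V G"
    unfolding lin_span_def by (intro CollectI exI[of _ "{}"]) auto
next
  fix x y assume "x \<in> lin_span V G" "y \<in> lin_span V G"
  then obtain B C b c where B: "finite B" "B \<subseteq> G" "x = (\<Oplus>v\<in>B. b v \<odot> v)"
    and C: "finite C" "C \<subseteq> G" "y = (\<Oplus>v\<in>C. c v \<odot> v)"
    by (auto simp: lin_span_def)
  have "x = (\<Oplus>v\<in>B \<union> C. (if v \<in> B then b v else 0) \<odot> v)"
    unfolding B(3) using B C G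
    by (intro add.finprod_mono_neutral_cong_left) (auto simp: subset_iff)
  moreover have "y = (\<Oplus>v\<in>B \<union> C. (if v \<in> C then c v else 0) \<odot> v)"
    unfolding C(3) using B C G
    by (intro add.finprod_mono_neutral_cong_left) (auto simp: subset_iff)
  ultimately have "x \<oplus> y = (\<Oplus>v\<in>B \<union> C. ((if v \<in> B then b v else 0) + (if v \<in> C then c v else 0)) \<odot> v)"
    using B C G by (subst finsum_cong'[OF refl _ scal_add_left]) (auto simp: subset_iff)
  then show "x \<oplus> y \<in> lin_span V G"
    unfolding lin_span_def using B C
    by (intro CollectI exI[of _ "B \<union> C"]
        exI[of _ "\<lambda>v. (if v \<in> B then b v else 0) + (if v \<in> C then c v else 0)"]) auto
next
  fix a x assume "x \<in> lin_span V G"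
  then obtain B b where B: "finite B" "B \<subseteq> G" "x = (\<Oplus>v\<in>B. b v \<odot> v)"
    by (auto simp: lin_span_def)
  have "a \<odot> x = (\<Oplus>v\<in>B. (a * b v) \<odot> v)"
    unfolding B(3) using B G
    by (subst scal_finsum) (auto simp: subset_iff scal_mult intro!: finsum_cong')
  then show "a \<odot> x \<in> lin_span V G"
    unfolding lin_span_def using B by (intro CollectI exI[of _ B] exI[of _ "\<lambda>v. a * b v"]) auto
qed

end

lemma lin_maps_zero:
  assumes "vec V" "vec W" "f \<in> lin_maps V W"
  shows "f \<zero>\<^bsub>V\<^esub> = \<zero>\<^bsub>W\<^esub>"
proof -
  interpret V: vec V by fact
  interpret W: vec W by fact
  have "f (0 \<odot>\<^bsub>V\<^esub> \<zero>\<^bsub>V\<^esub>) = 0 \<odot>\<^bsub>W\<^esub> f \<zero>\<^bsub>V\<^esub>"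
    using assms(3) by (rule lin_maps_smult) simp
  then show ?thesis using lin_maps_closed[OF assms(3), of "\<zero>\<^bsub>V\<^esub>"] by simp
qed

lemma lin_maps_finsum:
  assumes "vec V" "vec W" "f \<in> lin_maps V W" "g \<in> A \<rightarrow> carrier V"
  shows "f (\<Oplus>\<^bsub>V\<^esub>a\<in>A. g a) = (\<Oplus>\<^bsub>W\<^esub>a\<in>A. f (g a))"
proof -
  interpret V: vec V by fact
  interpret W: vec W by fact
  show ?thesis using assms(4)
  proof (induction A rule: infinite_finite_induct)
    case (insert a A)
    then have "f (\<Oplus>\<^bsub>V\<^esub>a\<in>insert a A. g a) = f (g a) \<oplus>\<^bsub>W\<^esub> f (\<Oplus>\<^bsub>V\<^esub>a\<in>A. g a)"
      by (simp add: lin_maps_add[OF assms(3)])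
    also have "\<dots> = f (g a) \<oplus>\<^bsub>W\<^esub> (\<Oplus>\<^bsub>W\<^esub>a\<in>A. f (g a))"
      using insert by simp
    also have "\<dots> = (\<Oplus>\<^bsub>W\<^esub>a\<in>insert a A. f (g a))"
      using insert lin_maps_closed[OF assms(3)] by (subst W.finsum_insert) auto
    finally show ?case .
  qed (auto simp: lin_maps_zero[OF assms(1-3)])
qed

lemma lin_maps_preimage:
  assumes "vec V" "vec W" "f \<in> lin_maps V W" "lin_subspace W U"
  shows "lin_subspace V {x \<in> carrier V. f x \<in> U}"
proof -
  interpret V: vec V by fact
  show ?thesis using assms(4) lin_maps_zero[OF assms(1-3)]
    by (intro lin_subspaceI) (auto simp: lin_subspace_def lin_maps_add[OF assms(3)] lin_maps_smult[OF assms(3)])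
qed

text \<open>
  Together with the lemmas named \<open>_generated\<close> below, this turns an identity between linear maps
  into a check on generators.
\<close>
lemma lin_maps_eq_subspace:
  assumes "vec V" "vec W" "f \<in> lin_maps V W" "g \<in> lin_maps V W"
  shows "lin_subspace V {x \<in> carrier V. f x = g x}"
proof -
  interpret V: vec V by fact
  show ?thesis using lin_maps_zero[OF assms(1-3)] lin_maps_zero[OF assms(1,2,4)]
    by (intro lin_subspaceI)
      (auto simp: lin_maps_add[OF assms(3)] lin_maps_smult[OF assms(3)]
        lin_maps_add[OF assms(4)] lin_maps_smult[OF assms(4)])
qed

text \<open>
  Commutative associative unital algebras over \<open>'f\<close>.
\<close>
locale calg = algebra "ring_of_type_algebra :: 'f::field ring" S
  for S :: "('f::field, 'a, 'm) module_scheme" (structure)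

sublocale calg \<subseteq> vec S ..

context calg begin

lemma scal_mult_left: "x \<in> carrier S \<Longrightarrow> y \<in> carrier S \<Longrightarrow> (c \<odot> x) \<otimes> y = c \<odot> (x \<otimes> y)"
  using smult_assoc2[of c x y] by simp

lemma scal_mult_right: "x \<in> carrier S \<Longrightarrow> y \<in> carrier S \<Longrightarrow> x \<otimes> (c \<odot> y) = c \<odot> (x \<otimes> y)"
  using scal_mult_left[of y x c] by (simp add: m_comm)

lemma mult_left_lin: "x \<in> carrier S \<Longrightarrow> (\<lambda>y. x \<otimes> y) \<in> lin_maps S S"
  by (auto intro!: lin_mapsI simp: r_distr scal_mult_right)

lemma mult_right_lin: "x \<in> carrier S \<Longrightarrow> (\<lambda>y. y \<otimes> x) \<in> lin_maps S S"
  by (auto intro!: lin_mapsI simp: l_distr scal_mult_left)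

lemma ideal_subspace: "ideal J S \<Longrightarrow> lin_subspace S J"
proof -
  assume "ideal J S"
  then interpret J: ideal J S .
  show "lin_subspace S J"
  proof (rule lin_subspaceI)
    fix c x assume x: "x \<in> J"
    then have "x \<in> carrier S" by auto
    with x show "c \<odot> x \<in> J"
      using J.I_l_closed[of x "c \<odot> \<one>"] by (simp add: scal_mult_left)
  qed auto
qed

end

lemma alg_hom_lin: "h \<in> alg_hom S T \<Longrightarrow> h \<in> lin_maps S T"
  by (auto simp: alg_hom_def lin_maps_def ring_hom_def)

lemma derivations_lin: "D \<in> derivations S \<Longrightarrow> D \<in> lin_maps S S"
  by (auto simp: derivations_def lin_maps_def)

lemma vecI:
  assumes "abelian_group V"
    and "\<And>c x. x \<in> carrier V \<Longrightarrow> c \<odot>\<^bsub>V\<^esub> x \<in> carrier V"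
    and "\<And>c d x. x \<in> carrier V \<Longrightarrow> (c + d) \<odot>\<^bsub>V\<^esub> x = c \<odot>\<^bsub>V\<^esub> x \<oplus>\<^bsub>V\<^esub> d \<odot>\<^bsub>V\<^esub> x"
    and "\<And>c x y. x \<in> carrier V \<Longrightarrow> y \<in> carrier V \<Longrightarrow>
      c \<odot>\<^bsub>V\<^esub> (x \<oplus>\<^bsub>V\<^esub> y) = c \<odot>\<^bsub>V\<^esub> x \<oplus>\<^bsub>V\<^esub> c \<odot>\<^bsub>V\<^esub> y"
    and "\<And>c d x. x \<in> carrier V \<Longrightarrow> (c * d) \<odot>\<^bsub>V\<^esub> x = c \<odot>\<^bsub>V\<^esub> (d \<odot>\<^bsub>V\<^esub> x)"
    and "\<And>x. x \<in> carrier V \<Longrightarrow> 1 \<odot>\<^bsub>V\<^esub> x = x"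
  shows "vec V"
  unfolding vec_def using assms
  by (intro moduleI) (auto intro: cring_from_type_algebra)

lemma vec_cong:
  assumes "vec V" "carrier V' = carrier V" "zero V' = zero V" "add V' = add V"
    "module.smult V' = module.smult V"
  shows "vec V'"
proof -
  interpret vec V by fact
  have "abelian_group V'"
  proof (rule abelian_groupI)
    fix x assume "x \<in> carrier V'"
    then show "\<exists>y\<in>carrier V'. y \<oplus>\<^bsub>V'\<^esub> x = \<zero>\<^bsub>V'\<^esub>"
      by (intro bexI[of _ "\<ominus>\<^bsub>V\<^esub> x"]) (simp_all add: assms l_neg)
  qed (simp_all add: assms a_ac)
  then show ?thesis
    using scal_add_left scal_add_right scal_mult by (intro vecI) (simp_all add: assms)
qed
lemma calgI:
  assumes "cring S" "vec S"
    and "\<And>c x y. x \<in> carrier S \<Longrightarrow> y \<in> carrier S \<Longrightarrow>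
      (c \<odot>\<^bsub>S\<^esub> x) \<otimes>\<^bsub>S\<^esub> y = c \<odot>\<^bsub>S\<^esub> (x \<otimes>\<^bsub>S\<^esub> y)"
  shows "calg S"
proof -
  interpret cring S by fact
  interpret vec S by fact
  show ?thesis
    unfolding calg_def algebra_def using assms
    by (auto simp: vec_def algebra_axioms_def)
qed

section \<open>Quotients\<close>
lemma quotient_simps:
  "carrier (quotient V J) = a_rcosets\<^bsub>V\<^esub> J"
  "monoid.mult (quotient V J) = rcoset_mult V J"
  "one (quotient V J) = J +>\<^bsub>V\<^esub> \<one>\<^bsub>V\<^esub>"
  "zero (quotient V J) = J"
  "add (quotient V J) = set_add V"
  "module.smult (quotient V J) = (\<lambda>c C. \<Union>v\<in>C. J +>\<^bsub>V\<^esub> (c \<odot>\<^bsub>V\<^esub> v))"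
  by (simp_all add: quotient_def ring.extend_def module.fields_def FactRing_def)

locale quot_vec = vec V for V :: "('f::field, 'v, 'm) module_scheme" (structure) +
  fixes J
  assumes J: "lin_subspace V J"
begin

sublocale abelian_subgroup J V
proof (rule abelian_subgroupI3)
  show "additive_subgroup J V"
    using J subspace_minus[OF J] unfolding additive_subgroup_def
    by (intro add.subgroupI) (auto simp: lin_subspace_def a_inv_def[symmetric])
qed (rule abelian_group_axioms)

lemma coset_eq_iff:
  assumes "x \<in> carrier V" "y \<in> carrier V"
  shows "J +> x = J +> y \<longleftrightarrow> x \<oplus> \<ominus> y \<in> J"
proof -
  have "J +> x = J +> y \<longleftrightarrow> x \<in> J +> y"
    using a_repr_independence'[of x y] a_rcos_self[of x] assms by auto
  then show ?thesis using a_rcos_module[of y x] assms by simp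
qed

lemma coset_eqI: "x \<in> carrier V \<Longrightarrow> y \<in> carrier V \<Longrightarrow> x \<oplus> \<ominus> y \<in> J \<Longrightarrow> J +> x = J +> y"
  by (simp add: coset_eq_iff)

lemma coset_zero: "x \<in> J \<Longrightarrow> J +> x = J"
  by (rule a_rcos_const)

lemma quotient_carrier: "carrier (quotient V J) = (\<lambda>x. J +> x) ` carrier V"
  by (auto simp: quotient_simps A_RCOSETS_def')

lemma coset_closed: "x \<in> carrier V \<Longrightarrow> J +> x \<in> carrier (quotient V J)"
  by (auto simp: quotient_carrier)

lemma coset_add:
  "x \<in> carrier V \<Longrightarrow> y \<in> carrier V \<Longrightarrow> (J +> x) \<oplus>\<^bsub>quotient V J\<^esub> (J +> y) = J +> (x \<oplus> y)"
  by (simp add: quotient_simps a_rcos_sum)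

lemma coset_in: "x \<in> carrier V \<Longrightarrow> y \<in> J +> x \<Longrightarrow> y \<in> carrier V \<and> J +> y = J +> x"
  using a_repr_independence'[of y x] a_elemrcos_carrier by auto

lemma coset_smult:
  assumes x: "x \<in> carrier V"
  shows "c \<odot>\<^bsub>quotient V J\<^esub> (J +> x) = J +> (c \<odot> x)"
proof -
  have "J +> (c \<odot> y) = J +> (c \<odot> x)" if "y \<in> J +> x" for y
  proof -
    have y: "y \<in> carrier V" "y \<oplus> \<ominus> x \<in> J"
      using coset_in[OF x that] x coset_eq_iff[of y x] by blast+
    then have "c \<odot> (y \<oplus> \<ominus> x) \<in> J" using J by (auto simp: lin_subspace_def)
    moreover have "c \<odot> (y \<oplus> \<ominus> x) = c \<odot> y \<oplus> \<ominus> (c \<odot> x)"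
      using x y(1) smult_r_minus[of c x] by (simp add: scal_add_right)
    ultimately show ?thesis using x y by (intro coset_eqI) auto
  qed
  then have "(\<Union>y\<in>J +> x. J +> (c \<odot> y)) = J +> (c \<odot> x)"
    using a_rcos_self[OF x] by (intro SUP_eq_const) blast+
  then show ?thesis by (simp add: quotient_simps)
qed

sublocale Q: vec "quotient V J"
proof (rule vecI)
  have zero: "\<zero>\<^bsub>quotient V J\<^esub> = J +> \<zero>"
    using coset_zero[of \<zero>] J by (simp add: quotient_simps lin_subspace_def)
  show "abelian_group (quotient V J)"
  proof (rule abelian_groupI)
    fix C assume "C \<in> carrier (quotient V J)"
    then obtain x where "x \<in> carrier V" "C = J +> x" by (auto simp: quotient_carrier)
    then show "\<exists>D\<in>carrier (quotient V J). D \<oplus>\<^bsub>quotient V J\<^esub> C = \<zero>\<^bsub>quotient V J\<^esub>"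
      by (intro bexI[of _ "J +> \<ominus> x"]) (simp_all add: coset_closed coset_add zero l_neg)
  qed (clarsimp simp: quotient_carrier coset_add zero a_assoc; (simp add: a_comm)?)+
qed (auto simp: quotient_carrier coset_smult coset_add scal_add_left scal_add_right scal_mult)

lemma coset_lin: "(\<lambda>x. J +> x) \<in> lin_maps V (quotient V J)"
  by (intro lin_mapsI) (auto simp: coset_closed coset_add coset_smult)

text \<open>
  Universal property of the quotient: a linear map that kills \<open>J\<close> is constant on cosets.
\<close>
lemma quotient_map_exists:
  assumes "vec W" "f \<in> lin_maps V W" "\<And>x. x \<in> J \<Longrightarrow> f x = \<zero>\<^bsub>W\<^esub>"
  shows "\<exists>g. g \<in> lin_maps (quotient V J) W \<and> (\<forall>x\<in>carrier V. g (J +> x) = f x)"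
proof -
  interpret W: vec W by fact
  define g where "g C = f (SOME x. x \<in> C)" for C
  have g: "g (J +> x) = f x" if x: "x \<in> carrier V" for x
  proof -
    define y where "y = (SOME y. y \<in> J +> x)"
    have "y \<in> J +> x" unfolding y_def using a_rcos_self[OF x] by (rule someI)
    then have y: "y \<in> carrier V" "y \<oplus> \<ominus> x \<in> J"
      using coset_in[OF x, of y] x coset_eq_iff[of y x] by blast+
    have "f y = f ((y \<oplus> \<ominus> x) \<oplus> x)" using x y by (simp add: a_assoc l_neg)
    also have "\<dots> = f x"
      using lin_maps_add[OF assms(2), of "y \<oplus> \<ominus> x" x] x y assms(3) lin_maps_closed[OF assms(2)]
      by simp
    finally show ?thesis by (simp add: g_def y_def)
  qed
  then have "g \<in> lin_maps (quotient V J) W"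
    by (intro lin_mapsI)
      (auto simp: quotient_carrier coset_add coset_smult lin_maps_closed[OF assms(2)]
        lin_maps_add[OF assms(2)] lin_maps_smult[OF assms(2)])
  with g show ?thesis by blast
qed

end

lemma (in calg) quotient_calg:
  assumes "ideal J S"
  shows "calg (quotient S J)"
    and "\<And>x y. x \<in> carrier S \<Longrightarrow> y \<in> carrier S \<Longrightarrow>
      (J +> x) \<otimes>\<^bsub>quotient S J\<^esub> (J +> y) = J +> (x \<otimes> y)"
proof -
  interpret J: ideal J S by fact
  interpret quot_vec S J by unfold_locales (rule ideal_subspace[OF assms])
  show mult: "(J +> x) \<otimes>\<^bsub>quotient S J\<^esub> (J +> y) = J +> (x \<otimes> y)"
    if "x \<in> carrier S" "y \<in> carrier S" for x y
    using J.rcoset_mult_add[OF that] by (simp add: quotient_simps)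
  have one: "\<one>\<^bsub>quotient S J\<^esub> = J +> \<one>"
    by (simp add: quotient_simps)
  have "cring (quotient S J)"
  proof (rule cringI)
    show "abelian_group (quotient S J)" by (rule Q.M.abelian_group_axioms)
    show "Group.comm_monoid (quotient S J)"
      by (rule comm_monoidI) (auto simp: quotient_carrier mult one m_ac)
  qed (auto simp: quotient_carrier mult coset_add l_distr)
  then show "calg (quotient S J)"
    by (rule calgI) (auto simp: Q.vec_axioms quotient_carrier coset_smult mult scal_mult_left)
qed

section \<open>Free vector spaces and monoid algebras\<close>
lemma lookup_map_scale [simp]:
  "Poly_Mapping.lookup (Poly_Mapping.map ((*) c) u) x = c * Poly_Mapping.lookup (u :: _ \<Rightarrow>\<^sub>0 'f::field) x"
  by (simp add: Poly_Mapping.map.rep_eq when_def)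

lemma keys_map_scale: "Poly_Mapping.keys (Poly_Mapping.map ((*) c) u) \<subseteq> Poly_Mapping.keys (u :: _ \<Rightarrow>\<^sub>0 'f::field)"
  by (auto simp: in_keys_iff)

lemma finsupp_induct [consumes 1, case_names zero single add]:
  fixes u :: "'x \<Rightarrow>\<^sub>0 'f::field"
  assumes "Poly_Mapping.keys u \<subseteq> G"
    and "P 0" "\<And>x c. x \<in> G \<Longrightarrow> P (Poly_Mapping.single x c)"
    and add: "\<And>u v. Poly_Mapping.keys u \<subseteq> G \<Longrightarrow> Poly_Mapping.keys v \<subseteq> G \<Longrightarrow> P u \<Longrightarrow> P v \<Longrightarrow> P (u + v)"
  shows "P u"
  using assms(1)
proof (induction u rule: update_induct)
  case const
  then show ?case by (simp add: assms)
next
  case (update u x c)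
  have "Poly_Mapping.update x c u = u + Poly_Mapping.single x c"
    using update(1)
    by (intro poly_mapping_eqI) (auto simp: lookup_update lookup_add lookup_single in_keys_iff when_def)
  moreover have "Poly_Mapping.keys (Poly_Mapping.update x c u) = insert x (Poly_Mapping.keys u)"
    using update(2) by (simp add: keys_update)
  ultimately show ?case using update assms(3)[of x c] by (auto intro!: add)
qed

lemma free_space_simps:
  "carrier (free_space G) = {u. Poly_Mapping.keys u \<subseteq> G}"
  "zero (free_space G) = 0" "add (free_space G) = (+)"
  "module.smult (free_space G) = (\<lambda>c. Poly_Mapping.map ((*) c))"
  by (simp_all add: free_space_def)

lemma monoid_algebra_simps:
  "carrier (monoid_algebra M) = {u. Poly_Mapping.keys u \<subseteq> M}"
  "zero (monoid_algebra M) = 0" "add (monoid_algebra M) = (+)"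
  "monoid.mult (monoid_algebra M) = (*)" "one (monoid_algebra M) = 1"
  "module.smult (monoid_algebra M) = (\<lambda>c. Poly_Mapping.map ((*) c))"
  by (simp_all add: monoid_algebra_def)

text \<open>
  Free vector spaces and monoid algebras share their additive structure. Stating this for the record
  fields covers both.
\<close>
lemma finsupp_vec:
  assumes "carrier V = {u :: 'x \<Rightarrow>\<^sub>0 'f::field. Poly_Mapping.keys u \<subseteq> G}"
    "zero V = 0" "add V = (+)" "module.smult V = (\<lambda>c. Poly_Mapping.map ((*) c))"
  shows "vec V"
proof (rule vecI)
  show "abelian_group V"
  proof (rule abelian_groupI)
    fix u assume "u \<in> carrier V"
    then show "\<exists>v\<in>carrier V. v \<oplus>\<^bsub>V\<^esub> u = \<zero>\<^bsub>V\<^esub>"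
      by (intro bexI[of _ "- u"]) (auto simp: assms in_keys_iff)
  next
    fix u v assume "u \<in> carrier V" "v \<in> carrier V"
    then show "u \<oplus>\<^bsub>V\<^esub> v \<in> carrier V" using keys_add[of u v] by (auto simp: assms)
  qed (auto simp: assms ac_simps)
next
  fix c u assume "u \<in> carrier V"
  then show "c \<odot>\<^bsub>V\<^esub> u \<in> carrier V" using keys_map_scale[of c u] by (auto simp: assms)
qed (auto simp: assms algebra_simps lookup_add intro!: poly_mapping_eqI)

lemma free_space_vec: "vec (free_space G)"
  by (rule finsupp_vec) (simp_all add: free_space_simps)

lemma monoid_algebra_calg:
  assumes "0 \<in> M" "\<And>m n. m \<in> M \<Longrightarrow> n \<in> M \<Longrightarrow> m + n \<in> M"
  shows "calg (monoid_algebra M :: ('f::field, 'm::comm_monoid_add \<Rightarrow>\<^sub>0 'f) module)"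
proof -
  let ?S = "monoid_algebra M :: ('f, 'm \<Rightarrow>\<^sub>0 'f) module"
  interpret vec ?S by (rule finsupp_vec) (simp_all add: monoid_algebra_simps)
  have mult: "u * v \<in> carrier ?S" if "u \<in> carrier ?S" "v \<in> carrier ?S" for u v
    using that keys_mult[of u v] assms(2) by (fastforce simp: monoid_algebra_simps)
  have "cring ?S"
  proof (rule cringI)
    show "abelian_group ?S" by (rule abelian_group_axioms)
    show "Group.comm_monoid ?S"
    proof (rule comm_monoidI)
    qed (use mult assms(1) in \<open>auto simp: monoid_algebra_simps algebra_simps\<close>)
  qed (auto simp: monoid_algebra_simps algebra_simps)
  then show ?thesis
    by (rule calgI[OF _ vec_axioms]) (simp add: monoid_algebra_simps mult_map_scale_conv_mult mult.assoc)
qed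

text \<open>
  The linear extension of a map defined on basis elements.
\<close>
definition lin_ext :: "('f::field, 'w, 'm) module_scheme \<Rightarrow> ('x \<Rightarrow> 'w) \<Rightarrow> ('x \<Rightarrow>\<^sub>0 'f) \<Rightarrow> 'w" where
  "lin_ext W g u = (\<Oplus>\<^bsub>W\<^esub>x\<in>Poly_Mapping.keys u. Poly_Mapping.lookup u x \<odot>\<^bsub>W\<^esub> g x)"

context vec begin

lemma lin_ext_superset:
  assumes "finite K" "Poly_Mapping.keys u \<subseteq> K" "g \<in> K \<rightarrow> carrier V"
  shows "lin_ext V g u = (\<Oplus>x\<in>K. Poly_Mapping.lookup u x \<odot> g x)"
  unfolding lin_ext_def using assms
  by (intro add.finprod_mono_neutral_cong_left) (auto simp: in_keys_iff Pi_iff)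

lemma lin_ext_single: "g x \<in> carrier V \<Longrightarrow> lin_ext V g (Poly_Mapping.single x c) = c \<odot> g x"
  by (subst lin_ext_superset[of "{x}"]) (auto simp: Pi_def)

lemma lin_ext_lin:
  assumes "g \<in> G \<rightarrow> carrier V" "carrier F = {u :: 'x \<Rightarrow>\<^sub>0 'f::field. Poly_Mapping.keys u \<subseteq> G}"
    "zero F = 0" "add F = (+)" "module.smult F = (\<lambda>c. Poly_Mapping.map ((*) c))"
  shows "lin_ext V g \<in> lin_maps F V"
proof (rule lin_mapsI)
  fix u assume "u \<in> carrier F"
  then show "lin_ext V g u \<in> carrier V"
    unfolding lin_ext_def using assms by (auto intro!: finsum_closed)
next
  fix u v assume uv: "u \<in> carrier F" "v \<in> carrier F"
  define K where "K = Poly_Mapping.keys u \<union> Poly_Mapping.keys v"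
  have K: "finite K" "K \<subseteq> G" "g \<in> K \<rightarrow> carrier V" using uv assms by (auto simp: K_def)
  have g: "x \<in> K \<Longrightarrow> g x \<in> carrier V" for x using K by auto
  have "lin_ext V g (u + v) = (\<Oplus>x\<in>K. Poly_Mapping.lookup u x \<odot> g x \<oplus> Poly_Mapping.lookup v x \<odot> g x)"
    using K keys_add[of u v] g
    by (subst lin_ext_superset[of K]) (auto simp: K_def[symmetric] lookup_add scal_add_left simp del: finsum_addf intro!: finsum_cong')
  also have "\<dots> = lin_ext V g u \<oplus> lin_ext V g v"
    using K g by (subst finsum_addf) (auto simp: lin_ext_superset[of K] K_def)
  finally show "lin_ext V g (u \<oplus>\<^bsub>F\<^esub> v) = lin_ext V g u \<oplus> lin_ext V g v" by (simp add: assms)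
next
  fix c u assume u: "u \<in> carrier F"
  have g: "x \<in> Poly_Mapping.keys u \<Longrightarrow> g x \<in> carrier V" for x using assms u by auto
  have "lin_ext V g (Poly_Mapping.map ((*) c) u) =
      (\<Oplus>x\<in>Poly_Mapping.keys u. c \<odot> (Poly_Mapping.lookup u x \<odot> g x))"
    using g by (subst lin_ext_superset[of "Poly_Mapping.keys u"])
      (auto simp: keys_map_scale scal_mult intro!: finsum_cong')
  then show "lin_ext V g (c \<odot>\<^bsub>F\<^esub> u) = c \<odot> lin_ext V g u"
    using g by (simp add: assms lin_ext_def scal_finsum Pi_def)
qed

end

text \<open>
  Universal property of the monoid algebra. Both sides of the multiplicativity equation are bilinear,
  so it is enough to compare them on basis elements.
\<close>
lemma (in calg) monoid_algebra_hom:
  fixes g :: "'n::comm_monoid_add \<Rightarrow> 'a"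
  assumes M: "0 \<in> M" "\<And>m n. m \<in> M \<Longrightarrow> n \<in> M \<Longrightarrow> m + n \<in> M"
    and g: "g \<in> M \<rightarrow> carrier S" "g 0 = \<one>" "\<And>m n. m \<in> M \<Longrightarrow> n \<in> M \<Longrightarrow> g (m + n) = g m \<otimes> g n"
  shows "lin_ext S g \<in> alg_hom (monoid_algebra M) S"
proof -
  let ?F = "monoid_algebra M :: ('f, 'n \<Rightarrow>\<^sub>0 'f) module"
  let ?h = "lin_ext S g"
  interpret F: calg ?F by (rule monoid_algebra_calg) (use M in auto)
  have lin: "?h \<in> lin_maps ?F S"
    by (rule lin_ext_lin[where G = M]) (use g in \<open>auto simp: monoid_algebra_simps\<close>)
  have g': "m \<in> M \<Longrightarrow> g m \<in> carrier S" for m using g by auto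
  have h_add: "?h (u + v) = ?h u \<oplus> ?h v"
    if "Poly_Mapping.keys u \<subseteq> M" "Poly_Mapping.keys v \<subseteq> M" for u v
    using lin_maps_add[OF lin] that by (simp add: monoid_algebra_simps)
  have h: "?h u \<in> carrier S" if "Poly_Mapping.keys u \<subseteq> M" for u
    using lin_maps_closed[OF lin] that by (simp add: monoid_algebra_simps)
  have h_zero: "?h 0 = \<zero>" by (simp add: lin_ext_def)
  have mult: "Poly_Mapping.keys (u * v) \<subseteq> M"
    if "Poly_Mapping.keys u \<subseteq> M" "Poly_Mapping.keys v \<subseteq> M" for u v :: "'n \<Rightarrow>\<^sub>0 'f"
    using F.m_closed[of u v] that by (simp add: monoid_algebra_simps)
  have h_single: "?h (Poly_Mapping.single m c * v) = ?h (Poly_Mapping.single m c) \<otimes> ?h v"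
    if m: "m \<in> M" and v: "Poly_Mapping.keys v \<subseteq> M" for m c v
    using v
  proof (induction v rule: finsupp_induct)
    case zero
    then show ?case using m g' by (simp add: h_zero lin_ext_single)
  next
    case (single n d)
    then show ?case using m g' M g
      by (simp add: lin_ext_single mult_single scal_mult_left scal_mult_right scal_mult[symmetric] mult.commute)
  next
    case (add u v)
    have "Poly_Mapping.keys (Poly_Mapping.single m c) \<subseteq> M" using m by auto
    with add show ?case by (simp add: distrib_left h_add mult h r_distr)
  qed
  have "?h (u * v) = ?h u \<otimes> ?h v"
    if u: "Poly_Mapping.keys u \<subseteq> M" and v: "Poly_Mapping.keys v \<subseteq> M" for u v
    using u
  proof (induction u rule: finsupp_induct)
    case zero
    then show ?case using v by (simp add: h_zero h)
  next
    case (single n d)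
    then show ?case using v by (rule h_single)
  next
    case (add u w)
    with v show ?case
      by (simp add: distrib_right h_add mult h l_distr)
  qed
  moreover have "?h 1 = \<one>" using lin_ext_single[of g 0 1] g' M g by simp
  ultimately show ?thesis
    using lin by (auto simp: alg_hom_def ring_hom_def lin_maps_def monoid_algebra_simps)
qed

section \<open>The symmetric algebra\<close>
text \<open>
  The algebra \<open>S[\<epsilon>]\<close> with \<open>\<epsilon>\<^sup>2 = 0\<close>, the pair \<open>(a, b)\<close> standing for \<open>a + b \<epsilon>\<close>. A map
  \<open>q \<mapsto> q + D(q) \<epsilon>\<close> is an algebra homomorphism exactly when \<open>D\<close> is a derivation, so derivations of
  the symmetric algebra come from its universal property with respect to homomorphisms.
\<close>
definition dual_numbers :: "('f::field, 'a, 'm) module_scheme \<Rightarrow> ('f, 'a \<times> 'a) module" where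
  "dual_numbers S =
     \<lparr>carrier = carrier S \<times> carrier S,
      monoid.mult = (\<lambda>(a, b) (c, d). (a \<otimes>\<^bsub>S\<^esub> c, a \<otimes>\<^bsub>S\<^esub> d \<oplus>\<^bsub>S\<^esub> b \<otimes>\<^bsub>S\<^esub> c)),
      one = (\<one>\<^bsub>S\<^esub>, \<zero>\<^bsub>S\<^esub>), zero = (\<zero>\<^bsub>S\<^esub>, \<zero>\<^bsub>S\<^esub>),
      add = (\<lambda>(a, b) (c, d). (a \<oplus>\<^bsub>S\<^esub> c, b \<oplus>\<^bsub>S\<^esub> d)),
      module.smult = (\<lambda>r (a, b). (r \<odot>\<^bsub>S\<^esub> a, r \<odot>\<^bsub>S\<^esub> b))\<rparr>"

lemma (in calg) dual_numbers_calg: "calg (dual_numbers S)"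
proof -
  have ab: "abelian_group (dual_numbers S)"
  proof (rule abelian_groupI)
    fix p assume "p \<in> carrier (dual_numbers S)"
    then show "\<exists>q\<in>carrier (dual_numbers S). q \<oplus>\<^bsub>dual_numbers S\<^esub> p = \<zero>\<^bsub>dual_numbers S\<^esub>"
      by (intro bexI[of _ "(\<ominus> fst p, \<ominus> snd p)"]) (auto simp: dual_numbers_def l_neg)
  qed (auto simp: dual_numbers_def a_ac)
  have "vec (dual_numbers S)"
    by (rule vecI[OF ab])
      (auto simp: dual_numbers_def scal_add_left scal_add_right scal_mult)
  moreover have "cring (dual_numbers S)"
  proof (rule cringI[OF ab])
    show "Group.comm_monoid (dual_numbers S)"
      by (rule comm_monoidI)
        (auto simp: dual_numbers_def l_distr r_distr m_ac a_ac)
  next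
    fix p q r assume "p \<in> carrier (dual_numbers S)" "q \<in> carrier (dual_numbers S)"
      "r \<in> carrier (dual_numbers S)"
    then show "(p \<oplus>\<^bsub>dual_numbers S\<^esub> q) \<otimes>\<^bsub>dual_numbers S\<^esub> r =
        p \<otimes>\<^bsub>dual_numbers S\<^esub> r \<oplus>\<^bsub>dual_numbers S\<^esub> q \<otimes>\<^bsub>dual_numbers S\<^esub> r"
      by (auto simp: dual_numbers_def l_distr r_distr a_ac)
  qed
  ultimately show ?thesis
    by (intro calgI) (auto simp: dual_numbers_def scal_mult_left scal_mult_right scal_add_right)
qed

text \<open>
  The product of \<open>f x\<close> over the entries of a multiset, with powers in place of repeated factors:
  products of a record monoid range over sets only.
\<close>
definition mset_prod :: "('a, 'm) monoid_scheme \<Rightarrow> ('v \<Rightarrow> 'a) \<Rightarrow> 'v multiset \<Rightarrow> 'a" where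
  "mset_prod T f m = (\<Otimes>\<^bsub>T\<^esub>x\<in>set_mset m. f x [^]\<^bsub>T\<^esub> count m x)"

context comm_monoid begin

lemma mset_prod_superset:
  assumes "finite K" "set_mset m \<subseteq> K" "f \<in> K \<rightarrow> carrier G"
  shows "mset_prod G f m = (\<Otimes>x\<in>K. f x [^] count m x)"
  unfolding mset_prod_def using assms
  by (intro finprod_mono_neutral_cong_left) (auto simp: Pi_iff not_in_iff)

lemma mset_prod_closed: "f \<in> set_mset m \<rightarrow> carrier G \<Longrightarrow> mset_prod G f m \<in> carrier G"
  unfolding mset_prod_def by (intro finprod_closed) (auto simp: Pi_iff)

lemma mset_prod_empty: "mset_prod G f {#} = \<one>"
  by (simp add: mset_prod_def)

lemma mset_prod_single: "f x \<in> carrier G \<Longrightarrow> mset_prod G f {#x#} = f x"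
  by (simp add: mset_prod_def)

lemma mset_prod_add:
  assumes "f \<in> set_mset m \<union> set_mset n \<rightarrow> carrier G"
  shows "mset_prod G f (m + n) = mset_prod G f m \<otimes> mset_prod G f n"
proof -
  define K where "K = set_mset m \<union> set_mset n"
  have f: "x \<in> K \<Longrightarrow> f x \<in> carrier G" for x using assms by (auto simp: K_def)
  have "mset_prod G f (m + n) = (\<Otimes>x\<in>K. f x [^] count m x \<otimes> f x [^] count n x)"
    using f by (subst mset_prod_superset[of K]) (auto simp: K_def nat_pow_mult simp del: finprod_multf intro!: finprod_cong')
  also have "\<dots> = mset_prod G f m \<otimes> mset_prod G f n"
    using f by (subst finprod_multf) (auto simp: mset_prod_superset[of K] K_def)
  finally show ?thesis .
qed

end

definition sym_relations :: "('f::field, 'v, 'm) module_scheme \<Rightarrow> ('v multiset \<Rightarrow>\<^sub>0 'f) set" where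
  "sym_relations V =
     {Poly_Mapping.single {#x \<oplus>\<^bsub>V\<^esub> y#} 1 - Poly_Mapping.single {#x#} 1 - Poly_Mapping.single {#y#} 1
        | x y. x \<in> carrier V \<and> y \<in> carrier V} \<union>
     {Poly_Mapping.single {#c \<odot>\<^bsub>V\<^esub> x#} 1 - Poly_Mapping.single {#x#} c | c x. x \<in> carrier V}"

lemma keys_diff_subset:
  "Poly_Mapping.keys u \<subseteq> G \<Longrightarrow> Poly_Mapping.keys v \<subseteq> G \<Longrightarrow>
    Poly_Mapping.keys (u - v :: _ \<Rightarrow>\<^sub>0 'f::field) \<subseteq> G"
  by (auto simp: in_keys_iff lookup_minus) (metis in_keys_iff subsetD)+

lemma finsupp_a_inv:
  assumes "abelian_group V" "carrier V = {u :: 'x \<Rightarrow>\<^sub>0 'f::field. Poly_Mapping.keys u \<subseteq> G}"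
    "zero V = 0" "add V = (+)" "u \<in> carrier V"
  shows "\<ominus>\<^bsub>V\<^esub> u = - u"
proof -
  interpret abelian_group V by fact
  show ?thesis using assms by (intro minus_equality) auto
qed

lemma alg_homI:
  assumes "h \<in> lin_maps S T" "h \<one>\<^bsub>S\<^esub> = \<one>\<^bsub>T\<^esub>"
    and "\<And>x y. x \<in> carrier S \<Longrightarrow> y \<in> carrier S \<Longrightarrow> h (x \<otimes>\<^bsub>S\<^esub> y) = h x \<otimes>\<^bsub>T\<^esub> h y"
  shows "h \<in> alg_hom S T"
  using assms by (auto simp: alg_hom_def ring_hom_def lin_maps_def)

lemma alg_hom_mult: "h \<in> alg_hom S T \<Longrightarrow> x \<in> carrier S \<Longrightarrow> y \<in> carrier S \<Longrightarrow>
    h (x \<otimes>\<^bsub>S\<^esub> y) = h x \<otimes>\<^bsub>T\<^esub> h y"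
  and alg_hom_one: "h \<in> alg_hom S T \<Longrightarrow> h \<one>\<^bsub>S\<^esub> = \<one>\<^bsub>T\<^esub>"
  by (auto simp: alg_hom_def ring_hom_def)

lemma derivations_mult: "D \<in> derivations S \<Longrightarrow> x \<in> carrier S \<Longrightarrow> y \<in> carrier S \<Longrightarrow>
    D (x \<otimes>\<^bsub>S\<^esub> y) = D x \<otimes>\<^bsub>S\<^esub> y \<oplus>\<^bsub>S\<^esub> x \<otimes>\<^bsub>S\<^esub> D y"
  by (auto simp: derivations_def)

lemma derivationsI:
  assumes "D \<in> lin_maps S S"
    and "\<And>x y. x \<in> carrier S \<Longrightarrow> y \<in> carrier S \<Longrightarrow>
      D (x \<otimes>\<^bsub>S\<^esub> y) = D x \<otimes>\<^bsub>S\<^esub> y \<oplus>\<^bsub>S\<^esub> x \<otimes>\<^bsub>S\<^esub> D y"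
  shows "D \<in> derivations S"
  using assms by (auto simp: derivations_def lin_maps_def)

lemma (in calg) derivations_one: "D \<in> derivations S \<Longrightarrow> D \<one> = \<zero>"
proof -
  assume D: "D \<in> derivations S"
  have "D \<one> \<in> carrier S" using lin_maps_closed[OF derivations_lin[OF D]] by simp
  then show ?thesis using derivations_mult[OF D, of \<one> \<one>] by simp
qed

text \<open>
  Interpreting \<open>sym_free V\<close> and \<open>sym_alg V\<close> inside \<open>vec\<close> itself would not terminate, since these are
  again vector spaces; hence a separate locale for the spaces whose symmetric algebra is formed.
\<close>
locale sym_space = vec V for V :: "('f::field, 'v, 'm) module_scheme" (structure)
begin

sublocale F: calg "sym_free V"
  unfolding sym_free_def by (rule monoid_algebra_calg) auto

lemma sym_free_simps:
  "carrier (sym_free V) = {u. Poly_Mapping.keys u \<subseteq> {m. set_mset m \<subseteq> carrier V}}"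
  "zero (sym_free V) = 0" "add (sym_free V) = (+)"
  "monoid.mult (sym_free V) = (*)" "one (sym_free V) = 1"
  "module.smult (sym_free V) = (\<lambda>c. Poly_Mapping.map ((*) c))"
  by (simp_all add: sym_free_def monoid_algebra_simps)

lemma sym_free_single: "x \<in> carrier V \<Longrightarrow> Poly_Mapping.single {#x#} c \<in> carrier (sym_free V)"
  by (simp add: sym_free_simps)

lemma sym_free_diff:
  assumes "u \<in> carrier (sym_free V)" "v \<in> carrier (sym_free V)"
  shows "u - v \<in> carrier (sym_free V)"
    and "u \<oplus>\<^bsub>sym_free V\<^esub> \<ominus>\<^bsub>sym_free V\<^esub> v = u - v"
proof -
  show "u - v \<in> carrier (sym_free V)"
    using assms keys_diff_subset[of u _ v] by (simp add: sym_free_simps(1))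
  have "\<ominus>\<^bsub>sym_free V\<^esub> v = - v"
    by (rule finsupp_a_inv[OF F.M.abelian_group_axioms sym_free_simps(1,2,3) assms(2)])
  then show "u \<oplus>\<^bsub>sym_free V\<^esub> \<ominus>\<^bsub>sym_free V\<^esub> v = u - v"
    by (simp add: sym_free_simps(3))
qed

lemma sym_relations_carrier: "sym_relations V \<subseteq> carrier (sym_free V)"
  unfolding sym_relations_def by (auto intro!: sym_free_diff(1) sym_free_single)

lemma sym_ideal_eq: "sym_ideal V = Idl\<^bsub>sym_free V\<^esub> (sym_relations V)"
  by (simp add: sym_ideal_def sym_relations_def)

lemma sym_ideal_ideal: "ideal (sym_ideal V) (sym_free V)"
  unfolding sym_ideal_eq by (rule F.genideal_ideal[OF sym_relations_carrier])

lemma sym_relations_ideal: "sym_relations V \<subseteq> sym_ideal V"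
  unfolding sym_ideal_eq by (rule F.genideal_self[OF sym_relations_carrier])

sublocale FQ: quot_vec "sym_free V" "sym_ideal V"
  by unfold_locales (rule F.ideal_subspace[OF sym_ideal_ideal])

sublocale S: calg "sym_alg V"
  unfolding sym_alg_def by (rule F.quotient_calg[OF sym_ideal_ideal])

lemma sym_coset_mult:
  "u \<in> carrier (sym_free V) \<Longrightarrow> v \<in> carrier (sym_free V) \<Longrightarrow>
    (sym_ideal V +>\<^bsub>sym_free V\<^esub> u) \<otimes>\<^bsub>sym_alg V\<^esub> (sym_ideal V +>\<^bsub>sym_free V\<^esub> v) =
    sym_ideal V +>\<^bsub>sym_free V\<^esub> (u * v)"
  using F.quotient_calg(2)[OF sym_ideal_ideal] by (simp add: sym_alg_def sym_free_simps)

lemma sym_coset_one: "\<one>\<^bsub>sym_alg V\<^esub> = sym_ideal V +>\<^bsub>sym_free V\<^esub> 1"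
  by (simp add: sym_alg_def quotient_simps sym_free_simps)

lemma sym_incl_lin: "sym_incl V \<in> lin_maps V (sym_alg V)"
proof (rule lin_mapsI)
  fix x assume x: "x \<in> carrier V"
  then show "sym_incl V x \<in> carrier (sym_alg V)"
    unfolding sym_incl_def sym_alg_def by (intro FQ.coset_closed) (auto simp: sym_free_simps)
next
  fix x y assume xy: "x \<in> carrier V" "y \<in> carrier V"
  let ?s = "\<lambda>x. Poly_Mapping.single {#x#} (1::'f)"
  have s: "?s z \<in> carrier (sym_free V)" if "z \<in> carrier V" for z
    using that by (rule sym_free_single)
  have "?s (x \<oplus> y) - ?s x - ?s y \<in> sym_ideal V"
    using xy sym_relations_ideal by (auto simp: sym_relations_def)
  then have "?s (x \<oplus> y) \<oplus>\<^bsub>sym_free V\<^esub> \<ominus>\<^bsub>sym_free V\<^esub> (?s x \<oplus>\<^bsub>sym_free V\<^esub> ?s y) \<in> sym_ideal V"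
    using xy s by (subst sym_free_diff) (auto simp: sym_free_simps(3) algebra_simps intro: F.a_closed[unfolded sym_free_simps(3)])
  then have "sym_ideal V +>\<^bsub>sym_free V\<^esub> ?s (x \<oplus> y) =
      sym_ideal V +>\<^bsub>sym_free V\<^esub> (?s x \<oplus>\<^bsub>sym_free V\<^esub> ?s y)"
    using xy s by (intro FQ.coset_eqI F.a_closed) simp_all
  then show "sym_incl V (x \<oplus> y) = sym_incl V x \<oplus>\<^bsub>sym_alg V\<^esub> sym_incl V y"
    unfolding sym_incl_def sym_alg_def using xy s by (simp add: FQ.coset_add)
next
  fix c x assume x: "x \<in> carrier V"
  let ?s = "\<lambda>x. Poly_Mapping.single {#x#} (1::'f)"
  have s: "?s z \<in> carrier (sym_free V)" if "z \<in> carrier V" for z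
    using that by (auto simp: sym_free_simps)
  have cs: "c \<odot>\<^bsub>sym_free V\<^esub> ?s x = Poly_Mapping.single {#x#} c"
    by (simp add: sym_free_simps)
  have "?s (c \<odot> x) - Poly_Mapping.single {#x#} c \<in> sym_ideal V"
    using x sym_relations_ideal by (auto simp: sym_relations_def)
  then have "?s (c \<odot> x) \<oplus>\<^bsub>sym_free V\<^esub> \<ominus>\<^bsub>sym_free V\<^esub> (c \<odot>\<^bsub>sym_free V\<^esub> ?s x) \<in> sym_ideal V"
    using x s by (subst sym_free_diff) (simp_all add: cs sym_free_single)
  then have "sym_ideal V +>\<^bsub>sym_free V\<^esub> ?s (c \<odot> x) =
      sym_ideal V +>\<^bsub>sym_free V\<^esub> (c \<odot>\<^bsub>sym_free V\<^esub> ?s x)"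
    using x s by (intro FQ.coset_eqI F.scal_closed) simp_all
  then show "sym_incl V (c \<odot> x) = c \<odot>\<^bsub>sym_alg V\<^esub> sym_incl V x"
    unfolding sym_incl_def sym_alg_def using x s by (simp add: FQ.coset_smult)
qed

lemma sym_incl_closed: "x \<in> carrier V \<Longrightarrow> sym_incl V x \<in> carrier (sym_alg V)"
  by (rule lin_maps_closed[OF sym_incl_lin])

text \<open>
  The symmetric algebra is spanned by products of elements of \<open>V\<close>, and such a product arises from \<open>1\<close>
  by multiplying with one element of \<open>V\<close> after the other.
\<close>
lemma sym_alg_generated:
  assumes U: "lin_subspace (sym_alg V) U" and one: "\<one>\<^bsub>sym_alg V\<^esub> \<in> U"
    and mult: "\<And>x q. x \<in> carrier V \<Longrightarrow> q \<in> U \<Longrightarrow> sym_incl V x \<otimes>\<^bsub>sym_alg V\<^esub> q \<in> U"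
  shows "carrier (sym_alg V) \<subseteq> U"
proof
  let ?c = "\<lambda>u. sym_ideal V +>\<^bsub>sym_free V\<^esub> u"
  fix q assume "q \<in> carrier (sym_alg V)"
  then obtain u where u: "Poly_Mapping.keys u \<subseteq> {m. set_mset m \<subseteq> carrier V}" "q = ?c u"
    unfolding sym_alg_def FQ.quotient_carrier by (auto simp: sym_free_simps)
  have monom: "?c (Poly_Mapping.single m 1) \<in> U" if "set_mset m \<subseteq> carrier V" for m
    using that
  proof (induction m)
    case empty
    then show ?case using one by (simp add: sym_coset_one flip: zero_multiset_def)
  next
    case (add x m)
    then have "sym_incl V x \<otimes>\<^bsub>sym_alg V\<^esub> ?c (Poly_Mapping.single m 1) \<in> U"
      by (intro mult) auto
    then show ?case
      unfolding sym_incl_def using add.prems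
      by (subst (asm) sym_coset_mult) (auto simp: sym_free_simps mult_single)
  qed
  have "?c u \<in> U" using u(1)
  proof (induction u rule: finsupp_induct)
    case zero
    have "?c \<zero>\<^bsub>sym_free V\<^esub> = \<zero>\<^bsub>sym_alg V\<^esub>"
      using lin_maps_zero[OF F.vec_axioms FQ.Q.vec_axioms FQ.coset_lin] by (simp add: sym_alg_def)
    then show ?case using U by (simp add: lin_subspace_def sym_free_simps)
  next
    case (single m c)
    then have "c \<odot>\<^bsub>sym_alg V\<^esub> ?c (Poly_Mapping.single m 1) \<in> U"
      using monom U by (auto simp: lin_subspace_def)
    then show ?case using single
      unfolding sym_alg_def by (subst (asm) FQ.coset_smult) (auto simp: sym_free_simps)
  next
    case (add u v)
    then have "?c u \<oplus>\<^bsub>sym_alg V\<^esub> ?c v \<in> U" using U by (auto simp: lin_subspace_def)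
    then show ?case using add
      unfolding sym_alg_def by (subst (asm) FQ.coset_add) (auto simp: sym_free_simps)
  qed
  then show "q \<in> U" by (simp add: u)
qed

lemma sym_alg_hom_unique:
  assumes "calg T" "h \<in> alg_hom (sym_alg V) T" "h' \<in> alg_hom (sym_alg V) T"
    and eq: "\<And>x. x \<in> carrier V \<Longrightarrow> h (sym_incl V x) = h' (sym_incl V x)"
    and "q \<in> carrier (sym_alg V)"
  shows "h q = h' q"
proof -
  interpret T: calg T by fact
  have "lin_subspace (sym_alg V) {q \<in> carrier (sym_alg V). h q = h' q}"
    by (rule lin_maps_eq_subspace[OF S.vec_axioms T.vec_axioms]) (auto intro: alg_hom_lin assms)
  then have "carrier (sym_alg V) \<subseteq> {q \<in> carrier (sym_alg V). h q = h' q}"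
    by (rule sym_alg_generated)
      (auto simp: alg_hom_one[OF assms(2)] alg_hom_one[OF assms(3)] sym_incl_closed eq
        alg_hom_mult[OF assms(2)] alg_hom_mult[OF assms(3)])
  with assms show ?thesis by auto
qed

lemma derivation_unique:
  assumes D: "D \<in> derivations (sym_alg V)" and D': "D' \<in> derivations (sym_alg V)"
    and eq: "\<And>x. x \<in> carrier V \<Longrightarrow> D (sym_incl V x) = D' (sym_incl V x)"
    and "q \<in> carrier (sym_alg V)"
  shows "D q = D' q"
proof -
  have "lin_subspace (sym_alg V) {q \<in> carrier (sym_alg V). D q = D' q}"
    by (rule lin_maps_eq_subspace[OF S.vec_axioms S.vec_axioms]) (auto intro: derivations_lin assms)
  then have "carrier (sym_alg V) \<subseteq> {q \<in> carrier (sym_alg V). D q = D' q}"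
    by (rule sym_alg_generated)
      (auto simp: S.derivations_one[OF D] S.derivations_one[OF D'] sym_incl_closed eq
        derivations_mult[OF D] derivations_mult[OF D'])
  with assms show ?thesis by auto
qed

text \<open>
  Universal property of the symmetric algebra: the homomorphism from the polynomial algebra with
  \<open>X\<^sub>x \<mapsto> f x\<close> kills the relations because \<open>f\<close> is linear.
\<close>
lemma sym_alg_hom_exists:
  assumes "calg T" and f: "f \<in> lin_maps V T"
  shows "\<exists>h. h \<in> alg_hom (sym_alg V) T \<and> (\<forall>x\<in>carrier V. h (sym_incl V x) = f x)"
proof -
  interpret T: calg T by fact
  let ?c = "\<lambda>u. sym_ideal V +>\<^bsub>sym_free V\<^esub> u"
  define h where "h = lin_ext T (mset_prod T f)"
  have fc: "x \<in> carrier V \<Longrightarrow> f x \<in> carrier T" for x by (rule lin_maps_closed[OF f])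
  have h: "h \<in> alg_hom (sym_free V) T"
    unfolding h_def sym_free_def
  proof (rule T.monoid_algebra_hom)
    show "mset_prod T f \<in> {m. set_mset m \<subseteq> carrier V} \<rightarrow> carrier T"
      using fc by (auto intro!: T.mset_prod_closed)
    show "mset_prod T f 0 = \<one>\<^bsub>T\<^esub>" by (simp add: T.mset_prod_empty)
    show "mset_prod T f (m + n) = mset_prod T f m \<otimes>\<^bsub>T\<^esub> mset_prod T f n"
      if "m \<in> {m. set_mset m \<subseteq> carrier V}" "n \<in> {m. set_mset m \<subseteq> carrier V}" for m n
      using that fc by (intro T.mset_prod_add) auto
  qed auto
  note lin = alg_hom_lin[OF h]
  have single: "h (Poly_Mapping.single {#x#} c) = c \<odot>\<^bsub>T\<^esub> f x" if "x \<in> carrier V" for x c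
    unfolding h_def using fc[OF that] by (simp add: T.lin_ext_single T.mset_prod_single)
  have diff: "h (u - v) = h u \<oplus>\<^bsub>T\<^esub> \<ominus>\<^bsub>T\<^esub> h v"
    if "u \<in> carrier (sym_free V)" "v \<in> carrier (sym_free V)" for u v
  proof -
    have uv: "u - v \<in> carrier (sym_free V)"
      using that by (rule sym_free_diff)
    have "h u = h (u - v) \<oplus>\<^bsub>T\<^esub> h v"
      using lin_maps_add[OF lin uv that(2)] by (simp add: sym_free_simps)
    then show ?thesis
      using lin_maps_closed[OF lin] uv that by (simp add: T.a_assoc T.r_neg)
  qed
  have "ring_hom_ring (sym_free V) T h"
    using h by (intro ring_hom_ringI2 F.ring_axioms T.ring_axioms) (simp add: alg_hom_def)
  then interpret h: ring_hom_ring "sym_free V" T h .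
  note s = sym_free_single
  have "sym_relations V \<subseteq> a_kernel (sym_free V) T h"
  proof
    fix u assume u: "u \<in> sym_relations V"
    have "h u = \<zero>\<^bsub>T\<^esub>" using u
      unfolding sym_relations_def
    proof (elim UnE CollectE exE conjE)
      fix x y assume xy: "x \<in> carrier V" "y \<in> carrier V"
        and u: "u = Poly_Mapping.single {#x \<oplus> y#} 1 - Poly_Mapping.single {#x#} 1 - Poly_Mapping.single {#y#} 1"
      have "Poly_Mapping.single {#x \<oplus> y#} 1 - Poly_Mapping.single {#x#} (1::'f) \<in> carrier (sym_free V)"
        using xy by (intro sym_free_diff sym_free_single) simp_all
      then have "h u = (f x \<oplus>\<^bsub>T\<^esub> f y) \<oplus>\<^bsub>T\<^esub> \<ominus>\<^bsub>T\<^esub> f x \<oplus>\<^bsub>T\<^esub> \<ominus>\<^bsub>T\<^esub> f y"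
        unfolding u using xy s fc by (simp add: diff single lin_maps_add[OF f])
      then show ?thesis
        using fc[OF xy(1)] fc[OF xy(2)] by (simp add: T.a_comm[of "f x" "f y"] T.a_assoc T.r_neg)
    next
      fix c x assume x: "x \<in> carrier V"
        and u: "u = Poly_Mapping.single {#c \<odot> x#} 1 - Poly_Mapping.single {#x#} c"
      then show ?thesis using s fc by (simp add: diff single lin_maps_smult[OF f] T.r_neg)
    qed
    then show "u \<in> a_kernel (sym_free V) T h"
      unfolding a_kernel_def' using u sym_relations_carrier by blast
  qed
  then have "sym_ideal V \<subseteq> a_kernel (sym_free V) T h"
    unfolding sym_ideal_eq by (rule F.genideal_minimal[OF h.kernel_is_ideal])
  then have "h u = \<zero>\<^bsub>T\<^esub>" if "u \<in> sym_ideal V" for u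
    using that unfolding a_kernel_def' by blast
  from FQ.quotient_map_exists[OF T.vec_axioms lin this]
  obtain g where g: "g \<in> lin_maps (sym_alg V) T" "\<forall>u\<in>carrier (sym_free V). g (?c u) = h u"
    unfolding sym_alg_def by blast
  have "g \<in> alg_hom (sym_alg V) T"
  proof (rule alg_homI[OF g(1)])
    show "g \<one>\<^bsub>sym_alg V\<^esub> = \<one>\<^bsub>T\<^esub>"
      using g(2) F.one_closed alg_hom_one[OF h] by (simp add: sym_coset_one sym_free_simps)
    fix p q assume "p \<in> carrier (sym_alg V)" "q \<in> carrier (sym_alg V)"
    then obtain u v where uv: "u \<in> carrier (sym_free V)" "v \<in> carrier (sym_free V)" "p = ?c u" "q = ?c v"
      unfolding sym_alg_def FQ.quotient_carrier by auto
    then have "p \<otimes>\<^bsub>sym_alg V\<^esub> q = ?c (u \<otimes>\<^bsub>sym_free V\<^esub> v)"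
      by (simp add: sym_coset_mult) (simp add: sym_free_simps)
    then show "g (p \<otimes>\<^bsub>sym_alg V\<^esub> q) = g p \<otimes>\<^bsub>T\<^esub> g q"
      using uv g(2) by (simp add: alg_hom_mult[OF h])
  qed
  moreover have "\<forall>x\<in>carrier V. g (sym_incl V x) = f x"
    using g(2) s by (simp add: sym_incl_def single fc)
  ultimately show ?thesis by blast
qed

text \<open>
  The homomorphism into the dual numbers with \<open>x \<mapsto> x + f(x) \<epsilon>\<close> is the identity modulo \<open>\<epsilon>\<close>, by
  uniqueness, and the coefficient of \<open>\<epsilon>\<close> is the wanted derivation.
\<close>
lemma derivation_exists:
  assumes f: "f \<in> lin_maps V (sym_alg V)"
  shows "\<exists>D. D \<in> derivations (sym_alg V) \<and> (\<forall>x\<in>carrier V. D (sym_incl V x) = f x)"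
proof -
  let ?S = "sym_alg V"
  let ?E = "dual_numbers ?S"
  have "(\<lambda>x. (sym_incl V x, f x)) \<in> lin_maps V ?E"
    using lin_maps_closed[OF f] lin_maps_add[OF f] lin_maps_smult[OF f] sym_incl_closed
      lin_maps_add[OF sym_incl_lin] lin_maps_smult[OF sym_incl_lin]
    by (intro lin_mapsI) (auto simp: dual_numbers_def)
  from sym_alg_hom_exists[OF S.dual_numbers_calg this]
  obtain h where h: "h \<in> alg_hom ?S ?E" "\<forall>x\<in>carrier V. h (sym_incl V x) = (sym_incl V x, f x)"
    by blast
  note lin = alg_hom_lin[OF h(1)]
  have E: "fst (a \<otimes>\<^bsub>?E\<^esub> b) = fst a \<otimes>\<^bsub>?S\<^esub> fst b"
    "snd (a \<otimes>\<^bsub>?E\<^esub> b) = fst a \<otimes>\<^bsub>?S\<^esub> snd b \<oplus>\<^bsub>?S\<^esub> snd a \<otimes>\<^bsub>?S\<^esub> fst b"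
    "fst (a \<oplus>\<^bsub>?E\<^esub> b) = fst a \<oplus>\<^bsub>?S\<^esub> fst b" "snd (a \<oplus>\<^bsub>?E\<^esub> b) = snd a \<oplus>\<^bsub>?S\<^esub> snd b"
    "fst (c \<odot>\<^bsub>?E\<^esub> a) = c \<odot>\<^bsub>?S\<^esub> fst a" "snd (c \<odot>\<^bsub>?E\<^esub> a) = c \<odot>\<^bsub>?S\<^esub> snd a"
    "fst \<one>\<^bsub>?E\<^esub> = \<one>\<^bsub>?S\<^esub>" for a b c
    by (auto simp: dual_numbers_def case_prod_unfold)
  have cl: "fst (h q) \<in> carrier ?S" "snd (h q) \<in> carrier ?S" if "q \<in> carrier ?S" for q
    using lin_maps_closed[OF lin that] by (auto simp: dual_numbers_def)
  have "(\<lambda>q. fst (h q)) \<in> alg_hom ?S ?S"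
    by (intro alg_homI lin_mapsI)
      (simp_all add: cl E lin_maps_add[OF lin] lin_maps_smult[OF lin] alg_hom_mult[OF h(1)] alg_hom_one[OF h(1)])
  moreover have "(\<lambda>q. q) \<in> alg_hom ?S ?S" by (intro alg_homI lin_mapsI) simp_all
  ultimately have fst: "fst (h q) = q" if "q \<in> carrier ?S" for q
    using that h(2) sym_alg_hom_unique[OF S.calg_axioms, of "\<lambda>q. fst (h q)" "\<lambda>q. q" q] by simp
  have "(\<lambda>q. snd (h q)) \<in> lin_maps ?S ?S"
    by (intro lin_mapsI) (simp_all add: cl E lin_maps_add[OF lin] lin_maps_smult[OF lin])
  then have "(\<lambda>q. snd (h q)) \<in> derivations ?S"
  proof (rule derivationsI)
    fix p q assume pq: "p \<in> carrier ?S" "q \<in> carrier ?S"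
    then have "snd (h (p \<otimes>\<^bsub>?S\<^esub> q)) = p \<otimes>\<^bsub>?S\<^esub> snd (h q) \<oplus>\<^bsub>?S\<^esub> snd (h p) \<otimes>\<^bsub>?S\<^esub> q"
      by (simp add: E fst alg_hom_mult[OF h(1)])
    also have "\<dots> = snd (h p) \<otimes>\<^bsub>?S\<^esub> q \<oplus>\<^bsub>?S\<^esub> p \<otimes>\<^bsub>?S\<^esub> snd (h q)"
      using pq cl by (intro S.a_comm) simp_all
    finally show "snd (h (p \<otimes>\<^bsub>?S\<^esub> q)) = snd (h p) \<otimes>\<^bsub>?S\<^esub> q \<oplus>\<^bsub>?S\<^esub> p \<otimes>\<^bsub>?S\<^esub> snd (h q)" .
  qed
  moreover have "\<forall>x\<in>carrier V. snd (h (sym_incl V x)) = f x"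
    using h(2) by simp
  ultimately show ?thesis by blast
qed

end

text \<open>
  The definite descriptions that define the action and \<open>tau_map\<close> single out functions that are
  \<^const>\<open>undefined\<close> outside the carrier.
\<close>
lemma derivations_restrict:
  assumes "calg S" "D \<in> derivations S"
  shows "restrict D (carrier S) \<in> derivations S"
proof -
  interpret calg S by fact
  note lin = derivations_lin[OF assms(2)]
  show ?thesis
    by (intro derivationsI lin_mapsI)
      (simp_all add: lin_maps_closed[OF lin] lin_maps_add[OF lin] lin_maps_smult[OF lin]
        derivations_mult[OF assms(2)])
qed

lemma alg_hom_restrict:
  assumes "calg S" "h \<in> alg_hom S T"
  shows "restrict h (carrier S) \<in> alg_hom S T"
proof -
  interpret calg S by fact
  note lin = alg_hom_lin[OF assms(2)]
  show ?thesis
    by (intro alg_homI lin_mapsI)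
      (simp_all add: lin_maps_closed[OF lin] lin_maps_add[OF lin] lin_maps_smult[OF lin]
        alg_hom_mult[OF assms(2)] alg_hom_one[OF assms(2)])
qed

lemma sym_action_derivation:
  fixes L :: "('f::field, 'v, 'm) lie_alg_scheme"
  assumes "vec L" and ad: "bracket L x \<in> lin_maps L L"
  shows "sym_action L x \<in> derivations (sym_alg L)"
    and "y \<in> carrier L \<Longrightarrow> sym_action L x (sym_incl L y) = sym_incl L (bracket L x y)"
proof -
  interpret vec L by fact
  interpret sym_space L ..
  let ?P = "\<lambda>D. D \<in> extensional (carrier (sym_alg L)) \<and> D \<in> derivations (sym_alg L) \<and>
             (\<forall>y\<in>carrier L. D (sym_incl L y) = sym_incl L (bracket L x y))"
  obtain D where D: "D \<in> derivations (sym_alg L)"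
    "\<forall>y\<in>carrier L. D (sym_incl L y) = sym_incl L (bracket L x y)"
    using derivation_exists[OF lin_maps_comp[OF ad sym_incl_lin]] by blast
  have "\<exists>!D. ?P D"
  proof (rule ex_ex1I)
    have "?P (restrict D (carrier (sym_alg L)))"
      using D by (simp add: derivations_restrict[OF S.calg_axioms] sym_incl_closed)
    then show "\<exists>D. ?P D" by (rule exI[of ?P])
  next
    fix D' D'' assume "?P D'" "?P D''"
    then show "D' = D''"
      using derivation_unique[of D' D''] by (intro extensionalityI[of D' "carrier (sym_alg L)"]) simp_all
  qed
  then have "?P (sym_action L x)"
    unfolding sym_action_def by (rule theI')
  then show "sym_action L x \<in> derivations (sym_alg L)"
    "y \<in> carrier L \<Longrightarrow> sym_action L x (sym_incl L y) = sym_incl L (bracket L x y)"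
    by simp_all
qed

lemma (in calg) derivations_add:
  assumes D: "D \<in> derivations S" and E: "E \<in> derivations S"
  shows "(\<lambda>q. D q \<oplus> E q) \<in> derivations S"
proof (rule derivationsI)
  note cl = lin_maps_closed[OF derivations_lin[OF D]] lin_maps_closed[OF derivations_lin[OF E]]
  show "(\<lambda>q. D q \<oplus> E q) \<in> lin_maps S S"
    by (intro lin_mapsI)
      (simp_all add: cl lin_maps_add[OF derivations_lin[OF D]] lin_maps_smult[OF derivations_lin[OF D]]
        lin_maps_add[OF derivations_lin[OF E]] lin_maps_smult[OF derivations_lin[OF E]] scal_add_right a_ac)
  fix p q assume "p \<in> carrier S" "q \<in> carrier S"
  then show "D (p \<otimes> q) \<oplus> E (p \<otimes> q) = (D p \<oplus> E p) \<otimes> q \<oplus> p \<otimes> (D q \<oplus> E q)"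
    by (simp add: cl derivations_mult[OF D] derivations_mult[OF E] l_distr r_distr a_ac)
qed

lemma (in calg) derivations_scal:
  assumes D: "D \<in> derivations S"
  shows "(\<lambda>q. c \<odot> D q) \<in> derivations S"
proof (rule derivationsI)
  note cl = lin_maps_closed[OF derivations_lin[OF D]]
  show "(\<lambda>q. c \<odot> D q) \<in> lin_maps S S"
    by (intro lin_mapsI)
      (simp_all add: cl lin_maps_add[OF derivations_lin[OF D]] lin_maps_smult[OF derivations_lin[OF D]]
        scal_add_right mult.commute flip: scal_mult)
  fix p q assume "p \<in> carrier S" "q \<in> carrier S"
  then show "c \<odot> D (p \<otimes> q) = (c \<odot> D p) \<otimes> q \<oplus> p \<otimes> (c \<odot> D q)"
    by (simp add: cl derivations_mult[OF D] scal_add_right scal_mult_left scal_mult_right)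
qed

definition bilin_maps ::
    "('f::field, 'v, 'm) module_scheme \<Rightarrow> ('f, 'w, 'n) module_scheme \<Rightarrow> ('f, 'u, 'k) module_scheme
      \<Rightarrow> ('v \<Rightarrow> 'w \<Rightarrow> 'u) set" where
  "bilin_maps V W U =
     {B. (\<forall>w\<in>carrier W. (\<lambda>x. B x w) \<in> lin_maps V U) \<and> (\<forall>x\<in>carrier V. B x \<in> lin_maps W U)}"

text \<open>
  Sums and multiples of derivations are derivations, and a derivation is determined by its values
  on \<open>L\<close>.
\<close>
lemma sym_action_lin:
  fixes L :: "('f::field, 'v, 'm) lie_alg_scheme"
  assumes "vec L" and br: "bracket L \<in> bilin_maps L L L" and q: "q \<in> carrier (sym_alg L)"
  shows "(\<lambda>z. sym_action L z q) \<in> lin_maps L (sym_alg L)"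
proof -
  interpret vec L by fact
  interpret sym_space L ..
  have ad: "bracket L z \<in> lin_maps L L" if "z \<in> carrier L" for z
    using br that by (simp add: bilin_maps_def)
  have bl: "(\<lambda>z. bracket L z y) \<in> lin_maps L L" if "y \<in> carrier L" for y
    using br that by (simp add: bilin_maps_def)
  have D: "sym_action L z \<in> derivations (sym_alg L)" if "z \<in> carrier L" for z
    using that by (intro sym_action_derivation(1) vec_axioms ad)
  have on_incl: "sym_action L z (sym_incl L y) = sym_incl L (bracket L z y)"
    if "z \<in> carrier L" "y \<in> carrier L" for z y
    using that by (intro sym_action_derivation(2) vec_axioms ad)
  show ?thesis
  proof (rule lin_mapsI)
    show "sym_action L z q \<in> carrier (sym_alg L)" if "z \<in> carrier L" for z
      using lin_maps_closed[OF derivations_lin[OF D[OF that]] q] .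
    show "sym_action L (z \<oplus>\<^bsub>L\<^esub> y) q = sym_action L z q \<oplus>\<^bsub>sym_alg L\<^esub> sym_action L y q"
      if "z \<in> carrier L" "y \<in> carrier L" for z y
      using that lin_maps_closed[OF bl]
      by (intro derivation_unique[OF D[of "z \<oplus>\<^bsub>L\<^esub> y"] S.derivations_add[OF D[of z] D[of y]] _ q])
        (simp_all add: on_incl lin_maps_add[OF bl] lin_maps_add[OF sym_incl_lin])
    show "sym_action L (c \<odot>\<^bsub>L\<^esub> z) q = c \<odot>\<^bsub>sym_alg L\<^esub> sym_action L z q"
      if "z \<in> carrier L" for c z
      using that lin_maps_closed[OF bl]
      by (intro derivation_unique[OF D[of "c \<odot>\<^bsub>L\<^esub> z"] S.derivations_scal[OF D[of z]] _ q])
        (simp_all add: on_incl lin_maps_smult[OF bl] lin_maps_smult[OF sym_incl_lin])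
  qed
qed

section \<open>Tensor products\<close>

lemma free_space_generated:
  fixes G :: "'x set" and U :: "('x \<Rightarrow>\<^sub>0 'f::field) set"
  assumes "lin_subspace (free_space G) U" "\<And>x. x \<in> G \<Longrightarrow> Poly_Mapping.single x 1 \<in> U"
  shows "carrier (free_space G) \<subseteq> U"
proof
  fix u :: "'x \<Rightarrow>\<^sub>0 'f" assume "u \<in> carrier (free_space G)"
  then have "Poly_Mapping.keys u \<subseteq> G" by (simp add: free_space_simps)
  then show "u \<in> U"
  proof (induction u rule: finsupp_induct)
    case zero
    then show ?case using assms by (simp add: lin_subspace_def free_space_simps)
  next
    case (single x c)
    have "c \<odot>\<^bsub>free_space G\<^esub> Poly_Mapping.single x 1 \<in> U"
      using assms(1) assms(2)[OF single] unfolding lin_subspace_def by blast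
    then show ?case by (simp add: free_space_simps)
  next
    case (add u v)
    then show ?case using assms by (simp add: lin_subspace_def free_space_simps)
  qed
qed

lemma free_space_diff:
  assumes "u \<in> carrier (free_space G)" "v \<in> carrier (free_space G)"
  shows "u - v \<in> carrier (free_space G)"
    and "u \<oplus>\<^bsub>free_space G\<^esub> \<ominus>\<^bsub>free_space G\<^esub> v = u - v"
proof -
  interpret vec "free_space G" by (rule free_space_vec)
  show "u - v \<in> carrier (free_space G)"
    using assms keys_diff_subset[of u G v] by (simp add: free_space_simps(1))
  have "\<ominus>\<^bsub>free_space G\<^esub> v = - v"
    by (rule finsupp_a_inv[OF M.abelian_group_axioms free_space_simps(1,2,3) assms(2)])
  then show "u \<oplus>\<^bsub>free_space G\<^esub> \<ominus>\<^bsub>free_space G\<^esub> v = u - v"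
    by (simp add: free_space_simps(3))
qed

lemma free_space_single: "x \<in> G \<Longrightarrow> Poly_Mapping.single x c \<in> carrier (free_space G)"
  by (simp add: free_space_simps)

text \<open>
  The relations of a tensor product are differences in the type of finitely supported functions,
  not in the record \<^const>\<open>free_space\<close>.
\<close>
lemma lin_maps_free_space_diff:
  assumes "vec W" "f \<in> lin_maps (free_space G) W"
    "u \<in> carrier (free_space G)" "v \<in> carrier (free_space G)"
  shows "f (u - v) = f u \<oplus>\<^bsub>W\<^esub> \<ominus>\<^bsub>W\<^esub> f v"
proof -
  interpret W: vec W by fact
  have uv: "u - v \<in> carrier (free_space G)" using assms(3,4) by (rule free_space_diff)
  have "f u = f (u - v) \<oplus>\<^bsub>W\<^esub> f v"
    using lin_maps_add[OF assms(2) uv assms(4)] by (simp add: free_space_simps)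
  then show ?thesis
    using lin_maps_closed[OF assms(2)] uv assms(4) by (simp add: W.a_assoc W.r_neg)
qed

locale tensor_space = V: vec V + W: vec W
  for V :: "('f::field, 'v, 'm) module_scheme" and W :: "('f, 'w, 'n) module_scheme"
begin

abbreviation F :: "('f, 'v \<times> 'w \<Rightarrow>\<^sub>0 'f) module" where
  "F \<equiv> free_space (carrier V \<times> carrier W)"

abbreviation N where "N \<equiv> tensor_null V W"

abbreviation T where "T \<equiv> tensor V W"

sublocale F: vec F by (rule free_space_vec)

lemma tensor_relations_carrier: "tensor_relations V W \<subseteq> carrier F"
  unfolding tensor_relations_def by (auto intro!: free_space_diff(1) free_space_single)

lemma tensor_null_eq: "N = lin_span F (tensor_relations V W)"
  by (simp add: tensor_null_def)

lemma tensor_relations_null: "tensor_relations V W \<subseteq> N"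
  unfolding tensor_null_eq by (rule F.lin_span_superset[OF tensor_relations_carrier])

sublocale Q: quot_vec F N
  by unfold_locales (unfold tensor_null_eq, rule F.lin_span_subspace[OF tensor_relations_carrier])

sublocale T: vec T unfolding tensor_def by (rule Q.Q.vec_axioms)

abbreviation tens where "tens \<equiv> pure_tensor V W"

lemma pure_tensor_coset: "tens x w = N +>\<^bsub>F\<^esub> Poly_Mapping.single (x, w) 1"
  by (simp add: pure_tensor_def)

lemma pure_tensor_closed: "x \<in> carrier V \<Longrightarrow> w \<in> carrier W \<Longrightarrow> tens x w \<in> carrier T"
  unfolding pure_tensor_coset tensor_def by (intro Q.coset_closed free_space_single) simp

lemma coset_scaled_pair:
  assumes "x \<in> carrier V" "w \<in> carrier W"
  shows "N +>\<^bsub>F\<^esub> Poly_Mapping.single (x, w) c = c \<odot>\<^bsub>T\<^esub> tens x w"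
  unfolding pure_tensor_coset tensor_def using assms
  by (subst Q.coset_smult) (simp_all add: free_space_simps)

lemma coset_sum:
  assumes "p \<in> carrier F" "q \<in> carrier F" "r \<in> carrier F" "p - q - r \<in> N"
  shows "N +>\<^bsub>F\<^esub> p = (N +>\<^bsub>F\<^esub> q) \<oplus>\<^bsub>T\<^esub> (N +>\<^bsub>F\<^esub> r)"
proof -
  have qr: "q \<oplus>\<^bsub>F\<^esub> r \<in> carrier F" using assms by simp
  have "p \<oplus>\<^bsub>F\<^esub> \<ominus>\<^bsub>F\<^esub> (q \<oplus>\<^bsub>F\<^esub> r) = p - q - r"
    by (subst free_space_diff[OF assms(1) qr]) (simp add: free_space_simps algebra_simps)
  then have "N +>\<^bsub>F\<^esub> p = N +>\<^bsub>F\<^esub> (q \<oplus>\<^bsub>F\<^esub> r)"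
    using assms qr by (intro Q.coset_eqI) simp_all
  then show ?thesis unfolding tensor_def using assms by (simp add: Q.coset_add)
qed

lemma coset_eq:
  assumes "p \<in> carrier F" "q \<in> carrier F" "p - q \<in> N"
  shows "N +>\<^bsub>F\<^esub> p = N +>\<^bsub>F\<^esub> q"
  using assms by (intro Q.coset_eqI) (simp_all add: free_space_diff)

lemma pure_tensor_bilin: "tens \<in> bilin_maps V W T"
  unfolding bilin_maps_def
proof (intro CollectI conjI ballI lin_mapsI)
  fix w x y assume "w \<in> carrier W" "x \<in> carrier V" "y \<in> carrier V"
  moreover from this have "Poly_Mapping.single (x \<oplus>\<^bsub>V\<^esub> y, w) 1 - Poly_Mapping.single (x, w) 1
      - Poly_Mapping.single (y, w) 1 \<in> tensor_relations V W"
    unfolding tensor_relations_def by blast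
  ultimately show "tens (x \<oplus>\<^bsub>V\<^esub> y) w = tens x w \<oplus>\<^bsub>T\<^esub> tens y w"
    unfolding pure_tensor_coset using tensor_relations_null
    by (intro coset_sum free_space_single) auto
next
  fix w x c assume xw: "w \<in> carrier W" "x \<in> carrier V"
  then have "Poly_Mapping.single (c \<odot>\<^bsub>V\<^esub> x, w) 1 - Poly_Mapping.single (x, w) c \<in> tensor_relations V W"
    unfolding tensor_relations_def by blast
  then have "tens (c \<odot>\<^bsub>V\<^esub> x) w = N +>\<^bsub>F\<^esub> Poly_Mapping.single (x, w) c"
    unfolding pure_tensor_coset using tensor_relations_null xw
    by (intro coset_eq free_space_single) auto
  with xw show "tens (c \<odot>\<^bsub>V\<^esub> x) w = c \<odot>\<^bsub>T\<^esub> tens x w" by (simp add: coset_scaled_pair)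
next
  fix w x y assume "x \<in> carrier V" "w \<in> carrier W" "y \<in> carrier W"
  moreover from this have "Poly_Mapping.single (x, w \<oplus>\<^bsub>W\<^esub> y) 1 - Poly_Mapping.single (x, w) 1
      - Poly_Mapping.single (x, y) 1 \<in> tensor_relations V W"
    unfolding tensor_relations_def by blast
  ultimately show "tens x (w \<oplus>\<^bsub>W\<^esub> y) = tens x w \<oplus>\<^bsub>T\<^esub> tens x y"
    unfolding pure_tensor_coset using tensor_relations_null
    by (intro coset_sum free_space_single) auto
next
  fix w x c assume xw: "x \<in> carrier V" "w \<in> carrier W"
  then have "Poly_Mapping.single (x, c \<odot>\<^bsub>W\<^esub> w) 1 - Poly_Mapping.single (x, w) c \<in> tensor_relations V W"
    unfolding tensor_relations_def by blast
  then have "tens x (c \<odot>\<^bsub>W\<^esub> w) = N +>\<^bsub>F\<^esub> Poly_Mapping.single (x, w) c"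
    unfolding pure_tensor_coset using tensor_relations_null xw
    by (intro coset_eq free_space_single) auto
  with xw show "tens x (c \<odot>\<^bsub>W\<^esub> w) = c \<odot>\<^bsub>T\<^esub> tens x w" by (simp add: coset_scaled_pair)
qed (simp_all add: pure_tensor_closed)

lemma pure_tensor_lin_left: "w \<in> carrier W \<Longrightarrow> (\<lambda>x. tens x w) \<in> lin_maps V T"
  and pure_tensor_lin_right: "x \<in> carrier V \<Longrightarrow> tens x \<in> lin_maps W T"
  using pure_tensor_bilin by (simp_all add: bilin_maps_def)

lemma tensor_generated:
  assumes U: "lin_subspace T U" and tens: "\<And>x w. x \<in> carrier V \<Longrightarrow> w \<in> carrier W \<Longrightarrow> tens x w \<in> U"
  shows "carrier T \<subseteq> U"
proof -
  have "lin_subspace F {u \<in> carrier F. N +>\<^bsub>F\<^esub> u \<in> U}"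
    using U unfolding tensor_def
    by (rule lin_maps_preimage[OF F.vec_axioms Q.Q.vec_axioms Q.coset_lin])
  then have "carrier F \<subseteq> {u \<in> carrier F. N +>\<^bsub>F\<^esub> u \<in> U}"
    by (rule free_space_generated) (use tens pure_tensor_coset in \<open>auto intro: free_space_single\<close>)
  then show ?thesis unfolding tensor_def Q.quotient_carrier by blast
qed

text \<open>
  Universal property of the tensor product: the linear extension of a bilinear map to the free space
  on pairs kills each of the four kinds of relations.
\<close>
lemma tensor_map_exists:
  assumes "vec U" and B: "B \<in> bilin_maps V W U"
  shows "\<exists>g. g \<in> lin_maps T U \<and> (\<forall>x\<in>carrier V. \<forall>w\<in>carrier W. g (tens x w) = B x w)"
proof -
  interpret U: vec U by fact
  define f where "f = lin_ext U (\<lambda>(x, w). B x w)"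
  have l: "(\<lambda>x. B x w) \<in> lin_maps V U" if "w \<in> carrier W" for w
    using B that by (simp add: bilin_maps_def)
  have r: "B x \<in> lin_maps W U" if "x \<in> carrier V" for x
    using B that by (simp add: bilin_maps_def)
  have Bc: "B x w \<in> carrier U" if "x \<in> carrier V" "w \<in> carrier W" for x w
    using lin_maps_closed[OF r] that by simp
  have f: "f \<in> lin_maps F U"
    unfolding f_def
    by (rule U.lin_ext_lin[where G = "carrier V \<times> carrier W"]) (use Bc in \<open>auto simp: free_space_simps\<close>)
  have single: "f (Poly_Mapping.single (x, w) c) = c \<odot>\<^bsub>U\<^esub> B x w" if "x \<in> carrier V" "w \<in> carrier W" for x w c
    unfolding f_def using Bc[OF that] by (simp add: U.lin_ext_single)
  have s: "Poly_Mapping.single (x, w) (c::'f) \<in> carrier F" if "x \<in> carrier V" "w \<in> carrier W" for x w c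
    using that by (intro free_space_single) simp
  have cancel: "(a \<oplus>\<^bsub>U\<^esub> b) \<oplus>\<^bsub>U\<^esub> \<ominus>\<^bsub>U\<^esub> a \<oplus>\<^bsub>U\<^esub> \<ominus>\<^bsub>U\<^esub> b = \<zero>\<^bsub>U\<^esub>"
    if "a \<in> carrier U" "b \<in> carrier U" for a b
    using that by (simp add: U.a_comm[of a b] U.a_assoc U.r_neg)
  note diff = lin_maps_free_space_diff[OF U.vec_axioms f] free_space_diff(1)
  have "tensor_relations V W \<subseteq> {u \<in> carrier F. f u \<in> {\<zero>\<^bsub>U\<^esub>}}"
  proof
    fix u assume u: "u \<in> tensor_relations V W"
    have "f u = \<zero>\<^bsub>U\<^esub>" using u
      unfolding tensor_relations_def
      by (elim UnE CollectE exE conjE)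
        (simp_all add: diff s single Bc cancel lin_maps_add[OF l] lin_maps_smult[OF l]
          lin_maps_add[OF r] lin_maps_smult[OF r] U.r_neg)
    then show "u \<in> {u \<in> carrier F. f u \<in> {\<zero>\<^bsub>U\<^esub>}}"
      using u tensor_relations_carrier by blast
  qed
  moreover have "lin_subspace F {u \<in> carrier F. f u \<in> {\<zero>\<^bsub>U\<^esub>}}"
    by (rule lin_maps_preimage[OF F.vec_axioms U.vec_axioms f]) (simp add: lin_subspace_def)
  ultimately have "N \<subseteq> {u \<in> carrier F. f u \<in> {\<zero>\<^bsub>U\<^esub>}}"
    unfolding tensor_null_eq by (intro F.lin_span_minimal)
  then have "f u = \<zero>\<^bsub>U\<^esub>" if "u \<in> N" for u using that by blast
  from Q.quotient_map_exists[OF U.vec_axioms f this]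
  obtain g where g: "g \<in> lin_maps T U" "\<forall>u\<in>carrier F. g (N +>\<^bsub>F\<^esub> u) = f u"
    unfolding tensor_def by blast
  have "\<forall>x\<in>carrier V. \<forall>w\<in>carrier W. g (tens x w) = B x w"
    using g(2) s by (simp add: pure_tensor_coset single Bc)
  with g(1) show ?thesis by blast
qed

end

section \<open>The Lie bracket on a tensor product\<close>
locale current_space = A: calg A
  for L :: "('f::field, 'v, 'm) lie_alg_scheme" and A :: "('f, 'a, 'n) module_scheme" +
  assumes lie: "lie_algebra L"
begin

sublocale lie_algebra L by (rule lie)

sublocale L: vec L by unfold_locales

sublocale tensor_space L A ..

abbreviation pre where "pre \<equiv> lie_tensor_pre L A"

abbreviation C where "C \<equiv> lie_tensor L A"

definition pair_bracket :: "'v \<times> 'a \<Rightarrow> 'v \<times> 'a \<Rightarrow> 'v \<times> 'a" where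
  "pair_bracket p q = (bracket L (fst p) (fst q), snd p \<otimes>\<^bsub>A\<^esub> snd q)"

lemma pair_bracket_closed:
  "p \<in> carrier L \<times> carrier A \<Longrightarrow> q \<in> carrier L \<times> carrier A \<Longrightarrow>
    pair_bracket p q \<in> carrier L \<times> carrier A"
  by (auto simp: pair_bracket_def bracket_closed)

lemma pre_superset:
  assumes "finite K" "Poly_Mapping.keys u \<subseteq> K" "finite K'" "Poly_Mapping.keys v \<subseteq> K'"
  shows "pre u v = (\<Sum>p\<in>K. \<Sum>q\<in>K'.
    Poly_Mapping.single (pair_bracket p q) (Poly_Mapping.lookup u p * Poly_Mapping.lookup v q))"
proof -
  have "pre u v = (\<Sum>p\<in>Poly_Mapping.keys u. \<Sum>q\<in>Poly_Mapping.keys v.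
      Poly_Mapping.single (pair_bracket p q) (Poly_Mapping.lookup u p * Poly_Mapping.lookup v q))"
    by (simp add: lie_tensor_pre_def pair_bracket_def case_prod_unfold)
  also have "\<dots> = (\<Sum>p\<in>Poly_Mapping.keys u. \<Sum>q\<in>K'.
      Poly_Mapping.single (pair_bracket p q) (Poly_Mapping.lookup u p * Poly_Mapping.lookup v q))"
    using assms by (intro sum.cong sum.mono_neutral_left) (auto simp: in_keys_iff)
  also have "\<dots> = (\<Sum>p\<in>K. \<Sum>q\<in>K'.
      Poly_Mapping.single (pair_bracket p q) (Poly_Mapping.lookup u p * Poly_Mapping.lookup v q))"
    using assms by (intro sum.mono_neutral_left) (auto simp: in_keys_iff)
  finally show ?thesis .
qed

lemma pre_single:
  "pre (Poly_Mapping.single p c) (Poly_Mapping.single q d) = Poly_Mapping.single (pair_bracket p q) (c * d)"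
  by (subst pre_superset[of "{p}" _ "{q}"]) auto

lemma scale_sum_single:
  "Poly_Mapping.map ((*) c) (\<Sum>p\<in>K. \<Sum>q\<in>K'. Poly_Mapping.single (g p q) (a p q)) =
    (\<Sum>p\<in>K. \<Sum>q\<in>K'. Poly_Mapping.single (g p q) (c * a p q :: 'f))"
  by (rule poly_mapping_eqI)
    (simp add: lookup_sum lookup_single sum_distrib_left mult_when)

lemma free_space_sum:
  assumes "\<And>i. i \<in> I \<Longrightarrow> b i \<in> carrier F"
  shows "sum b I \<in> carrier F"
  using assms
proof (induction I rule: infinite_finite_induct)
  case (insert i I)
  then show ?case using F.a_closed[of "b i" "sum b I"] by (simp add: free_space_simps)
qed (simp_all add: free_space_simps)

lemma pre_closed:
  assumes "u \<in> carrier F" "v \<in> carrier F"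
  shows "pre u v \<in> carrier F"
proof (subst pre_superset[OF finite_keys order.refl finite_keys order.refl], intro free_space_sum free_space_single)
  fix p q assume "p \<in> Poly_Mapping.keys u" "q \<in> Poly_Mapping.keys v"
  with assms show "pair_bracket p q \<in> carrier L \<times> carrier A"
    by (intro pair_bracket_closed) (auto simp: free_space_simps)
qed

lemma pre_lin_left:
  assumes v: "v \<in> carrier F"
  shows "(\<lambda>u. pre u v) \<in> lin_maps F F"
proof (rule lin_mapsI)
  fix u w :: "'v \<times> 'a \<Rightarrow>\<^sub>0 'f"
  let ?K = "Poly_Mapping.keys u \<union> Poly_Mapping.keys w"
  have "pre (u + w) v = pre u v + pre w v"
    using keys_add[of u w]
    by (simp add: pre_superset[of ?K _ "Poly_Mapping.keys v" v] lookup_add distrib_right single_add sum.distrib)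
  then show "pre (u \<oplus>\<^bsub>F\<^esub> w) v = pre u v \<oplus>\<^bsub>F\<^esub> pre w v" by (simp add: free_space_simps)
next
  fix c and u :: "'v \<times> 'a \<Rightarrow>\<^sub>0 'f"
  have "pre (Poly_Mapping.map ((*) c) u) v = Poly_Mapping.map ((*) c) (pre u v)"
    using keys_map_scale[of c u]
    by (simp add: pre_superset[of "Poly_Mapping.keys u" _ "Poly_Mapping.keys v" v] scale_sum_single mult.assoc)
  then show "pre (c \<odot>\<^bsub>F\<^esub> u) v = c \<odot>\<^bsub>F\<^esub> pre u v" by (simp add: free_space_simps)
qed (use v pre_closed in simp)

lemma pre_lin_right:
  assumes u: "u \<in> carrier F"
  shows "pre u \<in> lin_maps F F"
proof (rule lin_mapsI)
  fix v w :: "'v \<times> 'a \<Rightarrow>\<^sub>0 'f"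
  let ?K = "Poly_Mapping.keys v \<union> Poly_Mapping.keys w"
  have "pre u (v + w) = pre u v + pre u w"
    using keys_add[of v w]
    by (simp add: pre_superset[of "Poly_Mapping.keys u" u ?K] lookup_add distrib_left single_add sum.distrib)
  then show "pre u (v \<oplus>\<^bsub>F\<^esub> w) = pre u v \<oplus>\<^bsub>F\<^esub> pre u w" by (simp add: free_space_simps)
next
  fix c and v :: "'v \<times> 'a \<Rightarrow>\<^sub>0 'f"
  have "pre u (Poly_Mapping.map ((*) c) v) = Poly_Mapping.map ((*) c) (pre u v)"
    using keys_map_scale[of c v]
    by (simp add: pre_superset[of "Poly_Mapping.keys u" u "Poly_Mapping.keys v"] scale_sum_single mult.left_commute)
  then show "pre u (c \<odot>\<^bsub>F\<^esub> v) = c \<odot>\<^bsub>F\<^esub> pre u v" by (simp add: free_space_simps)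
qed (use u pre_closed in simp)

lemma N_subspace: "lin_subspace F N" by (rule Q.J)

lemma tensor_null_iff_coset: "u \<in> carrier F \<Longrightarrow> u \<in> N \<longleftrightarrow> N +>\<^bsub>F\<^esub> u = N"
  using Q.coset_zero[of u] Q.a_rcos_self[of u] by blast

text \<open>
  An endomorphism \<open>f\<close> of the free space that is bilinear in the pair, up to relations, preserves the
  relations: by the universal property of the tensor product there is a linear map \<open>g\<close> on it that
  agrees with the class of \<open>f\<close> on pairs, hence everywhere, and \<open>g\<close> maps \<open>0\<close> to \<open>0\<close>.
\<close>
lemma lin_maps_null:
  assumes f: "f \<in> lin_maps F F"
    and tens: "(\<lambda>x a. N +>\<^bsub>F\<^esub> f (Poly_Mapping.single (x, a) 1)) \<in> bilin_maps L A T"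
    and u: "u \<in> N"
  shows "f u \<in> N"
proof -
  let ?B = "\<lambda>x a. N +>\<^bsub>F\<^esub> f (Poly_Mapping.single (x, a) 1)"
  obtain g where g: "g \<in> lin_maps T T"
    "\<forall>x\<in>carrier L. \<forall>a\<in>carrier A. g (tens x a) = ?B x a"
    using tensor_map_exists[OF T.vec_axioms tens] by blast
  have c: "(\<lambda>u. N +>\<^bsub>F\<^esub> u) \<in> lin_maps F T" unfolding tensor_def by (rule Q.coset_lin)
  have "lin_subspace F {u \<in> carrier F. g (N +>\<^bsub>F\<^esub> u) = N +>\<^bsub>F\<^esub> f u}"
    by (rule lin_maps_eq_subspace[OF F.vec_axioms T.vec_axioms lin_maps_comp[OF c g(1)] lin_maps_comp[OF f c]])
  then have "carrier F \<subseteq> {u \<in> carrier F. g (N +>\<^bsub>F\<^esub> u) = N +>\<^bsub>F\<^esub> f u}"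
  proof (rule free_space_generated)
    fix p assume p: "p \<in> carrier L \<times> carrier A"
    then obtain x a where "p = (x, a)" "x \<in> carrier L" "a \<in> carrier A" by blast
    with g(2) have "g (N +>\<^bsub>F\<^esub> Poly_Mapping.single p 1) = N +>\<^bsub>F\<^esub> f (Poly_Mapping.single p 1)"
      by (simp add: pure_tensor_coset)
    with p show "Poly_Mapping.single p 1 \<in> {u \<in> carrier F. g (N +>\<^bsub>F\<^esub> u) = N +>\<^bsub>F\<^esub> f u}"
      by (simp add: free_space_single)
  qed
  moreover have uF: "u \<in> carrier F" using u N_subspace unfolding lin_subspace_def by blast
  ultimately have "g (N +>\<^bsub>F\<^esub> u) = N +>\<^bsub>F\<^esub> f u" by blast
  moreover have "N +>\<^bsub>F\<^esub> u = \<zero>\<^bsub>T\<^esub>"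
    using Q.coset_zero[OF u] by (simp add: tensor_def quotient_simps)
  moreover have "\<zero>\<^bsub>T\<^esub> = N" by (simp add: tensor_def quotient_simps)
  ultimately have "N +>\<^bsub>F\<^esub> f u = N"
    using lin_maps_zero[OF T.vec_axioms T.vec_axioms g(1)] by simp
  then show ?thesis using tensor_null_iff_coset lin_maps_closed[OF f uF] by blast
qed

lemma bracket_lin_left: "y \<in> carrier L \<Longrightarrow> (\<lambda>x. bracket L x y) \<in> lin_maps L L"
  by (intro lin_mapsI) (simp_all add: bracket_closed bracket_add_left bracket_smult_left)

lemma bracket_lin_right: "x \<in> carrier L \<Longrightarrow> bracket L x \<in> lin_maps L L"
  by (intro lin_mapsI) (simp_all add: bracket_closed bracket_add_right bracket_smult_right)

lemma tens_bracket_bilin_left: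
  assumes "y \<in> carrier L" "b \<in> carrier A"
  shows "(\<lambda>x a. tens (bracket L x y) (a \<otimes>\<^bsub>A\<^esub> b)) \<in> bilin_maps L A T"
  unfolding bilin_maps_def using assms
  by (auto intro!: lin_maps_comp[OF bracket_lin_left pure_tensor_lin_left]
      lin_maps_comp[OF A.mult_right_lin pure_tensor_lin_right] bracket_closed)

lemma tens_bracket_bilin_right:
  assumes "x \<in> carrier L" "a \<in> carrier A"
  shows "(\<lambda>y b. tens (bracket L x y) (a \<otimes>\<^bsub>A\<^esub> b)) \<in> bilin_maps L A T"
  unfolding bilin_maps_def using assms
  by (auto intro!: lin_maps_comp[OF bracket_lin_right pure_tensor_lin_left]
      lin_maps_comp[OF A.mult_left_lin pure_tensor_lin_right] bracket_closed)

lemma pre_null_left: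
  assumes u: "u \<in> N" and v: "v \<in> carrier F"
  shows "pre u v \<in> N"
proof -
  have uF: "u \<in> carrier F" using u N_subspace unfolding lin_subspace_def by blast
  have "lin_subspace F {v \<in> carrier F. pre u v \<in> N}"
    by (rule lin_maps_preimage[OF F.vec_axioms F.vec_axioms pre_lin_right[OF uF] N_subspace])
  then have "carrier F \<subseteq> {v \<in> carrier F. pre u v \<in> N}"
  proof (rule free_space_generated)
    fix q assume q: "q \<in> carrier L \<times> carrier A"
    then obtain y b where q': "q = (y, b)" "y \<in> carrier L" "b \<in> carrier A" by blast
    have qF: "Poly_Mapping.single q 1 \<in> carrier F" using q by (rule free_space_single)
    have "pre u (Poly_Mapping.single q 1) \<in> N"
      using pre_lin_left[OF qF] _ u
    proof (rule lin_maps_null)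
      show "(\<lambda>x a. N +>\<^bsub>F\<^esub> pre (Poly_Mapping.single (x, a) 1) (Poly_Mapping.single q 1)) \<in> bilin_maps L A T"
        using q' tens_bracket_bilin_left[OF q'(2,3)]
        by (simp add: pre_single pair_bracket_def flip: pure_tensor_coset)
    qed
    with qF show "Poly_Mapping.single q 1 \<in> {v \<in> carrier F. pre u v \<in> N}" by simp
  qed
  with v show ?thesis by blast
qed

lemma pre_null_right:
  assumes u: "u \<in> carrier F" and v: "v \<in> N"
  shows "pre u v \<in> N"
proof -
  have vF: "v \<in> carrier F" using v N_subspace unfolding lin_subspace_def by blast
  have "lin_subspace F {u \<in> carrier F. pre u v \<in> N}"
    by (rule lin_maps_preimage[OF F.vec_axioms F.vec_axioms pre_lin_left[OF vF] N_subspace])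
  then have "carrier F \<subseteq> {u \<in> carrier F. pre u v \<in> N}"
  proof (rule free_space_generated)
    fix q assume q: "q \<in> carrier L \<times> carrier A"
    then obtain y b where q': "q = (y, b)" "y \<in> carrier L" "b \<in> carrier A" by blast
    have qF: "Poly_Mapping.single q 1 \<in> carrier F" using q by (rule free_space_single)
    have "pre (Poly_Mapping.single q 1) v \<in> N"
      using pre_lin_right[OF qF] _ v
    proof (rule lin_maps_null)
      show "(\<lambda>x a. N +>\<^bsub>F\<^esub> pre (Poly_Mapping.single q 1) (Poly_Mapping.single (x, a) 1)) \<in> bilin_maps L A T"
        using q' tens_bracket_bilin_right[OF q'(2,3)]
        by (simp add: pre_single pair_bracket_def flip: pure_tensor_coset)
    qed
    with qF show "Poly_Mapping.single q 1 \<in> {u \<in> carrier F. pre u v \<in> N}" by simp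
  qed
  with u show ?thesis by blast
qed

lemma current_simps:
  "carrier C = carrier T" "zero C = zero T" "add C = add T" "module.smult C = module.smult T"
  "bracket C = (\<lambda>P Q. \<Union>u\<in>P. \<Union>v\<in>Q. N +>\<^bsub>F\<^esub> pre u v)"
  by (simp_all add: lie_tensor_def module.extend_def lie_alg.fields_def)

sublocale C: vec C
  by (rule vec_cong[OF T.vec_axioms]) (simp_all add: current_simps)

text \<open>
  The record \<open>C\<close> differs from the tensor product only by its additional field for the bracket.
\<close>
lemma lin_maps_current:
  "lin_maps C W = lin_maps T W" "lin_maps W C = lin_maps W T"
  "lin_subspace C = lin_subspace T"
  by (simp_all add: lin_maps_def lin_subspace_def current_simps fun_eq_iff)

text \<open>
  The bracket on the tensor product is well defined: its lift to the free space is bilinear and takes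
  values in the relations as soon as one argument is a relation.
\<close>
lemma pre_coset:
  assumes "u \<in> carrier F" "v \<in> carrier F" "u' \<in> N +>\<^bsub>F\<^esub> u" "v' \<in> N +>\<^bsub>F\<^esub> v"
  shows "N +>\<^bsub>F\<^esub> pre u' v' = N +>\<^bsub>F\<^esub> pre u v"
proof -
  have u': "u' \<in> carrier F" "u' \<oplus>\<^bsub>F\<^esub> \<ominus>\<^bsub>F\<^esub> u \<in> N" and v': "v' \<in> carrier F" "v' \<oplus>\<^bsub>F\<^esub> \<ominus>\<^bsub>F\<^esub> v \<in> N"
    using Q.coset_in[OF assms(1,3)] Q.coset_in[OF assms(2,4)] Q.coset_eq_iff[of u' u]
      Q.coset_eq_iff[of v' v] assms by blast+
  then have d: "u' - u \<in> N" "v' - v \<in> N" using assms by (simp_all add: free_space_diff)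
  have "pre (u' - u) v' \<in> N" "pre u (v' - v) \<in> N"
    using pre_null_left[OF d(1) v'(1)] pre_null_right[OF assms(1) d(2)] .
  then have *: "pre u' v' \<oplus>\<^bsub>F\<^esub> \<ominus>\<^bsub>F\<^esub> pre u v' \<in> N" "pre u v' \<oplus>\<^bsub>F\<^esub> \<ominus>\<^bsub>F\<^esub> pre u v \<in> N"
    using lin_maps_free_space_diff[OF F.vec_axioms pre_lin_left[OF v'(1)] u'(1) assms(1)]
      lin_maps_free_space_diff[OF F.vec_axioms pre_lin_right[OF assms(1)] v'(1) assms(2)] by simp_all
  have "N +>\<^bsub>F\<^esub> pre u' v' = N +>\<^bsub>F\<^esub> pre u v'"
    using * by (intro Q.coset_eqI pre_closed u' v' assms)
  also have "\<dots> = N +>\<^bsub>F\<^esub> pre u v"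
    using * by (intro Q.coset_eqI pre_closed u' v' assms)
  finally show ?thesis .
qed

lemma bracket_coset:
  assumes "u \<in> carrier F" "v \<in> carrier F"
  shows "bracket C (N +>\<^bsub>F\<^esub> u) (N +>\<^bsub>F\<^esub> v) = N +>\<^bsub>F\<^esub> pre u v"
proof -
  have "(\<Union>u'\<in>N +>\<^bsub>F\<^esub> u. \<Union>v'\<in>N +>\<^bsub>F\<^esub> v. N +>\<^bsub>F\<^esub> pre u' v') =
      (\<Union>u'\<in>N +>\<^bsub>F\<^esub> u. \<Union>v'\<in>N +>\<^bsub>F\<^esub> v. N +>\<^bsub>F\<^esub> pre u v)"
    by (intro SUP_cong refl pre_coset assms)
  also have "\<dots> = N +>\<^bsub>F\<^esub> pre u v"
    using Q.a_rcos_self[OF assms(1)] Q.a_rcos_self[OF assms(2)] by blast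
  finally show ?thesis by (simp add: current_simps)
qed

lemma bracket_tens:
  assumes "x \<in> carrier L" "y \<in> carrier L" "a \<in> carrier A" "b \<in> carrier A"
  shows "bracket C (tens x a) (tens y b) = tens (bracket L x y) (a \<otimes>\<^bsub>A\<^esub> b)"
  unfolding pure_tensor_coset using assms
  by (subst bracket_coset) (simp_all add: free_space_single pre_single pair_bracket_def)

lemma current_cases:
  assumes "Z \<in> carrier C"
  obtains u where "u \<in> carrier F" "Z = N +>\<^bsub>F\<^esub> u"
proof -
  from assms have "Z \<in> carrier (quotient F N)" by (simp add: current_simps tensor_def)
  then show ?thesis using that unfolding Q.quotient_carrier by blast
qed

lemma current_bracket_bilin: "bracket C \<in> bilin_maps C C C"
proof -
  have CQ: "carrier C = carrier (quotient F N)" "add C = add (quotient F N)" "module.smult C = module.smult (quotient F N)"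
    by (simp_all add: current_simps tensor_def)
  have l: "(\<lambda>Z. bracket C Z Y) \<in> lin_maps C C" if Y: "Y \<in> carrier C" for Y
  proof -
    obtain v where v: "v \<in> carrier F" "Y = N +>\<^bsub>F\<^esub> v" using current_cases[OF Y] by metis
    show ?thesis
    proof (rule lin_mapsI)
      fix Z assume "Z \<in> carrier C"
      then obtain u where u: "u \<in> carrier F" "Z = N +>\<^bsub>F\<^esub> u" using current_cases by metis
      then show "bracket C Z Y \<in> carrier C"
        using v by (simp add: bracket_coset CQ Q.coset_closed pre_closed)
    next
      fix Z Z' assume "Z \<in> carrier C" "Z' \<in> carrier C"
      then obtain u u' where u: "u \<in> carrier F" "Z = N +>\<^bsub>F\<^esub> u" "u' \<in> carrier F" "Z' = N +>\<^bsub>F\<^esub> u'"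
        using current_cases by metis
      then show "bracket C (Z \<oplus>\<^bsub>C\<^esub> Z') Y = bracket C Z Y \<oplus>\<^bsub>C\<^esub> bracket C Z' Y"
        using v by (simp add: bracket_coset CQ Q.coset_add pre_closed lin_maps_add[OF pre_lin_left])
    next
      fix c Z assume "Z \<in> carrier C"
      then obtain u where u: "u \<in> carrier F" "Z = N +>\<^bsub>F\<^esub> u" using current_cases by metis
      then show "bracket C (c \<odot>\<^bsub>C\<^esub> Z) Y = c \<odot>\<^bsub>C\<^esub> bracket C Z Y"
        using v by (simp add: bracket_coset CQ Q.coset_smult pre_closed lin_maps_smult[OF pre_lin_left])
    qed
  qed
  have r: "bracket C Y \<in> lin_maps C C" if Y: "Y \<in> carrier C" for Y
  proof -
    obtain v where v: "v \<in> carrier F" "Y = N +>\<^bsub>F\<^esub> v" using current_cases[OF Y] by metis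
    show ?thesis
    proof (rule lin_mapsI)
      fix Z assume "Z \<in> carrier C"
      then obtain u where u: "u \<in> carrier F" "Z = N +>\<^bsub>F\<^esub> u" using current_cases by metis
      then show "bracket C Y Z \<in> carrier C"
        using v by (simp add: bracket_coset CQ Q.coset_closed pre_closed)
    next
      fix Z Z' assume "Z \<in> carrier C" "Z' \<in> carrier C"
      then obtain u u' where u: "u \<in> carrier F" "Z = N +>\<^bsub>F\<^esub> u" "u' \<in> carrier F" "Z' = N +>\<^bsub>F\<^esub> u'"
        using current_cases by metis
      then show "bracket C Y (Z \<oplus>\<^bsub>C\<^esub> Z') = bracket C Y Z \<oplus>\<^bsub>C\<^esub> bracket C Y Z'"
        using v by (simp add: bracket_coset CQ Q.coset_add pre_closed lin_maps_add[OF pre_lin_right])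
    next
      fix c Z assume "Z \<in> carrier C"
      then obtain u where u: "u \<in> carrier F" "Z = N +>\<^bsub>F\<^esub> u" using current_cases by metis
      then show "bracket C Y (c \<odot>\<^bsub>C\<^esub> Z) = c \<odot>\<^bsub>C\<^esub> bracket C Y Z"
        using v by (simp add: bracket_coset CQ Q.coset_smult pre_closed lin_maps_smult[OF pre_lin_right])
    qed
  qed
  from l r show ?thesis by (simp add: bilin_maps_def)
qed

end

section \<open>Graded vector spaces\<close>

text \<open>
  Linear independence of joint eigenvectors with pairwise different systems of eigenvalues. As in the
  case of a single operator, applying \<open>D\<^sub>i - \<phi>\<^sub>i(\<kappa>)\<close> to a vanishing sum removes the summand with
  index \<open>\<kappa>\<close> and scales the others. The index \<open>i\<close> is chosen so that a given other summand survives.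
\<close>
lemma (in vec) eigenvectors_independent:
  assumes D: "\<And>i. D i \<in> lin_maps V V"
    and sep: "\<And>\<delta> \<epsilon>. \<delta> \<noteq> \<epsilon> \<Longrightarrow> \<exists>i. \<phi> i \<delta> \<noteq> \<phi> i \<epsilon>"
    and "finite K"
    and c: "\<And>\<delta>. \<delta> \<in> K \<Longrightarrow> c \<delta> \<in> carrier V" "\<And>\<delta> i. \<delta> \<in> K \<Longrightarrow> D i (c \<delta>) = \<phi> i \<delta> \<odot> c \<delta>"
    and sum: "(\<Oplus>\<delta>\<in>K. c \<delta>) = \<zero>" and "\<delta> \<in> K"
  shows "c \<delta> = \<zero>"
  using \<open>finite K\<close> c sum \<open>\<delta> \<in> K\<close>
proof (induction K arbitrary: c \<delta> rule: finite_induct)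
  case empty
  then show ?case by simp
next
  case (insert \<kappa> K)
  note c = insert.prems(1,2)
  have rest: "c \<epsilon> = \<zero>" if \<epsilon>: "\<epsilon> \<in> K" for \<epsilon>
  proof -
    have "\<epsilon> \<noteq> \<kappa>" using \<epsilon> insert.hyps by auto
    then obtain i where i: "\<phi> i \<epsilon> \<noteq> \<phi> i \<kappa>" using sep by blast
    let ?d = "\<lambda>\<delta>. (\<phi> i \<delta> + (- \<phi> i \<kappa>)) \<odot> c \<delta>"
    have cK: "c \<in> insert \<kappa> K \<rightarrow> carrier V" using c(1) by auto
    have "\<zero> = D i (\<Oplus>\<delta>\<in>insert \<kappa> K. c \<delta>) \<oplus> (- \<phi> i \<kappa>) \<odot> (\<Oplus>\<delta>\<in>insert \<kappa> K. c \<delta>)"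
      unfolding insert.prems(3) by (simp add: lin_maps_zero[OF vec_axioms vec_axioms D])
    also have "\<dots> = (\<Oplus>\<delta>\<in>insert \<kappa> K. D i (c \<delta>)) \<oplus> (\<Oplus>\<delta>\<in>insert \<kappa> K. (- \<phi> i \<kappa>) \<odot> c \<delta>)"
      using cK by (simp only: lin_maps_finsum[OF vec_axioms vec_axioms D] scal_finsum)
    also have "(\<Oplus>\<delta>\<in>insert \<kappa> K. D i (c \<delta>)) = (\<Oplus>\<delta>\<in>insert \<kappa> K. \<phi> i \<delta> \<odot> c \<delta>)"
      using c by (intro finsum_cong' refl) (auto simp del: insert_iff)
    also have "(\<Oplus>\<delta>\<in>insert \<kappa> K. \<phi> i \<delta> \<odot> c \<delta>) \<oplus> (\<Oplus>\<delta>\<in>insert \<kappa> K. (- \<phi> i \<kappa>) \<odot> c \<delta>) =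
        (\<Oplus>\<delta>\<in>insert \<kappa> K. \<phi> i \<delta> \<odot> c \<delta> \<oplus> (- \<phi> i \<kappa>) \<odot> c \<delta>)"
      using c(1) by (intro finsum_addf[symmetric]) (auto simp del: insert_iff)
    also have "\<dots> = (\<Oplus>\<delta>\<in>insert \<kappa> K. ?d \<delta>)"
      using c(1) by (intro finsum_cong' refl scal_add_left[symmetric]) (auto simp del: insert_iff)
    also have "\<dots> = (\<Oplus>\<delta>\<in>K. ?d \<delta>)"
      using insert.hyps c(1) by (subst finsum_insert) (auto intro!: r_zero l_zero finsum_closed)
    finally have "(\<Oplus>\<delta>\<in>K. ?d \<delta>) = \<zero>" by simp
    then have "?d \<epsilon> = \<zero>"
    proof (intro insert.IH[of ?d] \<epsilon>)
      fix \<delta> j assume "\<delta> \<in> K"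
      then show "D j (?d \<delta>) = \<phi> j \<delta> \<odot> ?d \<delta>"
        using c by (simp add: lin_maps_smult[OF D] mult.commute flip: scal_mult)
    qed (use c(1) in auto)
    then show ?thesis using scal_eq_zero[of "c \<epsilon>"] i c(1) \<epsilon> by simp
  qed
  have "(\<Oplus>\<delta>\<in>K. c \<delta>) = \<zero>"
    using rest by (intro add.finprod_one_eqI) simp
  then have "c \<kappa> = \<zero>"
    using insert.prems(3) insert.hyps c(1) by (subst (asm) finsum_insert) auto
  with rest insert.prems(4) show ?case by auto
qed

text \<open>
  The form that \<^const>\<open>degree_component\<close> takes for an arbitrary family of subspaces.
\<close>
definition component ::
    "('f::field, 'a, 'm) module_scheme \<Rightarrow> 'k set \<Rightarrow> ('k \<Rightarrow> 'a set) \<Rightarrow> 'k \<Rightarrow> 'a \<Rightarrow> 'a" where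
  "component S G U \<gamma> q =
     (THE r. \<exists>c. (\<forall>\<delta>\<in>G. c \<delta> \<in> U \<delta>) \<and> finite {\<delta>\<in>G. c \<delta> \<noteq> \<zero>\<^bsub>S\<^esub>} \<and>
        q = (\<Oplus>\<^bsub>S\<^esub>\<delta>\<in>{\<delta>\<in>G. c \<delta> \<noteq> \<zero>\<^bsub>S\<^esub>}. c \<delta>) \<and> r = c \<gamma>)"

locale graded_space = vec V for V :: "('f::field, 'v, 'm) module_scheme" (structure) +
  fixes G :: "'k set" and U :: "'k \<Rightarrow> 'v set"
  assumes sub: "\<And>\<delta>. \<delta> \<in> G \<Longrightarrow> lin_subspace V (U \<delta>)"
    and indep: "\<And>K c \<delta>. finite K \<Longrightarrow> K \<subseteq> G \<Longrightarrow> (\<And>\<delta>. \<delta> \<in> K \<Longrightarrow> c \<delta> \<in> U \<delta>) \<Longrightarrow>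
      (\<Oplus>\<delta>\<in>K. c \<delta>) = \<zero> \<Longrightarrow> \<delta> \<in> K \<Longrightarrow> c \<delta> = \<zero>"
    and span: "carrier V \<subseteq> lin_span V (\<Union>\<delta>\<in>G. U \<delta>)"
begin

lemma U_closed: "\<delta> \<in> G \<Longrightarrow> q \<in> U \<delta> \<Longrightarrow> q \<in> carrier V"
  and U_zero: "\<delta> \<in> G \<Longrightarrow> \<zero> \<in> U \<delta>"
  and U_add: "\<delta> \<in> G \<Longrightarrow> q \<in> U \<delta> \<Longrightarrow> r \<in> U \<delta> \<Longrightarrow> q \<oplus> r \<in> U \<delta>"
  and U_scal: "\<delta> \<in> G \<Longrightarrow> q \<in> U \<delta> \<Longrightarrow> a \<odot> q \<in> U \<delta>"
  using sub[of \<delta>] by (auto simp: lin_subspace_def)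

definition decomp :: "'v \<Rightarrow> ('k \<Rightarrow> 'v) \<Rightarrow> bool" where
  "decomp q c \<longleftrightarrow> (\<forall>\<delta>\<in>G. c \<delta> \<in> U \<delta>) \<and> finite {\<delta>\<in>G. c \<delta> \<noteq> \<zero>} \<and>
     q = (\<Oplus>\<delta>\<in>{\<delta>\<in>G. c \<delta> \<noteq> \<zero>}. c \<delta>)"

lemma decomp_sum:
  assumes "decomp q c" "finite K" "{\<delta>\<in>G. c \<delta> \<noteq> \<zero>} \<subseteq> K" "K \<subseteq> G"
  shows "q = (\<Oplus>\<delta>\<in>K. c \<delta>)"
  using assms U_closed unfolding decomp_def
  by (auto simp: subset_iff intro!: add.finprod_mono_neutral_cong_left)

lemma decompI:
  assumes "\<And>\<delta>. \<delta> \<in> G \<Longrightarrow> c \<delta> \<in> U \<delta>" "finite K" "K \<subseteq> G"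
    "\<And>\<delta>. \<delta> \<in> G \<Longrightarrow> \<delta> \<notin> K \<Longrightarrow> c \<delta> = \<zero>" "q = (\<Oplus>\<delta>\<in>K. c \<delta>)"
  shows "decomp q c"
proof -
  have sub: "{\<delta>\<in>G. c \<delta> \<noteq> \<zero>} \<subseteq> K" using assms(4) by blast
  then have "(\<Oplus>\<delta>\<in>K. c \<delta>) = (\<Oplus>\<delta>\<in>{\<delta>\<in>G. c \<delta> \<noteq> \<zero>}. c \<delta>)"
    using assms(1-3) U_closed by (intro add.finprod_mono_neutral_cong_right) auto
  then show ?thesis
    using assms sub finite_subset unfolding decomp_def by blast
qed

lemma decomp_add:
  assumes c: "decomp q c" and d: "decomp r d"
  shows "decomp (q \<oplus> r) (\<lambda>\<delta>. c \<delta> \<oplus> d \<delta>)"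
proof (rule decompI)
  let ?K = "{\<delta>\<in>G. c \<delta> \<noteq> \<zero>} \<union> {\<delta>\<in>G. d \<delta> \<noteq> \<zero>}"
  show fin: "finite ?K" using c d by (auto simp: decomp_def)
  have cl: "\<And>\<delta>. \<delta> \<in> G \<Longrightarrow> c \<delta> \<in> U \<delta>" "\<And>\<delta>. \<delta> \<in> G \<Longrightarrow> d \<delta> \<in> U \<delta>" using c d by (auto simp: decomp_def)
  show "q \<oplus> r = (\<Oplus>\<delta>\<in>?K. c \<delta> \<oplus> d \<delta>)"
    using cl U_closed decomp_sum[OF c fin] decomp_sum[OF d fin]
    by (subst finsum_addf) auto
qed (use c d U_add in \<open>auto simp: decomp_def\<close>)

lemma decomp_scal:
  assumes c: "decomp q c"
  shows "decomp (a \<odot> q) (\<lambda>\<delta>. a \<odot> c \<delta>)"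
proof (rule decompI)
  let ?K = "{\<delta>\<in>G. c \<delta> \<noteq> \<zero>}"
  show fin: "finite ?K" using c by (auto simp: decomp_def)
  show "a \<odot> q = (\<Oplus>\<delta>\<in>?K. a \<odot> c \<delta>)"
    using c U_closed unfolding decomp_def by (subst scal_finsum[symmetric]) auto
qed (use c U_scal in \<open>auto simp: decomp_def\<close>)

lemma decomp_homogeneous:
  assumes "\<delta> \<in> G" "q \<in> U \<delta>"
  shows "decomp q (\<lambda>\<epsilon>. if \<epsilon> = \<delta> then q else \<zero>)"
  using assms U_closed[OF assms] U_zero by (intro decompI[of _ "{\<delta>}"]) (auto simp: Pi_def)

lemma decomp_zero: "decomp \<zero> (\<lambda>_. \<zero>)"
  by (rule decompI[of _ "{}"]) (auto simp: U_zero)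

lemma decomp_exists:
  assumes "q \<in> carrier V"
  shows "\<exists>c. decomp q c"
proof -
  have "lin_subspace V {q. \<exists>c. decomp q c}"
  proof (rule lin_subspaceI)
    show "{q. \<exists>c. decomp q c} \<subseteq> carrier V"
      using U_closed unfolding decomp_def by (auto intro!: finsum_closed)
    show "\<zero> \<in> {q. \<exists>c. decomp q c}" using decomp_zero by blast
  qed (use decomp_add decomp_scal in blast)+
  then have "lin_span V (\<Union>\<delta>\<in>G. U \<delta>) \<subseteq> {q. \<exists>c. decomp q c}"
    using decomp_homogeneous by (intro lin_span_minimal) blast+
  with span assms show ?thesis by blast
qed

lemma decomp_unique:
  assumes c: "decomp q c" and d: "decomp q d" and \<gamma>: "\<gamma> \<in> G"
  shows "c \<gamma> = d \<gamma>"
proof -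
  let ?K = "insert \<gamma> ({\<delta>\<in>G. c \<delta> \<noteq> \<zero>} \<union> {\<delta>\<in>G. d \<delta> \<noteq> \<zero>})"
  have fin: "finite ?K" "?K \<subseteq> G" using c d \<gamma> by (auto simp: decomp_def)
  have cl: "c \<delta> \<in> U \<delta>" "d \<delta> \<in> U \<delta>" "c \<delta> \<in> carrier V" "d \<delta> \<in> carrier V" if "\<delta> \<in> G" for \<delta>
    using c d that U_closed by (auto simp: decomp_def)
  have q: "q \<in> carrier V" using c U_closed unfolding decomp_def by (auto intro!: finsum_closed)
  have "c \<gamma> \<oplus> (- 1) \<odot> d \<gamma> = \<zero>"
  proof (rule indep[of ?K "\<lambda>\<delta>. c \<delta> \<oplus> (- 1) \<odot> d \<delta>"])
    have "(\<Oplus>\<delta>\<in>?K. c \<delta> \<oplus> (- 1) \<odot> d \<delta>) = (\<Oplus>\<delta>\<in>?K. c \<delta>) \<oplus> (\<Oplus>\<delta>\<in>?K. (- 1) \<odot> d \<delta>)"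
      using fin cl by (intro finsum_addf) blast+
    also have "(\<Oplus>\<delta>\<in>?K. (- 1) \<odot> d \<delta>) = (- 1) \<odot> (\<Oplus>\<delta>\<in>?K. d \<delta>)"
      using fin cl by (intro scal_finsum[symmetric]) blast
    also have "(\<Oplus>\<delta>\<in>?K. c \<delta>) = q" using fin by (intro decomp_sum[OF c, symmetric]) auto
    also have "(\<Oplus>\<delta>\<in>?K. d \<delta>) = q" using fin by (intro decomp_sum[OF d, symmetric]) auto
    finally show "(\<Oplus>\<delta>\<in>?K. c \<delta> \<oplus> (- 1) \<odot> d \<delta>) = \<zero>"
      using q by (simp add: scal_minus_one r_neg)
    show "c \<delta> \<oplus> (- 1) \<odot> d \<delta> \<in> U \<delta>" if "\<delta> \<in> ?K" for \<delta>
      using that fin(2) cl by (intro U_add U_scal) blast+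
  qed (use fin in blast)+
  then have "c \<gamma> \<oplus> \<ominus> d \<gamma> = \<zero>" using cl(4)[OF \<gamma>] by (simp add: scal_minus_one)
  then show ?thesis
    using minus_equality[of "c \<gamma>" "\<ominus> d \<gamma>"] cl(3,4)[OF \<gamma>] by simp
qed

abbreviation comp where "comp \<equiv> component V G U"

lemma component_eq:
  assumes "decomp q c" "\<gamma> \<in> G"
  shows "comp \<gamma> q = c \<gamma>"
proof -
  have "comp \<gamma> q = (THE r. \<exists>c. decomp q c \<and> r = c \<gamma>)"
    by (simp add: component_def decomp_def conj_assoc)
  also have "\<dots> = c \<gamma>"
    using assms decomp_unique by (intro the_equality) blast+
  finally show ?thesis .
qed

lemma component_lin:
  assumes \<gamma>: "\<gamma> \<in> G"
  shows "comp \<gamma> \<in> lin_maps V V"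
proof (rule lin_mapsI)
  fix q assume "q \<in> carrier V"
  then obtain c where "decomp q c" using decomp_exists by blast
  then show "comp \<gamma> q \<in> carrier V"
    using U_closed \<gamma> by (simp add: component_eq) (simp add: decomp_def)
next
  fix q r assume "q \<in> carrier V" "r \<in> carrier V"
  then obtain c d where cd: "decomp q c" "decomp r d" using decomp_exists by blast
  show "comp \<gamma> (q \<oplus> r) = comp \<gamma> q \<oplus> comp \<gamma> r"
    by (simp only: component_eq[OF decomp_add[OF cd] \<gamma>] component_eq[OF cd(1) \<gamma>] component_eq[OF cd(2) \<gamma>])
next
  fix a q assume "q \<in> carrier V"
  then obtain c where c: "decomp q c" using decomp_exists by blast
  show "comp \<gamma> (a \<odot> q) = a \<odot> comp \<gamma> q"
    by (simp only: component_eq[OF decomp_scal[OF c] \<gamma>] component_eq[OF c \<gamma>])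
qed

lemma component_homogeneous:
  "\<gamma> \<in> G \<Longrightarrow> \<delta> \<in> G \<Longrightarrow> q \<in> U \<delta> \<Longrightarrow> comp \<gamma> q = (if \<gamma> = \<delta> then q else \<zero>)"
  using component_eq[OF decomp_homogeneous] by simp

end

section \<open>The truncated polynomial algebra\<close>

lemma Gam_zero: "0 \<in> Gam l"
  and Gam_add: "g \<in> Gam l \<Longrightarrow> h \<in> Gam l \<Longrightarrow> g + h \<in> Gam l"
  and Gam_diff: "g \<in> Gam l \<Longrightarrow> h \<in> Gam l \<Longrightarrow> g - h \<in> Gam l"
  and Omg_Gam: "w \<in> Omg l \<Longrightarrow> w \<in> Gam l"
  and Omg_zero: "0 \<in> Omg l"
  using keys_add[of g h] keys_diff[of g h]
  by (auto simp: Gam_def Omg_def)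

lemma Omg_add: "v \<in> Omg l \<Longrightarrow> w \<in> Omg l \<Longrightarrow> v + w \<in> Omg l"
  using Gam_add by (auto simp: Omg_def lookup_add)

text \<open>
  The type argument fixes the ground field, on which neither \<open>l\<close> nor \<open>\<Omega>\<^sub>0\<close> depends.
\<close>
locale truncation =
  fixes l :: nat and \<Omega>\<^sub>0 :: "(nat \<Rightarrow>\<^sub>0 int) set" and field_type :: "'f::field itself"
  assumes \<Omega>\<^sub>0_sub: "\<Omega>\<^sub>0 \<subseteq> Omg l"
    and \<Omega>\<^sub>0_add: "\<And>v w. v \<in> Omg l \<Longrightarrow> w \<in> \<Omega>\<^sub>0 \<Longrightarrow> v + w \<in> \<Omega>\<^sub>0"
begin

abbreviation P :: "('f, (nat \<Rightarrow>\<^sub>0 int) \<Rightarrow>\<^sub>0 'f) module" where "P \<equiv> monoid_algebra (Omg l)"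

abbreviation A :: "('f, ((nat \<Rightarrow>\<^sub>0 int) \<Rightarrow>\<^sub>0 'f) set) module" where "A \<equiv> trunc_alg l \<Omega>\<^sub>0"

abbreviation I :: "((nat \<Rightarrow>\<^sub>0 int) \<Rightarrow>\<^sub>0 'f) set" where "I \<equiv> trunc_ideal l \<Omega>\<^sub>0"

abbreviation \<tau> :: "(nat \<Rightarrow>\<^sub>0 int) \<Rightarrow> ((nat \<Rightarrow>\<^sub>0 int) \<Rightarrow>\<^sub>0 'f) set" where "\<tau> \<equiv> tau l \<Omega>\<^sub>0"

sublocale P: calg P
  by (rule monoid_algebra_calg) (auto intro: Omg_zero Omg_add)

lemma trunc_gens: "(\<lambda>w. Poly_Mapping.single w 1) ` \<Omega>\<^sub>0 \<subseteq> carrier P"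
  using \<Omega>\<^sub>0_sub by (auto simp: monoid_algebra_simps)

lemma trunc_ideal_ideal: "ideal I P"
  unfolding trunc_ideal_def by (rule P.genideal_ideal[OF trunc_gens])

sublocale PQ: quot_vec P I
  by unfold_locales (rule P.ideal_subspace[OF trunc_ideal_ideal])

lemma A_calg: "calg A"
  unfolding trunc_alg_def by (rule P.quotient_calg[OF trunc_ideal_ideal])

lemma monom_closed: "w \<in> Omg l \<Longrightarrow> Poly_Mapping.single w c \<in> carrier P"
  by (simp add: monoid_algebra_simps)

lemma tau_closed: "w \<in> Omg l \<Longrightarrow> \<tau> w \<in> carrier A"
  unfolding tau_def trunc_alg_def by (intro PQ.coset_closed monom_closed)

lemma tau_mult:
  assumes "v \<in> Omg l" "w \<in> Omg l"
  shows "\<tau> v \<otimes>\<^bsub>A\<^esub> \<tau> w = \<tau> (v + w)"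
  unfolding tau_def trunc_alg_def
  by (subst P.quotient_calg(2)[OF trunc_ideal_ideal monom_closed[OF assms(1)] monom_closed[OF assms(2)]])
    (simp add: monoid_algebra_simps(4) mult_single)

lemma tau_zero: "w \<in> \<Omega>\<^sub>0 \<Longrightarrow> \<tau> w = \<zero>\<^bsub>A\<^esub>"
  using P.genideal_self[OF trunc_gens] PQ.coset_zero[of "Poly_Mapping.single w 1"]
  by (auto simp: tau_def trunc_alg_def quotient_simps trunc_ideal_def)

lemma trunc_alg_generated:
  assumes U: "lin_subspace A U" and \<tau>: "\<And>w. w \<in> Omg l - \<Omega>\<^sub>0 \<Longrightarrow> \<tau> w \<in> U"
  shows "carrier A \<subseteq> U"
proof
  fix a assume "a \<in> carrier A"
  then obtain u where u: "u \<in> carrier P" "a = I +>\<^bsub>P\<^esub> u"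
    unfolding trunc_alg_def PQ.quotient_carrier by blast
  have lin: "(\<lambda>u. I +>\<^bsub>P\<^esub> u) \<in> lin_maps P A" unfolding trunc_alg_def by (rule PQ.coset_lin)
  have vA: "vec A" unfolding trunc_alg_def by (rule PQ.Q.vec_axioms)
  have "Poly_Mapping.keys u \<subseteq> Omg l" using u by (simp add: monoid_algebra_simps)
  then have "I +>\<^bsub>P\<^esub> u \<in> U"
  proof (induction u rule: finsupp_induct)
    case zero
    then show ?case
      using lin_maps_zero[OF P.vec_axioms vA lin] U by (simp add: monoid_algebra_simps lin_subspace_def)
  next
    case (single w c)
    have "\<tau> w \<in> U" using single \<tau>[of w] tau_zero[of w] U
      by (cases "w \<in> \<Omega>\<^sub>0") (simp_all add: lin_subspace_def)
    then have "c \<odot>\<^bsub>A\<^esub> \<tau> w \<in> U" using U unfolding lin_subspace_def by blast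
    then show ?case
      using lin_maps_smult[OF lin monom_closed[OF single, of 1], of c]
      by (simp add: tau_def monoid_algebra_simps(6))
  next
    case (add u v)
    then have "(I +>\<^bsub>P\<^esub> u) \<oplus>\<^bsub>A\<^esub> (I +>\<^bsub>P\<^esub> v) \<in> U" using U unfolding lin_subspace_def by blast
    then show ?case using lin_maps_add[OF lin, of u v] add by (simp add: monoid_algebra_simps)
  qed
  with u show "a \<in> U" by simp
qed

text \<open>
  As \<open>\<Omega>\<^sub>0\<close> absorbs \<open>\<nat>\<^sup>l\<close>, the polynomials with all exponents in \<open>\<Omega>\<^sub>0\<close> form an ideal.
\<close>
lemma trunc_ideal_support: "I \<subseteq> {u \<in> carrier P. Poly_Mapping.keys u \<subseteq> \<Omega>\<^sub>0}"
  unfolding trunc_ideal_def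
proof (rule P.genideal_minimal)
  let ?K = "{u \<in> carrier P. Poly_Mapping.keys u \<subseteq> \<Omega>\<^sub>0}"
  show "ideal ?K P"
  proof (rule idealI)
    show "subgroup ?K (add_monoid P)"
    proof (rule P.add.subgroupI)
      fix u v assume uv: "u \<in> ?K" "v \<in> ?K"
      then show "u \<oplus>\<^bsub>P\<^esub> v \<in> ?K"
        using keys_add[of u v] by (auto simp: monoid_algebra_simps)
    next
      fix u assume uv: "u \<in> ?K"
      have "\<ominus>\<^bsub>P\<^esub> u = - u"
        using uv by (intro finsupp_a_inv[OF P.M.abelian_group_axioms]) (auto simp: monoid_algebra_simps)
      then show "\<ominus>\<^bsub>P\<^esub> u \<in> ?K"
        using uv by (simp add: monoid_algebra_simps(1))
    qed (auto simp: monoid_algebra_simps intro: exI[of _ 0])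
  next
    fix u v assume u: "u \<in> ?K" and v: "v \<in> carrier P"
    have "Poly_Mapping.keys (v * u) \<subseteq> \<Omega>\<^sub>0"
      using keys_mult[of v u] u v \<Omega>\<^sub>0_add by (fastforce simp: monoid_algebra_simps)
    then show "v \<otimes>\<^bsub>P\<^esub> u \<in> ?K" "u \<otimes>\<^bsub>P\<^esub> v \<in> ?K"
      using u v P.m_closed[of v u] by (simp_all add: monoid_algebra_simps mult.commute)
  qed (rule P.ring_axioms)
  show "(\<lambda>w. Poly_Mapping.single w 1) ` \<Omega>\<^sub>0 \<subseteq> ?K"
    using \<Omega>\<^sub>0_sub by (auto simp: monoid_algebra_simps)
qed

text \<open>
  The ideal is spanned by monomials, so operators that are diagonal in the monomials descend to the
  quotient. The case \<open>\<phi>(\<omega>) = \<omega>\<^sub>i\<close> is used for the grading.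
\<close>
lemma diagonal_map_exists:
  "\<exists>d. d \<in> lin_maps A A \<and> (\<forall>w\<in>Omg l. d (\<tau> w) = \<phi> w \<odot>\<^bsub>A\<^esub> \<tau> w)"
proof -
  interpret A: calg A by (rule A_calg)
  define f where "f = lin_ext A (\<lambda>w. \<phi> w \<odot>\<^bsub>A\<^esub> \<tau> w)"
  have f: "f \<in> lin_maps P A"
    unfolding f_def by (rule A.lin_ext_lin[where G = "Omg l"]) (auto simp: monoid_algebra_simps tau_closed)
  have "f u = \<zero>\<^bsub>A\<^esub>" if "u \<in> I" for u
    unfolding f_def lin_ext_def
  proof (rule A.add.finprod_one_eqI)
    fix w assume "w \<in> Poly_Mapping.keys u"
    then have "w \<in> \<Omega>\<^sub>0" using that trunc_ideal_support by blast
    then show "Poly_Mapping.lookup u w \<odot>\<^bsub>A\<^esub> (\<phi> w \<odot>\<^bsub>A\<^esub> \<tau> w) = \<zero>\<^bsub>A\<^esub>"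
      by (simp add: tau_zero)
  qed
  from PQ.quotient_map_exists[OF A.vec_axioms f this]
  obtain d where d: "d \<in> lin_maps A A" "\<forall>u\<in>carrier P. d (I +>\<^bsub>P\<^esub> u) = f u"
    unfolding trunc_alg_def by blast
  have "\<forall>w\<in>Omg l. d (\<tau> w) = \<phi> w \<odot>\<^bsub>A\<^esub> \<tau> w"
  proof
    fix w assume w: "w \<in> Omg l"
    have "d (\<tau> w) = f (Poly_Mapping.single w 1)"
      unfolding tau_def using d(2) monom_closed[OF w] by blast
    also have "\<dots> = \<phi> w \<odot>\<^bsub>A\<^esub> \<tau> w"
      unfolding f_def using w tau_closed by (subst A.lin_ext_single) simp_all
    finally show "d (\<tau> w) = \<phi> w \<odot>\<^bsub>A\<^esub> \<tau> w" .
  qed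
  with d(1) show ?thesis by blast
qed

end

section \<open>Symmetric powers\<close>
context sym_space begin

abbreviation sym_monomial :: "(nat \<Rightarrow> 'v) \<Rightarrow> nat \<Rightarrow> ('v multiset \<Rightarrow>\<^sub>0 'f) set" where
  "sym_monomial x n \<equiv> \<Otimes>\<^bsub>sym_alg V\<^esub>i\<in>{..<n}. sym_incl V (x i)"

lemma sym_monomial_Suc:
  assumes "\<forall>i<Suc n. x i \<in> carrier V"
  shows "sym_monomial x (Suc n) = sym_incl V (x n) \<otimes>\<^bsub>sym_alg V\<^esub> sym_monomial x n"
  using assms unfolding lessThan_Suc by (subst S.finprod_insert) (auto intro: sym_incl_closed)

lemma sym_monomial_closed: "\<forall>i<n. x i \<in> carrier V \<Longrightarrow> sym_monomial x n \<in> carrier (sym_alg V)"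
  by (intro S.finprod_closed) (auto intro: sym_incl_closed)

lemma sym_monomial_cong:
  "(\<And>i. i < n \<Longrightarrow> x i = y i) \<Longrightarrow> \<forall>i<n. y i \<in> carrier V \<Longrightarrow> sym_monomial x n = sym_monomial y n"
  by (intro S.finprod_cong') (auto intro: sym_incl_closed)

lemma sym_monomial_extend:
  assumes "\<forall>i<n. x i \<in> carrier V" "y \<in> carrier V"
  shows "sym_incl V y \<otimes>\<^bsub>sym_alg V\<^esub> sym_monomial x n = sym_monomial (x(n := y)) (Suc n)"
  using assms sym_monomial_cong[of n "x(n := y)" x] by (subst sym_monomial_Suc) auto

lemma sym_power_subspace: "lin_subspace (sym_alg V) (sym_power V k)"
  unfolding sym_power_def
  by (rule S.lin_span_subspace) (auto intro: sym_monomial_closed)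

lemma sym_monomial_power: "\<forall>i<k. x i \<in> carrier V \<Longrightarrow> sym_monomial x k \<in> sym_power V k"
  unfolding sym_power_def
  by (rule subsetD[OF S.lin_span_superset]) (auto intro: sym_monomial_closed)

lemma sym_power_minimal:
  assumes "lin_subspace (sym_alg V) U" "\<And>x. \<forall>i<k. x i \<in> carrier V \<Longrightarrow> sym_monomial x k \<in> U"
  shows "sym_power V k \<subseteq> U"
  unfolding sym_power_def using assms by (intro S.lin_span_minimal) auto

lemma sym_power_mult:
  assumes y: "y \<in> carrier V" and q: "q \<in> sym_power V k"
  shows "sym_incl V y \<otimes>\<^bsub>sym_alg V\<^esub> q \<in> sym_power V (Suc k)"
proof -
  have "lin_subspace (sym_alg V) {q \<in> carrier (sym_alg V). sym_incl V y \<otimes>\<^bsub>sym_alg V\<^esub> q \<in> sym_power V (Suc k)}"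
    by (rule lin_maps_preimage[OF S.vec_axioms S.vec_axioms S.mult_left_lin[OF sym_incl_closed[OF y]] sym_power_subspace])
  then have "sym_power V k \<subseteq> {q \<in> carrier (sym_alg V). sym_incl V y \<otimes>\<^bsub>sym_alg V\<^esub> q \<in> sym_power V (Suc k)}"
  proof (rule sym_power_minimal)
    fix x assume x: "\<forall>i<k. x i \<in> carrier V"
    have "sym_monomial (x(k := y)) (Suc k) \<in> sym_power V (Suc k)"
      using x y by (intro sym_monomial_power) (auto simp: less_Suc_eq)
    then show "sym_monomial x k \<in> {q \<in> carrier (sym_alg V). sym_incl V y \<otimes>\<^bsub>sym_alg V\<^esub> q \<in> sym_power V (Suc k)}"
      using x y by (simp add: sym_monomial_closed sym_monomial_extend)
  qed
  with q show ?thesis by blast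
qed

end

section \<open>The current algebra over the truncated polynomial algebra\<close>
locale truncated_current = truncation l \<Omega>\<^sub>0 "TYPE('f)"
  for l \<Omega>\<^sub>0 and L :: "('f::field_char_0, 'v, 'm) lie_alg_scheme" +
  assumes L: "lie_algebra L" and \<Omega>\<^sub>1_finite: "finite (Omg l - \<Omega>\<^sub>0)"
begin

sublocale current_space L A
  by (intro current_space.intro current_space_axioms.intro A_calg L)

sublocale SL: sym_space L by (intro sym_space.intro L.vec_axioms)

sublocale SC: sym_space C by (intro sym_space.intro C.vec_axioms)

abbreviation SA where "SA \<equiv> sym_alg C"

abbreviation \<Omega>\<^sub>1 where "\<Omega>\<^sub>1 \<equiv> Omg l - \<Omega>\<^sub>0"

text \<open>
  \<open>\<iota> x w\<close> is the element \<open>x \<otimes> \<tau>\<^sup>w\<close> of the symmetric algebra of the current algebra.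
\<close>
definition \<iota> where "\<iota> x w = sym_incl C (tens x (\<tau> w))"

lemma current_eq: "current l \<Omega>\<^sub>0 L = C" by (simp add: current_def)

lemma tens_closed: "x \<in> carrier L \<Longrightarrow> a \<in> carrier A \<Longrightarrow> tens x a \<in> carrier C"
  by (simp add: current_simps pure_tensor_closed)

lemma incl_closed: "x \<in> carrier L \<Longrightarrow> w \<in> Omg l \<Longrightarrow> \<iota> x w \<in> carrier SA"
  unfolding \<iota>_def by (intro SC.sym_incl_closed tens_closed tau_closed)

lemma incl_lin_right: "x \<in> carrier L \<Longrightarrow> (\<lambda>a. sym_incl C (tens x a)) \<in> lin_maps A SA"
  using lin_maps_comp[OF _ SC.sym_incl_lin, of "tens x" A] pure_tensor_lin_right[of x]
  by (simp add: lin_maps_current)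

lemma incl_lin_left: "a \<in> carrier A \<Longrightarrow> (\<lambda>x. sym_incl C (tens x a)) \<in> lin_maps L SA"
  using lin_maps_comp[OF _ SC.sym_incl_lin, of "\<lambda>x. tens x a" L] pure_tensor_lin_left[of a]
  by (simp add: lin_maps_current)

lemma incl_zero: "x \<in> carrier L \<Longrightarrow> w \<in> \<Omega>\<^sub>0 \<Longrightarrow> \<iota> x w = \<zero>\<^bsub>SA\<^esub>"
  using lin_maps_zero[OF A.vec_axioms SC.S.vec_axioms incl_lin_right] by (simp add: \<iota>_def tau_zero)

text \<open>
  The monomials with exponents in \<open>\<Omega>\<^sub>0\<close> vanish in \<open>A\<close>.
\<close>
lemma current_generated:
  assumes "lin_subspace C U" "\<And>x w. x \<in> carrier L \<Longrightarrow> w \<in> \<Omega>\<^sub>1 \<Longrightarrow> tens x (\<tau> w) \<in> U"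
  shows "carrier C \<subseteq> U"
proof -
  have U: "lin_subspace T U" using assms(1) by (simp add: lin_maps_current)
  have "carrier T \<subseteq> U"
  proof (rule tensor_generated[OF U])
    fix x a assume x: "x \<in> carrier L" and a: "a \<in> carrier A"
    have "lin_subspace A {a \<in> carrier A. tens x a \<in> U}"
      by (rule lin_maps_preimage[OF A.vec_axioms T.vec_axioms pure_tensor_lin_right[OF x] U])
    then have "carrier A \<subseteq> {a \<in> carrier A. tens x a \<in> U}"
      by (rule trunc_alg_generated) (use assms(2) x tau_closed in simp)
    with a show "tens x a \<in> U" by blast
  qed
  then show ?thesis by (simp add: current_simps)
qed

lemma tau_sum_closed: "tau_sum l \<Omega>\<^sub>0 \<in> carrier A"
  unfolding tau_sum_def by (intro A.finsum_closed) (auto intro: tau_closed)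

lemma tau_map_hom: "tau_map l \<Omega>\<^sub>0 L \<in> alg_hom (sym_alg L) SA"
  and tau_map_incl': "x \<in> carrier L \<Longrightarrow>
    tau_map l \<Omega>\<^sub>0 L (sym_incl L x) = sym_incl C (tens x (tau_sum l \<Omega>\<^sub>0))"
proof -
  let ?P = "\<lambda>h. h \<in> extensional (carrier (sym_alg L)) \<and> h \<in> alg_hom (sym_alg L) SA \<and>
             (\<forall>x\<in>carrier L. h (sym_incl L x) = sym_incl C (tens x (tau_sum l \<Omega>\<^sub>0)))"
  have "\<exists>!h. ?P h"
  proof (rule ex_ex1I)
    obtain h where h: "h \<in> alg_hom (sym_alg L) SA"
      "\<forall>x\<in>carrier L. h (sym_incl L x) = sym_incl C (tens x (tau_sum l \<Omega>\<^sub>0))"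
      using SL.sym_alg_hom_exists[OF SC.S.calg_axioms incl_lin_left[OF tau_sum_closed]] by blast
    have "?P (restrict h (carrier (sym_alg L)))"
      using h by (simp add: alg_hom_restrict[OF SL.S.calg_axioms] SL.sym_incl_closed)
    then show "\<exists>h. ?P h" by (rule exI[of ?P])
  next
    fix h h' assume "?P h" "?P h'"
    then show "h = h'"
      using SL.sym_alg_hom_unique[OF SC.S.calg_axioms, of h h']
      by (intro extensionalityI[of h "carrier (sym_alg L)"]) simp_all
  qed
  then have "?P (tau_map l \<Omega>\<^sub>0 L)"
    unfolding tau_map_def current_eq by (rule theI')
  then show "tau_map l \<Omega>\<^sub>0 L \<in> alg_hom (sym_alg L) SA"
    "x \<in> carrier L \<Longrightarrow> tau_map l \<Omega>\<^sub>0 L (sym_incl L x) = sym_incl C (tens x (tau_sum l \<Omega>\<^sub>0))"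
    by simp_all
qed

lemma tau_map_incl:
  assumes "x \<in> carrier L"
  shows "tau_map l \<Omega>\<^sub>0 L (sym_incl L x) = (\<Oplus>\<^bsub>SA\<^esub>w\<in>\<Omega>\<^sub>1. \<iota> x w)"
  unfolding tau_map_incl'[OF assms] tau_sum_def \<iota>_def
  by (rule lin_maps_finsum[OF A.vec_axioms SC.S.vec_axioms incl_lin_right[OF assms]])
    (auto intro: tau_closed)

section \<open>The grading of the symmetric algebra\<close>

definition homogeneous_monomials where
  "homogeneous_monomials \<delta> = {\<Otimes>\<^bsub>SA\<^esub>i\<in>{..<n}. \<iota> (x i) (w i)
    | (n::nat) x w. (\<forall>i<n. x i \<in> carrier L \<and> w i \<in> \<Omega>\<^sub>1) \<and> (\<Sum>i<n. w i) = \<delta>}"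

abbreviation U where "U \<equiv> degree_space l \<Omega>\<^sub>0 L"

lemma degree_space_eq: "U \<delta> = lin_span SA (homogeneous_monomials \<delta>)"
  by (simp add: degree_space_def homogeneous_monomials_def current_eq \<iota>_def)

text \<open>
  Here \<open>Q \<delta> q\<close> may mention the degree \<open>\<delta>\<close>, to which each new factor adds its own.
\<close>
lemma homogeneous_monomials_induct [consumes 1, case_names one mult]:
  assumes "q \<in> homogeneous_monomials \<delta>"
    and one: "Q 0 \<one>\<^bsub>SA\<^esub>"
    and mult: "\<And>x w \<delta> q. x \<in> carrier L \<Longrightarrow> w \<in> \<Omega>\<^sub>1 \<Longrightarrow> q \<in> carrier SA \<Longrightarrow> Q \<delta> q \<Longrightarrow>
      Q (\<delta> + w) (\<iota> x w \<otimes>\<^bsub>SA\<^esub> q)"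
  shows "Q \<delta> q"
proof -
  have "Q (\<Sum>i<n. w i) (\<Otimes>\<^bsub>SA\<^esub>i\<in>{..<n}. \<iota> (x i) (w i))"
    if "\<forall>i<n. x i \<in> carrier L \<and> w i \<in> \<Omega>\<^sub>1" for n :: nat and x w
    using that
  proof (induction n)
    case 0
    then show ?case using one by simp
  next
    case (Suc n)
    have cl: "(\<lambda>i. \<iota> (x i) (w i)) \<in> {..<n} \<rightarrow> carrier SA" "\<iota> (x n) (w n) \<in> carrier SA"
      using Suc.prems by (auto intro!: incl_closed)
    then have "(\<Otimes>\<^bsub>SA\<^esub>i\<in>{..<n}. \<iota> (x i) (w i)) \<in> carrier SA" by (intro SC.S.finprod_closed)
    with cl show ?case
      using mult[of "x n" "w n" "\<Otimes>\<^bsub>SA\<^esub>i\<in>{..<n}. \<iota> (x i) (w i)" "\<Sum>i<n. w i"] Suc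
      unfolding lessThan_Suc by (subst SC.S.finprod_insert) (auto simp: add.commute)
  qed
  with assms(1) show ?thesis unfolding homogeneous_monomials_def by blast
qed

lemma homogeneous_monomials_one: "\<one>\<^bsub>SA\<^esub> \<in> homogeneous_monomials 0"
  unfolding homogeneous_monomials_def by (intro CollectI exI[of _ 0]) simp

lemma homogeneous_monomials_mult:
  assumes x: "y \<in> carrier L" and w: "v \<in> \<Omega>\<^sub>1" and q: "q \<in> homogeneous_monomials \<delta>"
  shows "\<iota> y v \<otimes>\<^bsub>SA\<^esub> q \<in> homogeneous_monomials (\<delta> + v)"
proof -
  obtain n x w where n: "\<forall>i<n. x i \<in> carrier L \<and> w i \<in> \<Omega>\<^sub>1" "(\<Sum>i<n. w i) = \<delta>"
    and q: "q = (\<Otimes>\<^bsub>SA\<^esub>i\<in>{..<n::nat}. \<iota> (x i) (w i))"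
    using q unfolding homogeneous_monomials_def by blast
  let ?x = "x(n := y)" and ?w = "w(n := v)"
  have "(\<Otimes>\<^bsub>SA\<^esub>i\<in>{..<n}. \<iota> (?x i) (?w i)) = q"
    unfolding q using n by (intro SC.S.finprod_cong') (auto intro: incl_closed)
  moreover have "(\<lambda>i. \<iota> (?x i) (?w i)) \<in> {..<n} \<rightarrow> carrier SA"
    using n by (auto intro!: incl_closed)
  ultimately have "\<iota> y v \<otimes>\<^bsub>SA\<^esub> q = (\<Otimes>\<^bsub>SA\<^esub>i\<in>{..<Suc n}. \<iota> (?x i) (?w i))"
    unfolding lessThan_Suc using assms(1,2) by (subst SC.S.finprod_insert) (auto intro!: incl_closed)
  moreover have "(\<Sum>i<Suc n. ?w i) = \<delta> + v" using n(2) by simp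
  moreover have "\<forall>i<Suc n. ?x i \<in> carrier L \<and> ?w i \<in> \<Omega>\<^sub>1" using n(1) assms(1,2) by (auto simp: less_Suc_eq)
  ultimately show ?thesis unfolding homogeneous_monomials_def by blast
qed

lemma homogeneous_monomials_closed: "homogeneous_monomials \<delta> \<subseteq> carrier SA"
proof
  fix q assume "q \<in> homogeneous_monomials \<delta>"
  then show "q \<in> carrier SA"
    by (induction rule: homogeneous_monomials_induct) (auto intro: incl_closed)
qed

lemma degree_space_subspace: "lin_subspace SA (U \<delta>)"
  unfolding degree_space_eq by (rule SC.S.lin_span_subspace[OF homogeneous_monomials_closed])

lemma degree_space_closed: "q \<in> U \<delta> \<Longrightarrow> q \<in> carrier SA"
  using degree_space_subspace[of \<delta>] unfolding lin_subspace_def by blast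

lemma degree_space_one: "\<one>\<^bsub>SA\<^esub> \<in> U 0"
  unfolding degree_space_eq
  by (rule subsetD[OF SC.S.lin_span_superset[OF homogeneous_monomials_closed] homogeneous_monomials_one])

lemma degree_space_mult:
  assumes x: "x \<in> carrier L" and w: "w \<in> \<Omega>\<^sub>1" and q: "q \<in> U \<delta>"
  shows "\<iota> x w \<otimes>\<^bsub>SA\<^esub> q \<in> U (\<delta> + w)"
proof -
  have "\<iota> x w \<in> carrier SA" using x w by (auto intro: incl_closed)
  then have "lin_subspace SA {q \<in> carrier SA. \<iota> x w \<otimes>\<^bsub>SA\<^esub> q \<in> U (\<delta> + w)}"
    by (intro lin_maps_preimage[OF SC.S.vec_axioms SC.S.vec_axioms _ degree_space_subspace] SC.S.mult_left_lin)
  then have "U \<delta> \<subseteq> {q \<in> carrier SA. \<iota> x w \<otimes>\<^bsub>SA\<^esub> q \<in> U (\<delta> + w)}"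
    unfolding degree_space_eq[of \<delta>]
    using homogeneous_monomials_closed homogeneous_monomials_mult[OF x w]
      SC.S.lin_span_superset[OF homogeneous_monomials_closed, of "\<delta> + w"]
    by (intro SC.S.lin_span_minimal) (auto simp: degree_space_eq)
  with q show ?thesis by blast
qed

text \<open>
  Apply \<open>derivation_exists\<close> to \<open>id \<otimes> d\<close>, with \<open>d\<close> the diagonal operator on \<open>A\<close> with eigenvalues \<open>\<phi>\<close>.
\<close>
lemma weight_derivation_exists:
  "\<exists>D. D \<in> derivations SA \<and> (\<forall>x\<in>carrier L. \<forall>w\<in>Omg l. D (\<iota> x w) = \<phi> w \<odot>\<^bsub>SA\<^esub> \<iota> x w)"
proof -
  obtain d where d: "d \<in> lin_maps A A" "\<forall>w\<in>Omg l. d (\<tau> w) = \<phi> w \<odot>\<^bsub>A\<^esub> \<tau> w"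
    using diagonal_map_exists by blast
  have "(\<lambda>x a. sym_incl C (tens x (d a))) \<in> bilin_maps L A SA"
    unfolding bilin_maps_def
    using incl_lin_left lin_maps_closed[OF d(1)] lin_maps_comp[OF d(1) incl_lin_right] by simp
  from tensor_map_exists[OF SC.S.vec_axioms this]
  obtain f where f: "f \<in> lin_maps C SA"
    "\<forall>x\<in>carrier L. \<forall>a\<in>carrier A. f (tens x a) = sym_incl C (tens x (d a))"
    by (auto simp: lin_maps_current)
  obtain D where D: "D \<in> derivations SA" "\<forall>z\<in>carrier C. D (sym_incl C z) = f z"
    using SC.derivation_exists[OF f(1)] by blast
  have "D (\<iota> x w) = \<phi> w \<odot>\<^bsub>SA\<^esub> \<iota> x w" if "x \<in> carrier L" "w \<in> Omg l" for x w
    using that D(2) f(2) d(2) tens_closed tau_closed lin_maps_smult[OF incl_lin_right[OF that(1)]]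
    by (simp add: \<iota>_def)
  with D(1) show ?thesis by blast
qed

lemma weight_derivation_degree:
  assumes D: "D \<in> derivations SA" "\<And>x w. x \<in> carrier L \<Longrightarrow> w \<in> Omg l \<Longrightarrow> D (\<iota> x w) = \<phi> w \<odot>\<^bsub>SA\<^esub> \<iota> x w"
    and \<phi>: "\<phi> 0 = 0" "\<And>v w. \<phi> (v + w) = \<phi> v + \<phi> w"
    and q: "q \<in> U \<delta>"
  shows "D q = \<phi> \<delta> \<odot>\<^bsub>SA\<^esub> q"
proof -
  note lin = derivations_lin[OF D(1)]
  have mon: "D q = \<phi> \<delta> \<odot>\<^bsub>SA\<^esub> q" if "q \<in> homogeneous_monomials \<delta>" for q \<delta>
    using that
  proof (induction rule: homogeneous_monomials_induct)
    case one
    then show ?case by (simp add: SC.S.derivations_one[OF D(1)] \<phi>)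
  next
    case (mult x w \<delta> q)
    then have x: "\<iota> x w \<in> carrier SA" by (auto intro: incl_closed)
    have "D (\<iota> x w \<otimes>\<^bsub>SA\<^esub> q) =
        (\<phi> w \<odot>\<^bsub>SA\<^esub> \<iota> x w) \<otimes>\<^bsub>SA\<^esub> q \<oplus>\<^bsub>SA\<^esub> \<iota> x w \<otimes>\<^bsub>SA\<^esub> (\<phi> \<delta> \<odot>\<^bsub>SA\<^esub> q)"
      using mult x by (simp add: derivations_mult[OF D(1)] D(2))
    also have "\<dots> = \<phi> w \<odot>\<^bsub>SA\<^esub> (\<iota> x w \<otimes>\<^bsub>SA\<^esub> q) \<oplus>\<^bsub>SA\<^esub> \<phi> \<delta> \<odot>\<^bsub>SA\<^esub> (\<iota> x w \<otimes>\<^bsub>SA\<^esub> q)"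
      using mult x by (simp add: SC.S.scal_mult_left SC.S.scal_mult_right)
    also have "\<dots> = (\<phi> w + \<phi> \<delta>) \<odot>\<^bsub>SA\<^esub> (\<iota> x w \<otimes>\<^bsub>SA\<^esub> q)"
      using mult x by (simp add: SC.S.scal_add_left)
    also have "\<phi> w + \<phi> \<delta> = \<phi> (\<delta> + w)"
      by (simp add: \<phi>)
    finally show ?case .
  qed
  have sc: "(\<lambda>q. \<phi> \<delta> \<odot>\<^bsub>SA\<^esub> q) \<in> lin_maps SA SA"
    by (intro lin_mapsI) (simp_all add: SC.S.scal_add_right mult.commute flip: SC.S.scal_mult)
  have "lin_subspace SA {q \<in> carrier SA. D q = \<phi> \<delta> \<odot>\<^bsub>SA\<^esub> q}"
    by (rule lin_maps_eq_subspace[OF SC.S.vec_axioms SC.S.vec_axioms lin sc])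
  then have "U \<delta> \<subseteq> {q \<in> carrier SA. D q = \<phi> \<delta> \<odot>\<^bsub>SA\<^esub> q}"
    unfolding degree_space_eq using mon homogeneous_monomials_closed
    by (intro SC.S.lin_span_minimal) blast+
  with q show ?thesis by blast
qed

text \<open>
  The integer coordinates of a degree are its eigenvalues under the weight derivations. This is where
  characteristic zero enters: different integers have different images in the field.
\<close>
lemma degree_spaces_independent:
  assumes "finite K" "\<And>\<delta>. \<delta> \<in> K \<Longrightarrow> c \<delta> \<in> U \<delta>" "(\<Oplus>\<^bsub>SA\<^esub>\<delta>\<in>K. c \<delta>) = \<zero>\<^bsub>SA\<^esub>" "\<delta> \<in> K"
  shows "c \<delta> = \<zero>\<^bsub>SA\<^esub>"
proof -
  define \<phi> :: "nat \<Rightarrow> (nat \<Rightarrow>\<^sub>0 int) \<Rightarrow> 'f" where "\<phi> i w = of_int (Poly_Mapping.lookup w i)" for i w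
  have \<phi>: "\<phi> i 0 = 0" "\<phi> i (v + w) = \<phi> i v + \<phi> i w" for i v w by (simp_all add: \<phi>_def lookup_add)
  have "\<exists>D. \<forall>i. D i \<in> derivations SA \<and> (\<forall>x\<in>carrier L. \<forall>w\<in>Omg l. D i (\<iota> x w) = \<phi> i w \<odot>\<^bsub>SA\<^esub> \<iota> x w)"
    using weight_derivation_exists by (intro choice allI)
  then obtain D where D: "\<And>i. D i \<in> derivations SA"
    "\<And>i x w. x \<in> carrier L \<Longrightarrow> w \<in> Omg l \<Longrightarrow> D i (\<iota> x w) = \<phi> i w \<odot>\<^bsub>SA\<^esub> \<iota> x w"
    by blast
  show ?thesis
  proof (rule SC.S.eigenvectors_independent[where D = D and \<phi> = \<phi> and K = K and c = c])
    show "\<exists>i. \<phi> i \<delta> \<noteq> \<phi> i \<epsilon>" if "\<delta> \<noteq> \<epsilon>" for \<delta> \<epsilon>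
      using that by (auto simp: \<phi>_def poly_mapping_eq_iff fun_eq_iff)
    show "D i (c \<delta>) = \<phi> i \<delta> \<odot>\<^bsub>SA\<^esub> c \<delta>" if "\<delta> \<in> K" for \<delta> i
      by (rule weight_derivation_degree[OF D \<phi> assms(2)[OF that]])
  qed (use assms D derivations_lin degree_space_closed in \<open>blast+\<close>)
qed

text \<open>
  The span of the homogeneous elements contains \<open>1\<close> and is stable under multiplication by each
  \<open>x \<otimes> \<tau>\<^sup>w\<close>, hence by each element of the current algebra.
\<close>
lemma degree_spaces_span: "carrier SA \<subseteq> lin_span SA (\<Union>\<delta>\<in>Gam l. U \<delta>)"
proof -
  let ?M = "\<Union>\<delta>\<in>Gam l. U \<delta>"
  have M: "?M \<subseteq> carrier SA" using degree_space_closed by blast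
  note span = SC.S.lin_span_subspace[OF M] and sup = SC.S.lin_span_superset[OF M]
  have hom: "\<iota> x w \<otimes>\<^bsub>SA\<^esub> q \<in> lin_span SA ?M" if xw: "x \<in> carrier L" "w \<in> \<Omega>\<^sub>1" and q: "q \<in> lin_span SA ?M" for x w q
  proof -
    have "\<iota> x w \<in> carrier SA" using xw by (auto intro: incl_closed)
    then have "lin_subspace SA {q \<in> carrier SA. \<iota> x w \<otimes>\<^bsub>SA\<^esub> q \<in> lin_span SA ?M}"
      by (intro lin_maps_preimage[OF SC.S.vec_axioms SC.S.vec_axioms _ span] SC.S.mult_left_lin)
    then have "lin_span SA ?M \<subseteq> {q \<in> carrier SA. \<iota> x w \<otimes>\<^bsub>SA\<^esub> q \<in> lin_span SA ?M}"
    proof (rule SC.S.lin_span_minimal, intro subsetI)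
      fix q assume "q \<in> ?M"
      then obtain \<delta> where \<delta>: "\<delta> \<in> Gam l" "q \<in> U \<delta>" by blast
      have "w \<in> Gam l" using xw Omg_Gam by blast
      then have "\<iota> x w \<otimes>\<^bsub>SA\<^esub> q \<in> ?M"
        using degree_space_mult[OF xw \<delta>(2)] Gam_add[OF \<delta>(1)] by blast
      with sup \<delta> show "q \<in> {q \<in> carrier SA. \<iota> x w \<otimes>\<^bsub>SA\<^esub> q \<in> lin_span SA ?M}"
        using degree_space_closed by blast
    qed
    with q show ?thesis by blast
  qed
  show ?thesis
  proof (rule SC.sym_alg_generated[OF span])
    show "\<one>\<^bsub>SA\<^esub> \<in> lin_span SA ?M" using sup degree_space_one Gam_zero by blast
    fix z q assume z: "z \<in> carrier C" and q: "q \<in> lin_span SA ?M"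
    have qc: "q \<in> carrier SA" using q span unfolding lin_subspace_def by blast
    have "(\<lambda>z. sym_incl C z \<otimes>\<^bsub>SA\<^esub> q) \<in> lin_maps C SA"
      by (rule lin_maps_comp[OF SC.sym_incl_lin SC.S.mult_right_lin[OF qc]])
    from lin_maps_preimage[OF C.vec_axioms SC.S.vec_axioms this span]
    have "carrier C \<subseteq> {z \<in> carrier C. sym_incl C z \<otimes>\<^bsub>SA\<^esub> q \<in> lin_span SA ?M}"
      by (rule current_generated) (use hom[OF _ _ q] tens_closed tau_closed in \<open>simp add: \<iota>_def\<close>)
    with z show "sym_incl C z \<otimes>\<^bsub>SA\<^esub> q \<in> lin_span SA ?M" by blast
  qed
qed

sublocale GR: graded_space SA "Gam l" U
  using degree_space_subspace degree_spaces_independent degree_spaces_span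
  by unfold_locales blast+

text \<open>
  Both sides are linear in \<open>q\<close>; for homogeneous \<open>q\<close> of degree \<open>\<delta>\<close> both are \<open>\<iota> x w \<otimes> q\<close> if
  \<open>\<gamma> = \<delta> + w\<close>, and zero otherwise.
\<close>
lemma component_mult:
  assumes x: "x \<in> carrier L" and w: "w \<in> \<Omega>\<^sub>1" and \<gamma>: "\<gamma> \<in> Gam l" and q: "q \<in> carrier SA"
  shows "GR.comp \<gamma> (\<iota> x w \<otimes>\<^bsub>SA\<^esub> q) = \<iota> x w \<otimes>\<^bsub>SA\<^esub> GR.comp (\<gamma> - w) q"
proof -
  have wG: "w \<in> Gam l" using w Omg_Gam by blast
  note \<gamma>w = Gam_diff[OF \<gamma> wG]
  have xc: "\<iota> x w \<in> carrier SA" using x w by (auto intro: incl_closed)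
  note m = SC.S.mult_left_lin[OF xc]
  let ?E = "{q \<in> carrier SA. GR.comp \<gamma> (\<iota> x w \<otimes>\<^bsub>SA\<^esub> q) = \<iota> x w \<otimes>\<^bsub>SA\<^esub> GR.comp (\<gamma> - w) q}"
  have "lin_subspace SA ?E"
    by (rule lin_maps_eq_subspace[OF SC.S.vec_axioms SC.S.vec_axioms
        lin_maps_comp[OF m GR.component_lin[OF \<gamma>]] lin_maps_comp[OF GR.component_lin[OF \<gamma>w] m]])
  then have "lin_span SA (\<Union>\<delta>\<in>Gam l. U \<delta>) \<subseteq> ?E"
  proof (rule SC.S.lin_span_minimal, intro subsetI)
    fix q assume "q \<in> (\<Union>\<delta>\<in>Gam l. U \<delta>)"
    then obtain \<delta> where \<delta>: "\<delta> \<in> Gam l" "q \<in> U \<delta>" by blast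
    have iff: "\<gamma> = \<delta> + w \<longleftrightarrow> \<gamma> - w = \<delta>" by (auto simp: algebra_simps)
    show "q \<in> ?E"
      using degree_space_closed[OF \<delta>(2)] xc
      by (simp add: GR.component_homogeneous[OF \<gamma> Gam_add[OF \<delta>(1) wG] degree_space_mult[OF x w \<delta>(2)]]
          GR.component_homogeneous[OF \<gamma>w \<delta>] iff)
  qed
  with degree_spaces_span q show ?thesis by blast
qed

section \<open>Components of invariants\<close>

text \<open>
  The order of arguments makes \<open>part \<gamma>\<close> a linear map from \<open>S(L)\<close> to \<open>S(C)\<close>.
\<close>
definition part where "part \<gamma> q = p_component l \<Omega>\<^sub>0 L q \<gamma>"

lemma part_eq: "part \<gamma> q = GR.comp \<gamma> (tau_map l \<Omega>\<^sub>0 L q)"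
  by (simp add: part_def p_component_def degree_component_def component_def current_eq)

lemma part_lin: "\<gamma> \<in> Gam l \<Longrightarrow> part \<gamma> \<in> lin_maps (sym_alg L) SA"
  unfolding part_eq by (rule lin_maps_comp[OF alg_hom_lin[OF tau_map_hom] GR.component_lin])

lemma part_closed: "\<gamma> \<in> Gam l \<Longrightarrow> q \<in> carrier (sym_alg L) \<Longrightarrow> part \<gamma> q \<in> carrier SA"
  by (rule lin_maps_closed[OF part_lin])

lemma part_one: "\<gamma> \<in> Gam l \<Longrightarrow> part \<gamma> \<one>\<^bsub>sym_alg L\<^esub> = (if \<gamma> = 0 then \<one>\<^bsub>SA\<^esub> else \<zero>\<^bsub>SA\<^esub>)"
  by (simp add: part_eq alg_hom_one[OF tau_map_hom] GR.component_homogeneous[OF _ Gam_zero degree_space_one])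

lemma \<Omega>\<^sub>1_Gam: "w \<in> \<Omega>\<^sub>1 \<Longrightarrow> w \<in> Gam l"
  using Omg_Gam by blast

text \<open>
  The recursion behind all inductions below: the image of \<open>y\<close> is \<open>\<Sum>\<^sub>w y \<otimes> \<tau>\<^sup>w\<close>, and the factor
  \<open>y \<otimes> \<tau>\<^sup>w\<close> takes away \<open>w\<close> from the degree.
\<close>
lemma part_mult:
  assumes y: "y \<in> carrier L" and q: "q \<in> carrier (sym_alg L)" and \<gamma>: "\<gamma> \<in> Gam l"
  shows "part \<gamma> (sym_incl L y \<otimes>\<^bsub>sym_alg L\<^esub> q) = (\<Oplus>\<^bsub>SA\<^esub>w\<in>\<Omega>\<^sub>1. \<iota> y w \<otimes>\<^bsub>SA\<^esub> part (\<gamma> - w) q)"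
proof -
  let ?t = "tau_map l \<Omega>\<^sub>0 L"
  have tq: "?t q \<in> carrier SA" by (rule lin_maps_closed[OF alg_hom_lin[OF tau_map_hom] q])
  have iy: "\<iota> y w \<in> carrier SA" if "w \<in> \<Omega>\<^sub>1" for w using y that by (auto intro: incl_closed)
  have "?t (sym_incl L y \<otimes>\<^bsub>sym_alg L\<^esub> q) = (\<Oplus>\<^bsub>SA\<^esub>w\<in>\<Omega>\<^sub>1. \<iota> y w) \<otimes>\<^bsub>SA\<^esub> ?t q"
    using y q by (simp add: alg_hom_mult[OF tau_map_hom] SL.sym_incl_closed tau_map_incl)
  also have "\<dots> = (\<Oplus>\<^bsub>SA\<^esub>w\<in>\<Omega>\<^sub>1. \<iota> y w \<otimes>\<^bsub>SA\<^esub> ?t q)"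
    using iy by (intro lin_maps_finsum[OF SC.S.vec_axioms SC.S.vec_axioms SC.S.mult_right_lin[OF tq]]) blast
  finally have "part \<gamma> (sym_incl L y \<otimes>\<^bsub>sym_alg L\<^esub> q) = GR.comp \<gamma> (\<Oplus>\<^bsub>SA\<^esub>w\<in>\<Omega>\<^sub>1. \<iota> y w \<otimes>\<^bsub>SA\<^esub> ?t q)"
    by (simp only: part_eq)
  also have "\<dots> = (\<Oplus>\<^bsub>SA\<^esub>w\<in>\<Omega>\<^sub>1. GR.comp \<gamma> (\<iota> y w \<otimes>\<^bsub>SA\<^esub> ?t q))"
    using iy tq by (intro lin_maps_finsum[OF SC.S.vec_axioms SC.S.vec_axioms GR.component_lin[OF \<gamma>]] Pi_I SC.S.m_closed)
  also have "\<dots> = (\<Oplus>\<^bsub>SA\<^esub>w\<in>\<Omega>\<^sub>1. \<iota> y w \<otimes>\<^bsub>SA\<^esub> part (\<gamma> - w) q)"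
    using iy y \<gamma> tq part_closed[OF Gam_diff[OF \<gamma> \<Omega>\<^sub>1_Gam] q]
    by (intro SC.S.finsum_cong' refl Pi_I SC.S.m_closed) (simp_all add: component_mult part_eq)
  finally show ?thesis .
qed

lemma part_monomial_support:
  assumes "\<forall>i<k. x i \<in> carrier L" "\<gamma> \<in> Gam l" "\<gamma> \<notin> sumset_pow \<Omega>\<^sub>1 k"
  shows "part \<gamma> (SL.sym_monomial x k) = \<zero>\<^bsub>SA\<^esub>"
  using assms
proof (induction k arbitrary: \<gamma>)
  case 0
  then show ?case by (simp add: part_one)
next
  case (Suc k)
  have "part (\<gamma> - w) (SL.sym_monomial x k) = \<zero>\<^bsub>SA\<^esub>" if w: "w \<in> \<Omega>\<^sub>1" for w
  proof (rule Suc.IH)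
    show "\<gamma> - w \<notin> sumset_pow \<Omega>\<^sub>1 k"
    proof
      assume "\<gamma> - w \<in> sumset_pow \<Omega>\<^sub>1 k"
      with w have "w + (\<gamma> - w) \<in> \<Omega>\<^sub>1 + sumset_pow \<Omega>\<^sub>1 k" by (rule set_plus_intro)
      with Suc.prems show False by simp
    qed
  qed (use Suc.prems w Gam_diff[OF _ \<Omega>\<^sub>1_Gam] in auto)
  moreover have xk: "x k \<in> carrier L" "SL.sym_monomial x k \<in> carrier (sym_alg L)"
    using Suc.prems SL.sym_monomial_closed[of k x] by auto
  ultimately have "(\<Oplus>\<^bsub>SA\<^esub>w\<in>\<Omega>\<^sub>1. \<iota> (x k) w \<otimes>\<^bsub>SA\<^esub> part (\<gamma> - w) (SL.sym_monomial x k)) = \<zero>\<^bsub>SA\<^esub>"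
    by (intro SC.S.add.finprod_one_eqI) (simp add: incl_closed)
  then show ?case
    using Suc.prems xk by (simp only: SL.sym_monomial_Suc part_mult)
qed

lemma part_sym_power:
  assumes "q \<in> sym_power L k" and "\<gamma> \<in> Gam l"
  shows "part \<gamma> q \<in> sym_power C k"
proof -
  have mon: "part \<gamma> (SL.sym_monomial x k) \<in> sym_power C k"
    if "\<forall>i<k. x i \<in> carrier L" "\<gamma> \<in> Gam l" for x \<gamma>
    using that
  proof (induction k arbitrary: \<gamma>)
    case 0
    have "\<one>\<^bsub>SA\<^esub> \<in> sym_power C 0" using SC.sym_monomial_power[of 0] by simp
    then show ?case
      using 0 SC.sym_power_subspace[of 0] by (simp add: part_one lin_subspace_def)
  next
    case (Suc k)
    have xk: "x k \<in> carrier L" "SL.sym_monomial x k \<in> carrier (sym_alg L)"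
      using Suc.prems SL.sym_monomial_closed[of k x] by auto
    have "(\<Oplus>\<^bsub>SA\<^esub>w\<in>\<Omega>\<^sub>1. \<iota> (x k) w \<otimes>\<^bsub>SA\<^esub> part (\<gamma> - w) (SL.sym_monomial x k)) \<in> sym_power C (Suc k)"
    proof (rule SC.S.subspace_finsum[OF SC.sym_power_subspace])
      fix w assume w: "w \<in> \<Omega>\<^sub>1"
      show "\<iota> (x k) w \<otimes>\<^bsub>SA\<^esub> part (\<gamma> - w) (SL.sym_monomial x k) \<in> sym_power C (Suc k)"
        unfolding \<iota>_def using w xk Suc.prems Gam_diff[OF _ \<Omega>\<^sub>1_Gam[OF w]]
        by (intro SC.sym_power_mult tens_closed tau_closed Suc.IH) auto
    qed
    then show ?case using Suc.prems xk by (simp only: SL.sym_monomial_Suc part_mult)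
  qed
  have "lin_subspace (sym_alg L) {q \<in> carrier (sym_alg L). part \<gamma> q \<in> sym_power C k}"
    by (rule lin_maps_preimage[OF SL.S.vec_axioms SC.S.vec_axioms part_lin[OF assms(2)] SC.sym_power_subspace])
  then have "sym_power L k \<subseteq> {q \<in> carrier (sym_alg L). part \<gamma> q \<in> sym_power C k}"
    by (rule SL.sym_power_minimal) (use mon assms(2) SL.sym_monomial_closed in blast)
  with assms show ?thesis by blast
qed

text \<open>
  The degrees at which truncation interferes. For \<open>\<sigma>, v \<in> \<Omega>\<^sub>1\<close> with \<open>v - \<sigma> \<notin> \<Omega>\<^sub>1\<close>, a factor with exponent
  \<open>v\<close> cannot have come from the action of \<open>x \<otimes> \<tau>\<^sup>\<sigma>\<close>, and then \<open>v - \<sigma> \<in> \<Delta>\<close>.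
\<close>
definition \<Delta> where "\<Delta> = diffset \<Omega>\<^sub>1 \<Omega>\<^sub>1 - \<Omega>\<^sub>1"

text \<open>
  The degrees \<open>\<gamma>\<close> that are a sum of an element of \<open>\<Delta>\<close> and the \<open>k - 1\<close> exponents of the other factors.
  For \<open>k = 0\<close> there is no factor on which truncation could interfere.
\<close>
fun obstruction where
  "obstruction 0 = {}"
| "obstruction (Suc k) = \<Delta> + sumset_pow \<Omega>\<^sub>1 k"

lemma current_ad_lin: "z \<in> carrier C \<Longrightarrow> bracket C z \<in> lin_maps C C"
  using current_bracket_bilin by (simp add: bilin_maps_def)

lemma action_incl:
  assumes "y \<in> carrier L" "v \<in> Omg l" "x \<in> carrier L" "w \<in> Omg l"
  shows "sym_action C (tens y (\<tau> v)) (\<iota> x w) = \<iota> (bracket L y x) (v + w)"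
  unfolding \<iota>_def using assms
  by (simp add: sym_action_derivation(2)[OF C.vec_axioms current_ad_lin] tens_closed tau_closed bracket_tens tau_mult)

text \<open>
  The heart of the proof: the action commutes with taking components, up to a shift of the degree.
  Split off the factor \<open>x\<^sub>k\<close> and apply the product rule on both sides. The summands in which the
  action falls on the other factors agree by induction, because \<open>\<gamma> \<notin> \<Delta> + \<Omega>\<^sub>1\<^sup>k\<close> implies
  \<open>\<gamma> - w \<notin> \<Delta> + \<Omega>\<^sub>1\<^bsup>k-1\<^esup>\<close> for \<open>w \<in> \<Omega>\<^sub>1\<close>. The summands in which it falls on \<open>x\<^sub>k\<close> form the same sum of
  terms \<open>g v\<close>, on the one side over \<open>v \<in> \<sigma> + \<Omega>\<^sub>1\<close> and on the other side over \<open>v \<in> \<Omega>\<^sub>1\<close>; where the two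
  index sets differ the terms vanish.
\<close>
lemma action_part_monomial:
  assumes "\<forall>i<k. x i \<in> carrier L" "y \<in> carrier L" "\<sigma> \<in> \<Omega>\<^sub>1" "\<gamma> \<in> Gam l" "\<gamma> \<notin> obstruction k"
  shows "sym_action C (tens y (\<tau> \<sigma>)) (part \<gamma> (SL.sym_monomial x k)) =
    part (\<gamma> + \<sigma>) (sym_action L y (SL.sym_monomial x k))"
  using assms
proof (induction k arbitrary: \<gamma>)
  case 0
  have D: "sym_action C (tens y (\<tau> \<sigma>)) \<in> derivations SA"
    using 0 by (intro sym_action_derivation(1) C.vec_axioms current_ad_lin tens_closed tau_closed) auto
  have E: "sym_action L y \<in> derivations (sym_alg L)"
    using 0 by (intro sym_action_derivation(1) L.vec_axioms bracket_lin_right)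
  have \<gamma>\<sigma>: "\<gamma> + \<sigma> \<in> Gam l" by (rule Gam_add[OF 0(4) \<Omega>\<^sub>1_Gam[OF 0(3)]])
  show ?case
    using 0 \<gamma>\<sigma> lin_maps_zero[OF SC.S.vec_axioms SC.S.vec_axioms derivations_lin[OF D]]
      lin_maps_zero[OF SL.S.vec_axioms SC.S.vec_axioms part_lin[OF \<gamma>\<sigma>]]
    by (simp add: part_one SL.S.derivations_one[OF E] SC.S.derivations_one[OF D])
next
  case (Suc k)
  let ?m = "SL.sym_monomial x k" and ?D = "sym_action C (tens y (\<tau> \<sigma>))" and ?E = "sym_action L y"
  let ?z = "bracket L y (x k)"
  have D: "?D \<in> derivations SA"
    using Suc.prems by (intro sym_action_derivation(1) C.vec_axioms current_ad_lin tens_closed tau_closed) auto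
  have E: "?E \<in> derivations (sym_alg L)"
    using Suc.prems by (intro sym_action_derivation(1) L.vec_axioms bracket_lin_right)
  have xk: "x k \<in> carrier L" and m: "?m \<in> carrier (sym_alg L)" and \<sigma>: "\<sigma> \<in> Omg l"
    using Suc.prems SL.sym_monomial_closed[of k x] by auto
  have z: "?z \<in> carrier L" using xk Suc.prems by (intro bracket_closed)
  have Em: "?E ?m \<in> carrier (sym_alg L)" by (rule lin_maps_closed[OF derivations_lin[OF E] m])
  have \<gamma>\<sigma>: "\<gamma> + \<sigma> \<in> Gam l" by (rule Gam_add[OF Suc.prems(4) \<Omega>\<^sub>1_Gam[OF Suc.prems(3)]])
  have \<gamma>w: "\<gamma> - w \<in> Gam l" "\<gamma> + \<sigma> - w \<in> Gam l" if "w \<in> Omg l" for w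
    using Gam_diff[OF _ Omg_Gam[OF that]] Suc.prems \<gamma>\<sigma> by auto
  \<comment> \<open>The summands with the action on \<open>x\<^sub>k\<close>, in terms of the exponent \<open>v\<close> after the action.\<close>
  define g where "g v = \<iota> ?z v \<otimes>\<^bsub>SA\<^esub> part (\<gamma> + \<sigma> - v) ?m" for v
  have g: "g v \<in> carrier SA" if "v \<in> Omg l" for v
    unfolding g_def using that z m by (intro SC.S.m_closed incl_closed part_closed \<gamma>w)
  \<comment> \<open>The summands with the action on one of the other factors.\<close>
  define h where "h w = \<iota> (x k) w \<otimes>\<^bsub>SA\<^esub> part (\<gamma> + \<sigma> - w) (?E ?m)" for w
  have h: "h w \<in> carrier SA" if "w \<in> Omg l" for w
    unfolding h_def using that xk Em by (intro SC.S.m_closed incl_closed part_closed \<gamma>w)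
  have step: "?D (\<iota> (x k) w \<otimes>\<^bsub>SA\<^esub> part (\<gamma> - w) ?m) = g (\<sigma> + w) \<oplus>\<^bsub>SA\<^esub> h w" if w: "w \<in> \<Omega>\<^sub>1" for w
  proof -
    have wO: "w \<in> Omg l" using w by blast
    have "\<gamma> - w \<notin> obstruction k"
    proof (cases k)
      case (Suc j)
      show ?thesis
      proof
        assume "\<gamma> - w \<in> obstruction k"
        then obtain a b where ab: "a \<in> \<Delta>" "b \<in> sumset_pow \<Omega>\<^sub>1 j" "\<gamma> - w = a + b"
          using Suc by (auto elim: set_plus_elim)
        then have "\<gamma> = a + (w + b)" by (simp add: algebra_simps)
        moreover have "w + b \<in> sumset_pow \<Omega>\<^sub>1 k" using w ab Suc by (simp add: set_plus_intro)
        ultimately show False using ab(1) Suc.prems(5) set_plus_intro[of a \<Delta>] by simp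
      qed
    qed simp
    then have IH: "?D (part (\<gamma> - w) ?m) = part (\<gamma> + \<sigma> - w) (?E ?m)"
      using Suc.IH[of "\<gamma> - w"] Suc.prems \<gamma>w(1)[OF wO] by (simp add: algebra_simps)
    have "?D (\<iota> (x k) w \<otimes>\<^bsub>SA\<^esub> part (\<gamma> - w) ?m) =
        \<iota> ?z (\<sigma> + w) \<otimes>\<^bsub>SA\<^esub> part (\<gamma> - w) ?m \<oplus>\<^bsub>SA\<^esub> \<iota> (x k) w \<otimes>\<^bsub>SA\<^esub> part (\<gamma> + \<sigma> - w) (?E ?m)"
      using derivations_mult[OF D incl_closed[OF xk wO] part_closed[OF \<gamma>w(1)[OF wO] m]]
      by (simp only: IH action_incl[OF Suc.prems(2) \<sigma> xk wO])
    then show ?thesis by (simp add: g_def h_def)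
  qed
  have shift: "(\<Oplus>\<^bsub>SA\<^esub>w\<in>\<Omega>\<^sub>1. g (\<sigma> + w)) = (\<Oplus>\<^bsub>SA\<^esub>v\<in>\<Omega>\<^sub>1. g v)"
  proof -
    have "(\<Oplus>\<^bsub>SA\<^esub>w\<in>\<Omega>\<^sub>1. g (\<sigma> + w)) = (\<Oplus>\<^bsub>SA\<^esub>v\<in>(+) \<sigma> ` \<Omega>\<^sub>1. g v)"
      using g \<sigma> Omg_add by (intro SC.S.finsum_reindex[symmetric]) auto
    also have "\<dots> = (\<Oplus>\<^bsub>SA\<^esub>v\<in>\<Omega>\<^sub>1. g v)"
    proof (rule SC.S.add.finprod_mono_neutral_cong)
      \<comment> \<open>If the remaining factors had exponents with sum \<open>\<gamma> + \<sigma> - v\<close>, then \<open>\<gamma> = (v - \<sigma>) + (\<gamma> + \<sigma> - v)\<close> would be excluded.\<close>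
      fix v assume v: "v \<in> \<Omega>\<^sub>1 - (+) \<sigma> ` \<Omega>\<^sub>1"
      have "v - \<sigma> \<notin> \<Omega>\<^sub>1"
      proof
        assume "v - \<sigma> \<in> \<Omega>\<^sub>1"
        then have "\<sigma> + (v - \<sigma>) \<in> (+) \<sigma> ` \<Omega>\<^sub>1" by (rule imageI)
        with v show False by simp
      qed
      then have "v - \<sigma> \<in> \<Delta>" using v Suc.prems(3) unfolding \<Delta>_def diffset_def by blast
      moreover have "\<gamma> = (v - \<sigma>) + (\<gamma> + \<sigma> - v)" by simp
      ultimately have "\<gamma> + \<sigma> - v \<notin> sumset_pow \<Omega>\<^sub>1 k"
        using Suc.prems(5) set_plus_intro[of "v - \<sigma>" \<Delta> "\<gamma> + \<sigma> - v" "sumset_pow \<Omega>\<^sub>1 k"] by auto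
      then have "part (\<gamma> + \<sigma> - v) ?m = \<zero>\<^bsub>SA\<^esub>"
        using Suc.prems v \<gamma>w by (intro part_monomial_support) auto
      then show "g v = \<zero>\<^bsub>SA\<^esub>" unfolding g_def using v z by (simp add: incl_closed)
    next
      \<comment> \<open>Here the action leads into the ideal.\<close>
      fix v assume v: "v \<in> (+) \<sigma> ` \<Omega>\<^sub>1 - \<Omega>\<^sub>1"
      then have vO: "v \<in> Omg l" "v \<in> \<Omega>\<^sub>0" using \<sigma> Omg_add by auto
      then show "g v = \<zero>\<^bsub>SA\<^esub>"
        unfolding g_def using z m \<gamma>w by (simp add: incl_zero part_closed)
    qed (use g \<sigma> Omg_add \<Omega>\<^sub>1_finite in auto)
    finally show ?thesis .
  qed
  have "?D (part \<gamma> (SL.sym_monomial x (Suc k))) = ?D (\<Oplus>\<^bsub>SA\<^esub>w\<in>\<Omega>\<^sub>1. \<iota> (x k) w \<otimes>\<^bsub>SA\<^esub> part (\<gamma> - w) ?m)"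
    using Suc.prems xk m by (simp only: SL.sym_monomial_Suc part_mult)
  also have "\<dots> = (\<Oplus>\<^bsub>SA\<^esub>w\<in>\<Omega>\<^sub>1. ?D (\<iota> (x k) w \<otimes>\<^bsub>SA\<^esub> part (\<gamma> - w) ?m))"
    using xk m \<gamma>w
    by (intro lin_maps_finsum[OF SC.S.vec_axioms SC.S.vec_axioms derivations_lin[OF D]] Pi_I SC.S.m_closed incl_closed part_closed) auto
  also have "\<dots> = (\<Oplus>\<^bsub>SA\<^esub>w\<in>\<Omega>\<^sub>1. g (\<sigma> + w) \<oplus>\<^bsub>SA\<^esub> h w)"
    using step g h \<sigma> Omg_add by (intro SC.S.finsum_cong' refl) auto
  also have "\<dots> = (\<Oplus>\<^bsub>SA\<^esub>w\<in>\<Omega>\<^sub>1. g (\<sigma> + w)) \<oplus>\<^bsub>SA\<^esub> (\<Oplus>\<^bsub>SA\<^esub>w\<in>\<Omega>\<^sub>1. h w)"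
    using g h \<sigma> Omg_add by (intro SC.S.finsum_addf) auto
  also have "\<dots> = part (\<gamma> + \<sigma>) (sym_incl L ?z \<otimes>\<^bsub>sym_alg L\<^esub> ?m) \<oplus>\<^bsub>SA\<^esub> part (\<gamma> + \<sigma>) (sym_incl L (x k) \<otimes>\<^bsub>sym_alg L\<^esub> ?E ?m)"
  proof -
    have "part (\<gamma> + \<sigma>) (sym_incl L ?z \<otimes>\<^bsub>sym_alg L\<^esub> ?m) = (\<Oplus>\<^bsub>SA\<^esub>v\<in>\<Omega>\<^sub>1. g v)"
      unfolding g_def by (rule part_mult[OF z m \<gamma>\<sigma>])
    moreover have "part (\<gamma> + \<sigma>) (sym_incl L (x k) \<otimes>\<^bsub>sym_alg L\<^esub> ?E ?m) = (\<Oplus>\<^bsub>SA\<^esub>w\<in>\<Omega>\<^sub>1. h w)"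
      unfolding h_def by (rule part_mult[OF xk Em \<gamma>\<sigma>])
    ultimately show ?thesis by (simp only: shift)
  qed
  also have "\<dots> = part (\<gamma> + \<sigma>) (sym_incl L ?z \<otimes>\<^bsub>sym_alg L\<^esub> ?m \<oplus>\<^bsub>sym_alg L\<^esub> sym_incl L (x k) \<otimes>\<^bsub>sym_alg L\<^esub> ?E ?m)"
    using z xk m Em by (intro lin_maps_add[OF part_lin[OF \<gamma>\<sigma>], symmetric] SL.S.m_closed SL.sym_incl_closed)
  also have "sym_incl L ?z \<otimes>\<^bsub>sym_alg L\<^esub> ?m \<oplus>\<^bsub>sym_alg L\<^esub> sym_incl L (x k) \<otimes>\<^bsub>sym_alg L\<^esub> ?E ?m =
      ?E (SL.sym_monomial x (Suc k))"
    using Suc.prems xk m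
    by (simp only: SL.sym_monomial_Suc derivations_mult[OF E] SL.sym_incl_closed
        sym_action_derivation(2)[OF L.vec_axioms bracket_lin_right])
  finally show ?case .
qed

lemma action_part:
  assumes "q \<in> sym_power L k" "y \<in> carrier L" "\<sigma> \<in> \<Omega>\<^sub>1" "\<gamma> \<in> Gam l" "\<gamma> \<notin> obstruction k"
  shows "sym_action C (tens y (\<tau> \<sigma>)) (part \<gamma> q) = part (\<gamma> + \<sigma>) (sym_action L y q)"
proof -
  have D: "sym_action C (tens y (\<tau> \<sigma>)) \<in> derivations SA"
    using assms by (intro sym_action_derivation(1) C.vec_axioms current_ad_lin tens_closed tau_closed) auto
  have E: "sym_action L y \<in> derivations (sym_alg L)"
    using assms by (intro sym_action_derivation(1) L.vec_axioms bracket_lin_right)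
  have \<gamma>\<sigma>: "\<gamma> + \<sigma> \<in> Gam l" by (rule Gam_add[OF assms(4) \<Omega>\<^sub>1_Gam[OF assms(3)]])
  let ?U = "{q \<in> carrier (sym_alg L). sym_action C (tens y (\<tau> \<sigma>)) (part \<gamma> q) = part (\<gamma> + \<sigma>) (sym_action L y q)}"
  have "lin_subspace (sym_alg L) ?U"
    by (rule lin_maps_eq_subspace[OF SL.S.vec_axioms SC.S.vec_axioms
        lin_maps_comp[OF part_lin[OF assms(4)] derivations_lin[OF D]]
        lin_maps_comp[OF derivations_lin[OF E] part_lin[OF \<gamma>\<sigma>]]])
  then have "sym_power L k \<subseteq> ?U"
    by (rule SL.sym_power_minimal) (use action_part_monomial assms SL.sym_monomial_closed in blast)
  with assms(1) show ?thesis by blast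
qed

text \<open>
  It suffices to let the generators \<open>y \<otimes> \<tau>\<^sup>\<sigma>\<close> act, and they lead to the degree \<open>\<gamma> + \<sigma>\<close> component of
  the image of \<open>y \<cdot> p = 0\<close>.
\<close>
lemma part_invariant:
  assumes p: "p \<in> sym_power L k" "p \<in> sym_invariants L" and \<gamma>: "\<gamma> \<in> Gam l" "\<gamma> \<notin> obstruction k"
  shows "part \<gamma> p \<in> sym_invariants C"
proof -
  have pc: "p \<in> carrier (sym_alg L)" using p(2) by (simp add: sym_invariants_def)
  have qc: "part \<gamma> p \<in> carrier SA" using \<gamma>(1) pc by (rule part_closed)
  have "lin_subspace C {z \<in> carrier C. sym_action C z (part \<gamma> p) \<in> {\<zero>\<^bsub>SA\<^esub>}}"
    by (rule lin_maps_preimage[OF C.vec_axioms SC.S.vec_axioms sym_action_lin[OF C.vec_axioms current_bracket_bilin qc]]) (simp add: lin_subspace_def)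
  then have "carrier C \<subseteq> {z \<in> carrier C. sym_action C z (part \<gamma> p) \<in> {\<zero>\<^bsub>SA\<^esub>}}"
  proof (rule current_generated)
    fix y \<sigma> assume y: "y \<in> carrier L" and \<sigma>: "\<sigma> \<in> \<Omega>\<^sub>1"
    have "sym_action C (tens y (\<tau> \<sigma>)) (part \<gamma> p) = part (\<gamma> + \<sigma>) \<zero>\<^bsub>sym_alg L\<^esub>"
      using action_part[OF p(1) y \<sigma> \<gamma>] p(2) y by (simp add: sym_invariants_def)
    also have "\<dots> = \<zero>\<^bsub>SA\<^esub>"
      by (rule lin_maps_zero[OF SL.S.vec_axioms SC.S.vec_axioms part_lin[OF Gam_add[OF \<gamma>(1) \<Omega>\<^sub>1_Gam[OF \<sigma>]]]])
    finally show "tens y (\<tau> \<sigma>) \<in> {z \<in> carrier C. sym_action C z (part \<gamma> p) \<in> {\<zero>\<^bsub>SA\<^esub>}}"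
      using y \<sigma> tens_closed tau_closed by simp
  qed
  with qc show ?thesis by (auto simp: sym_invariants_def)
qed

end

theorem proposition3p8:
  fixes L :: "('f::field_char_0, 'v) lie_alg"
    and l k :: nat
    and \<Omega>\<^sub>0 \<Omega>\<^sub>1 :: "(nat \<Rightarrow>\<^sub>0 int) set"
    and p :: "('v multiset \<Rightarrow>\<^sub>0 'f) set"
  assumes "lie_algebra L"
    and "fin_dim L"
    and "\<Omega>\<^sub>0 \<subseteq> Omg l"
    and "\<And>\<omega> \<gamma>. \<lbrakk>\<omega> \<in> Omg l; \<gamma> \<in> \<Omega>\<^sub>0\<rbrakk> \<Longrightarrow> \<omega> + \<gamma> \<in> \<Omega>\<^sub>0"
    and "\<Omega>\<^sub>1 = Omg l - \<Omega>\<^sub>0"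
    and "finite \<Omega>\<^sub>1"
    and "k \<ge> 1"
    and "p \<in> sym_power L k \<inter> sym_invariants L"
  shows "\<forall>\<gamma>\<in>Gam l.
           \<gamma> \<notin> (\<Union>j\<in>{1..k}. sumset_pow (diffset \<Omega>\<^sub>1 \<Omega>\<^sub>1 - \<Omega>\<^sub>1) j + sumset_pow \<Omega>\<^sub>1 (k - j)) \<longrightarrow>
           p_component l \<Omega>\<^sub>0 L p \<gamma>
             \<in> sym_power (current l \<Omega>\<^sub>0 L) k \<inter> sym_invariants (current l \<Omega>\<^sub>0 L)"
proof (intro ballI impI)
  interpret K: truncated_current l \<Omega>\<^sub>0 L
    using assms by (intro truncated_current.intro truncation.intro truncated_current_axioms.intro) simp_all
  fix \<gamma> assume \<gamma>: "\<gamma> \<in> Gam l"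
    and notin: "\<gamma> \<notin> (\<Union>j\<in>{1..k}. sumset_pow (diffset \<Omega>\<^sub>1 \<Omega>\<^sub>1 - \<Omega>\<^sub>1) j + sumset_pow \<Omega>\<^sub>1 (k - j))"
  obtain k' where k: "k = Suc k'" using assms(7) by (cases k) auto
  have "\<gamma> \<notin> sumset_pow (diffset \<Omega>\<^sub>1 \<Omega>\<^sub>1 - \<Omega>\<^sub>1) 1 + sumset_pow \<Omega>\<^sub>1 (k - 1)"
    using notin assms(7) by (metis UN_I atLeastAtMost_iff order_refl)
  then have "\<gamma> \<notin> K.obstruction k"
    using assms(5) by (simp add: k K.\<Delta>_def flip: set_zero)
  then show "p_component l \<Omega>\<^sub>0 L p \<gamma> \<in> sym_power (current l \<Omega>\<^sub>0 L) k \<inter> sym_invariants (current l \<Omega>\<^sub>0 L)"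
    using K.part_sym_power[of p k \<gamma>] K.part_invariant[of p k \<gamma>] assms(8) \<gamma>
    by (simp add: K.part_def K.current_eq)
qed

end
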